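(* Let $X_m$ be a generic symmetric $m\times m$ matrix (entries $x_{ij}=x_{ji}$, with $x_{ij}$, $i\le j$, distinct indeterminates) and let $I_m$ be the ideal generated by the $2\times2$ minors of $X_m$ in the polynomial ring $\mathbb{K}[x_{ij}\mid 1\le i\le j\le m]$. Then $I_m$ is differentially perfect. In particular, for all integers $r,s\ge1$ the set $$\Big\{\prod_{i=1}^{l}f_i\ \Big|\ f_i\in\mathcal{M}_{r+1}(X_m),\ \sum_{i=1}^{l}(\deg f_i-r)=s\Big\}$$ forms a Gröbner basis for the symbolic power $\left(I_m^{\{r\}}\right)^{(s)}$ with respect to any diagonal term order.
   Context: $\mathbb{K}$ is an algebraically closed field and $R=\mathbb{K}[\mathbf{x}]$ is the polynomial ring in the indeterminates. For a matrix $X$, $\mathcal{M}_r(X)$ is the set of all $t\times t$ minors of $X$ for all $t\ge r$; $l\ge1$ is arbitrary. A diagonal term order is any term order that selects the product of the main diagonal entries of any square submatrix of $X_m$ as the leading monomial of the corresponding minor. Symbolic power: $I^{(r)}=(R_I^{-1}I^r)\cap R$, where $R_I$ is the complement of the union of the minimal primes of $I$. Join and secant ideals: $I\ast J=\big(I(\mathbf{y})+J(\mathbf{z})+\langle x_a-y_a-z_a\mid a\rangle\big)\cap\mathbb{K}[\mathbf{x}]$ ($a$ running over the indices of the variables), where $I(\mathbf{y})$ is $I$ with $y_a$ substituted for $x_a$; the $r$-th secant ideal is the $r$-fold join $I^{\{r\}}=I\ast\cdots\ast I$ (so $I^{\{1\}}=I$). An ideal $I$ is $r$-differentially perfect if for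 all $s\ge1$, $(I^{\{r\}})^{(s)}=I^{\{r+s-1\}}+\sum_{i=1}^{s-1}(I^{\{r\}})^{(i)}(I^{\{r\}})^{(s-i)}$; it is differentially perfect if it is $r$-differentially perfect for all $r\ge1$. *)

theory Defs
  imports
    "HOL-Library.Poly_Mapping"
    "HOL-Library.Set_Algebras"
    "HOL-Library.Uprod"
    "HOL-Computational_Algebra.Polynomial"
    "Jordan_Normal_Form.Determinant"
begin

section \<open>Ideals of a commutative ring\<close>

text \<open>
  An ideal is a submodule of the ring over itself, so \<open>ideal.subspace\<close> is ``is an ideal'' and
  \<open>ideal.span\<close> is ``ideal generated by''.  Sums of ideals are the elementwise sums of sets
  from \<open>Set_Algebras\<close>; the empty sum is the zero ideal.
\<close>

interpretation ideal: Modules.module "times :: 'a::comm_ring_1 \<Rightarrow> 'a \<Rightarrow> 'a"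
  by unfold_locales (simp_all add: algebra_simps)

definition ideal_mult :: "'a::comm_ring_1 set \<Rightarrow> 'a set \<Rightarrow> 'a set" where
  "ideal_mult I J = ideal.span {a * b | a b. a \<in> I \<and> b \<in> J}"

primrec ideal_power :: "'a::comm_ring_1 set \<Rightarrow> nat \<Rightarrow> 'a set" where
  "ideal_power I 0 = UNIV"
| "ideal_power I (Suc n) = ideal_mult I (ideal_power I n)"

definition is_prime_ideal :: "'a::comm_ring_1 set \<Rightarrow> bool" where
  "is_prime_ideal P \<longleftrightarrow>
    ideal.subspace P \<and> P \<noteq> UNIV \<and> (\<forall>a b. a * b \<in> P \<longrightarrow> a \<in> P \<or> b \<in> P)"

definition minimal_primes :: "'a::comm_ring_1 set \<Rightarrow> 'a set set" where
  "minimal_primes I =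
    {P. is_prime_ideal P \<and> I \<subseteq> P \<and> (\<forall>Q. is_prime_ideal Q \<and> I \<subseteq> Q \<and> Q \<subseteq> P \<longrightarrow> Q = P)}"

text \<open>
  \<open>R\<^sub>I\<close> is the complement of \<open>\<Union>(minimal_primes I)\<close>.  An element \<open>f\<close> of the ring lies in
  \<open>R\<^sub>I\<inverse> I\<^sup>r\<close> iff its image in the localization equals a fraction \<open>a / u\<close> with \<open>a \<in> I\<^sup>r\<close>
  and \<open>u \<in> R\<^sub>I\<close>; equality of the fractions \<open>f / 1\<close> and \<open>a / u\<close> in \<open>R\<^sub>I\<inverse> R\<close> means
  \<open>w * (u * f - a) = 0\<close> for some \<open>w \<in> R\<^sub>I\<close>.
\<close>

definition symbolic_power :: "'a::comm_ring_1 set \<Rightarrow> nat \<Rightarrow> 'a set" where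
  "symbolic_power I r =
    (let S = - \<Union>(minimal_primes I)
     in {f. \<exists>a \<in> ideal_power I r. \<exists>u \<in> S. \<exists>w \<in> S. w * (u * f - a) = 0})"


section \<open>Polynomial rings\<close>

text \<open>
  Polynomials with coefficients in \<open>'k\<close> and indeterminates indexed by the type \<open>'v\<close>, as finitely
  supported maps from monomials (finitely supported exponent vectors) to coefficients.
\<close>

type_synonym 'v monom = "'v \<Rightarrow>\<^sub>0 nat"
type_synonym ('v, 'k) mpoly = "'v monom \<Rightarrow>\<^sub>0 'k"

definition Var :: "'v \<Rightarrow> ('v, 'k::comm_ring_1) mpoly" where
  "Var v = Poly_Mapping.single (Poly_Mapping.single v 1) 1"

definition total_degree :: "('v, 'k::zero) mpoly \<Rightarrow> nat" where
  "total_degree f =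
    Max (insert 0 ((\<lambda>t. \<Sum>v\<in>Poly_Mapping.keys t. Poly_Mapping.lookup t v) ` Poly_Mapping.keys f))"

definition subst_poly ::
  "('v \<Rightarrow> ('w, 'k::comm_ring_1) mpoly) \<Rightarrow> ('v, 'k) mpoly \<Rightarrow> ('w, 'k) mpoly" where
  "subst_poly \<sigma> f =
    (\<Sum>t\<in>Poly_Mapping.keys f. Poly_Mapping.single 0 (Poly_Mapping.lookup f t) *
      (\<Prod>v\<in>Poly_Mapping.keys t. \<sigma> v ^ Poly_Mapping.lookup t v))"


section \<open>Joins, secant ideals, differential perfection\<close>

datatype 'v xyz = XVar 'v | YVar 'v | ZVar 'v

text \<open>
  The intersection with \<open>\<K>[x]\<close> is taken along the inclusion of \<open>\<K>[x]\<close> into \<open>\<K>[x, y, z]\<close>.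
\<close>

definition ideal_join ::
  "('v, 'k::comm_ring_1) mpoly set \<Rightarrow> ('v, 'k) mpoly set \<Rightarrow> ('v, 'k) mpoly set" where
  "ideal_join I J =
    {f. subst_poly (\<lambda>a. Var (XVar a)) f \<in>
          ideal.span (subst_poly (\<lambda>a. Var (YVar a)) ` I)
        + ideal.span (subst_poly (\<lambda>a. Var (ZVar a)) ` J)
        + ideal.span {Var (XVar a) - Var (YVar a) - Var (ZVar a) | a. True}}"

text \<open>The \<open>r\<close>-fold join; only meaningful for \<open>r \<ge> 1\<close>.\<close>

definition secant_ideal :: "('v, 'k::comm_ring_1) mpoly set \<Rightarrow> nat \<Rightarrow> ('v, 'k) mpoly set" where
  "secant_ideal I r = (ideal_join I ^^ (r - 1)) I"

definition r_differentially_perfect :: "nat \<Rightarrow> ('v, 'k::comm_ring_1) mpoly set \<Rightarrow> bool" where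
  "r_differentially_perfect r I \<longleftrightarrow>
    (\<forall>s\<ge>1. symbolic_power (secant_ideal I r) s =
       secant_ideal I (r + s - 1) +
       (\<Sum>i = 1..s - 1. ideal_mult (symbolic_power (secant_ideal I r) i)
                                   (symbolic_power (secant_ideal I r) (s - i))))"

definition differentially_perfect :: "('v, 'k::comm_ring_1) mpoly set \<Rightarrow> bool" where
  "differentially_perfect I \<longleftrightarrow> (\<forall>r\<ge>1. r_differentially_perfect r I)"


section \<open>Term orders and Groebner bases\<close>

text \<open>Term orders are given as reflexive relations on monomials, \<open>leq s t\<close> meaning \<open>s \<le> t\<close>.\<close>

definition term_order :: "('v monom \<Rightarrow> 'v monom \<Rightarrow> bool) \<Rightarrow> bool" where
  "term_order leq \<longleftrightarrow>
    reflp leq \<and> transp leq \<and> antisymp leq \<and> totalp leq \<and>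
    (\<forall>t. leq 0 t) \<and> (\<forall>s t u. leq s t \<longrightarrow> leq (s + u) (t + u))"

definition lead_monom :: "('v monom \<Rightarrow> 'v monom \<Rightarrow> bool) \<Rightarrow> ('v, 'k::zero) mpoly \<Rightarrow> 'v monom" where
  "lead_monom leq f =
    (THE t. t \<in> Poly_Mapping.keys f \<and> (\<forall>s\<in>Poly_Mapping.keys f. leq s t))"

definition initial_ideal ::
  "('v monom \<Rightarrow> 'v monom \<Rightarrow> bool) \<Rightarrow> ('v, 'k::comm_ring_1) mpoly set \<Rightarrow> ('v, 'k) mpoly set" where
  "initial_ideal leq F =
    ideal.span ((\<lambda>f. Poly_Mapping.single (lead_monom leq f) 1) ` (F - {0}))"

definition is_groebner_basis ::
  "('v monom \<Rightarrow> 'v monom \<Rightarrow> bool) \<Rightarrow> ('v, 'k::field) mpoly set \<Rightarrow> ('v, 'k) mpoly set \<Rightarrow> bool" where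
  "is_groebner_basis leq G I \<longleftrightarrow> finite G \<and> G \<subseteq> I \<and> initial_ideal leq G = initial_ideal leq I"


section \<open>The generic symmetric matrix\<close>

text \<open>
  Rows and columns are indexed by a finite linearly ordered type \<open>'m\<close>, so \<open>m = CARD('m)\<close>.
  The indeterminates are indexed by unordered pairs \<open>Upair i j = Upair j i\<close>
  (with \<open>i = j\<close> allowed), one for each \<open>i \<le> j\<close>.
\<close>

definition generic_sym :: "'m \<Rightarrow> 'm \<Rightarrow> ('m uprod, 'k::comm_ring_1) mpoly" where
  "generic_sym i j = Var (Upair i j)"

text \<open>
  The determinant of the \<open>t \<times> t\<close> submatrix with rows \<open>\<rho> 0 < \<dots> < \<rho> (t - 1)\<close> and columns
  \<open>\<gamma> 0 < \<dots> < \<gamma> (t - 1)\<close>.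
\<close>

definition minor :: "('m \<Rightarrow> 'm \<Rightarrow> 'a::comm_ring_1) \<Rightarrow> nat \<Rightarrow> (nat \<Rightarrow> 'm) \<Rightarrow> (nat \<Rightarrow> 'm) \<Rightarrow> 'a" where
  "minor A t \<rho> \<gamma> = det (mat t t (\<lambda>(a, b). A (\<rho> a) (\<gamma> b)))"

definition minors :: "('m::linorder \<Rightarrow> 'm \<Rightarrow> 'a::comm_ring_1) \<Rightarrow> nat \<Rightarrow> 'a set" where
  "minors A t =
    {minor A t \<rho> \<gamma> | \<rho> \<gamma>. strict_mono_on {..<t} \<rho> \<and> strict_mono_on {..<t} \<gamma>}"

definition minors_ge :: "nat \<Rightarrow> ('m::linorder \<Rightarrow> 'm \<Rightarrow> 'a::comm_ring_1) \<Rightarrow> 'a set" where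
  "minors_ge r A = (\<Union>t\<in>{r..}. minors A t)"

definition sym_minor_ideal :: "('m::{finite,linorder} uprod, 'k::comm_ring_1) mpoly set" where
  "sym_minor_ideal = ideal.span (minors generic_sym 2)"

text \<open>
  The type argument fixes the coefficient field over which the minors are formed.
\<close>

definition diagonal_term_order ::
  "'k::field itself \<Rightarrow> ('m::{finite,linorder} uprod monom \<Rightarrow> 'm uprod monom \<Rightarrow> bool) \<Rightarrow> bool" where
  "diagonal_term_order _ leq \<longleftrightarrow>
    term_order leq \<and>
    (\<forall>t \<rho> \<gamma>. strict_mono_on {..<t} \<rho> \<and> strict_mono_on {..<t} \<gamma> \<longrightarrow>
       lead_monom leq (minor generic_sym t \<rho> \<gamma> :: ('m uprod, 'k) mpoly) =
       (\<Sum>a<t. Poly_Mapping.single (Upair (\<rho> a) (\<gamma> a)) 1))"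

end

theory Submission
  imports Defs "HOL-Library.Product_Lexorder"
begin

text \<open>
  The ideal \<open>I\<close> of 2-minors is the kernel of \<open>x\<^sub>i\<^sub>j \<mapsto> a\<^sub>i a\<^sub>j\<close>, and the join of the kernels of two
  substitutions in disjoint variables is the kernel of their sum.  So the secant ideal \<open>J\<close> of
  \<open>I\<close> is the kernel of \<open>X \<mapsto> A A\<^sup>T\<close>, where \<open>A\<close> has \<open>r\<close> columns; it is prime, and every \<open>f\<close> in its
  \<open>s\<close>-th symbolic power satisfies: \<open>f (A A\<^sup>T + Z)\<close> vanishes to order \<open>s\<close> in \<open>Z\<close>.  Conversely a
  \<open>t\<close>-minor lies in the symbolic power of exponent \<open>t - r\<close> by block elimination.

  Variables \<open>x\<^sub>i\<^sub>j\<close> with \<open>i \<le> j\<close> are viewed as intervals, ordered by strict increase of both end points.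
  The chains are the diagonals of minors; the monomials supported on antichains (nested
  intervals) are the least ones among those with the same image under \<open>x\<^sub>i\<^sub>j \<mapsto> a\<^sub>i a\<^sub>j\<close>.  If the leading
  monomial \<open>u\<close> of \<open>f\<close> were not divisible by that of a product of minors of the required kind, then
  by the Greene--Kleitman theorem \<open>r\<close> antichains would cover all but less than \<open>s\<close> of the
  factors of \<open>u\<close>.  The resulting monomial in \<open>A\<close> and \<open>Z\<close>, of degree less than \<open>s\<close> in \<open>Z\<close>, would
  come from \<open>u\<close> only and in exactly one way, so its coefficient would be that of \<open>u\<close> in \<open>f\<close>, in any
  characteristic.  Differential perfection is read off from the generators so obtained.
\<close>

text \<open>The obstacle is cancellation: a coefficient of \<open>f (A A^T + Z)\<close> collects
  contributions of many terms of \<open>f\<close>, each possibly with a multinomial factor that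
  vanishes in small characteristic. The labelling removes both dangers. The exponents of the
  variables in the \<open>k\<close>-th column of \<open>A\<close> determine only the vertex degrees
  of the factors sent there, whereas the exponents in \<open>Z\<close> determine the factors
  themselves. As each part with label below \<open>r\<close> is least among the monomials of its
  vertex degrees, any other distribution with the same image has parts at least as large, hence
  comes from a monomial at least as large as \<open>u\<close>. But the terms of \<open>f\<close> are
  at most \<open>u\<close>, so equality holds part by part. Equal factors share one label, so no
  multinomial coefficient appears. The argument covers all diagonal orders at once, since minimality
  of nested monomials uses only the leading terms of 2-minors. Passing from leading monomials to
  ideal generators is done with one particular order, \<open>rank_order\<close>, whose lower sets
  are finite, so that division terminates by counting.\<close>

abbreviation keys where "keys \<equiv> Poly_Mapping.keys"
abbreviation lookup where "lookup \<equiv> Poly_Mapping.lookup"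
abbreviation single where "single \<equiv> Poly_Mapping.single"

text \<open>
  For the ring acting on itself this simp rule is associativity from right to left, which loops
  together with \<open>mult_ac\<close>.
\<close>
declare ideal.scale_scale [simp del]

section \<open>Unordered pairs as intervals\<close>

definition lo :: "'m::linorder uprod \<Rightarrow> 'm" where "lo e = Min (set_uprod e)"
definition hi :: "'m::linorder uprod \<Rightarrow> 'm" where "hi e = Max (set_uprod e)"

lemma lo_Upair [simp]: "lo (Upair i j) = min i j"
  by (simp add: lo_def)

lemma hi_Upair [simp]: "hi (Upair i j) = max i j"
  by (simp add: hi_def)

lemma Upair_lo_hi [simp]: "Upair (lo e) (hi e) = e"
  by (cases e) (auto simp: min_def max_def)

lemma uprod_eqI: "lo e = lo f \<Longrightarrow> hi e = hi f \<Longrightarrow> e = f"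
  by (metis Upair_lo_hi)

text \<open>This lexicographic order of the end points is auxiliary. It induces a linear order on
  monomials, which breaks ties in \<open>weight_leq\<close> and makes the polynomial rings integral
  domains; the order relevant for minors is \<open>uprec\<close>.\<close>

instantiation uprod :: (linorder) linorder
begin

definition less_eq_uprod :: "'a uprod \<Rightarrow> 'a uprod \<Rightarrow> bool" where
  "less_eq_uprod e f \<longleftrightarrow> (lo e, hi e) \<le> (lo f, hi f)"

definition less_uprod :: "'a uprod \<Rightarrow> 'a uprod \<Rightarrow> bool" where
  "less_uprod e f \<longleftrightarrow> (lo e, hi e) < (lo f, hi f)"

instance
proof
  fix e f :: "'a uprod"
  show "e \<le> f \<Longrightarrow> f \<le> e \<Longrightarrow> e = f"
    by (auto simp: less_eq_uprod_def intro: uprod_eqI)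
qed (auto simp: less_eq_uprod_def less_uprod_def)

end

section \<open>Polynomials and substitution\<close>

lemma poly_mapping_expand:
  assumes "finite A" "keys f \<subseteq> A"
  shows "f = (\<Sum>t\<in>A. single t (lookup f t))"
  using assms
  by (intro poly_mapping_eqI) (auto simp: lookup_sum lookup_single when_def in_keys_iff)

lemma sum_single_keys: "(\<Sum>t\<in>keys f. single t (lookup f t)) = f"
  by (rule poly_mapping_expand[symmetric]) auto

lemma lookup_mult_sum:
  fixes p q :: "'a::monoid_add \<Rightarrow>\<^sub>0 'b::semiring_0"
  shows "lookup (p * q) k = (\<Sum>s\<in>keys p. \<Sum>t\<in>keys q. lookup p s * lookup q t when k = s + t)"
proof -
  have "p * q = (\<Sum>s\<in>keys p. single s (lookup p s)) * (\<Sum>t\<in>keys q. single t (lookup q t))"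
    by (simp add: sum_single_keys)
  also have "\<dots> = (\<Sum>s\<in>keys p. \<Sum>t\<in>keys q. single (s + t) (lookup p s * lookup q t))"
    by (simp add: sum_product mult_single)
  finally show ?thesis
    by (simp add: lookup_sum lookup_single) (simp add: when_def eq_commute)
qed

text \<open>The convolution sum collapses to one summand, so nothing can cancel. Applied to leading
  monomials, to polynomials in disjoint variables and, in \<open>lookup_subst_image_monom\<close>,
  to the labelled decomposition.\<close>

lemma lookup_mult_unique:
  fixes p q :: "'a::monoid_add \<Rightarrow>\<^sub>0 'b::semiring_0"
  assumes "\<And>s t. s \<in> keys p \<Longrightarrow> t \<in> keys q \<Longrightarrow> s + t = a + b \<Longrightarrow> s = a \<and> t = b"
  shows "lookup (p * q) (a + b) = lookup p a * lookup q b"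
proof -
  have "lookup (p * q) (a + b) =
      (\<Sum>s\<in>keys p. \<Sum>t\<in>keys q. lookup p s * lookup q t when s = a \<and> t = b)"
    unfolding lookup_mult_sum by (intro sum.cong refl when_cong) (use assms in force)+
  also have "\<dots> = (\<Sum>s\<in>keys p. if s = a then \<Sum>t\<in>keys q. if t = b then lookup p s * lookup q t else 0 else 0)"
    by (intro sum.cong refl) (auto simp: when_def intro!: sum.neutral)
  also have "\<dots> = lookup p a * lookup q b"
    by (simp add: in_keys_iff)
  finally show ?thesis .
qed

lemma keys_mult_E:
  assumes "k \<in> keys (p * q)"
  obtains s t where "s \<in> keys p" "t \<in> keys q" "k = s + t"
  using keys_mult[of p q] assms by auto

lemma keys_add_monom: "keys (s + t) = keys s \<union> keys t" for s t :: "'v monom"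
  by (auto simp: in_keys_iff lookup_add)

abbreviation Const :: "'k::comm_ring_1 \<Rightarrow> ('v, 'k) mpoly" where
  "Const c \<equiv> single 0 c"

lemma Const_mult: "Const (a * b) = Const a * Const b"
  by (simp add: mult_single)

definition subst_monom :: "('v \<Rightarrow> ('w, 'k::comm_ring_1) mpoly) \<Rightarrow> 'v monom \<Rightarrow> ('w, 'k) mpoly" where
  "subst_monom \<sigma> t = (\<Prod>v\<in>keys t. \<sigma> v ^ lookup t v)"

lemma subst_monom_superset:
  assumes "finite A" "keys t \<subseteq> A"
  shows "subst_monom \<sigma> t = (\<Prod>v\<in>A. \<sigma> v ^ lookup t v)"
  unfolding subst_monom_def using assms
  by (intro prod.mono_neutral_left) (auto simp: in_keys_iff)

lemma subst_monom_0 [simp]: "subst_monom \<sigma> 0 = 1"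
  by (simp add: subst_monom_def)

lemma subst_monom_add: "subst_monom \<sigma> (s + t) = subst_monom \<sigma> s * subst_monom \<sigma> t"
proof -
  have "subst_monom \<sigma> u = (\<Prod>v\<in>keys s \<union> keys t. \<sigma> v ^ lookup u v)" if "u \<in> {s, t, s + t}" for u
    using that by (intro subst_monom_superset) (auto simp: keys_add_monom)
  then show ?thesis
    by (simp add: lookup_add power_add prod.distrib)
qed

lemma subst_monom_single [simp]: "subst_monom \<sigma> (single v n) = \<sigma> v ^ n"
  by (cases "n = 0") (auto simp: subst_monom_def)

lemma subst_poly_superset:
  assumes "finite A" "keys f \<subseteq> A"
  shows "subst_poly \<sigma> f = (\<Sum>t\<in>A. Const (lookup f t) * subst_monom \<sigma> t)"
  unfolding subst_poly_def subst_monom_def using assms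
  by (intro sum.mono_neutral_left) (auto simp: in_keys_iff)

lemma subst_poly_0 [simp]: "subst_poly \<sigma> 0 = 0"
  by (simp add: subst_poly_def)

lemma subst_poly_add: "subst_poly \<sigma> (f + g) = subst_poly \<sigma> f + subst_poly \<sigma> g"
proof -
  have "subst_poly \<sigma> h = (\<Sum>t\<in>keys f \<union> keys g. Const (lookup h t) * subst_monom \<sigma> t)"
    if "h \<in> {f, g, f + g}" for h
    using that keys_add[of f g] by (intro subst_poly_superset) auto
  then show ?thesis
    by (simp add: lookup_add single_add algebra_simps sum.distrib)
qed

lemma subst_poly_single: "subst_poly \<sigma> (single t c) = Const c * subst_monom \<sigma> t"
  by (subst subst_poly_superset[of "{t}"]) auto

lemma subst_poly_single_mult:
  "subst_poly \<sigma> (single s a * single t b) =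
    subst_poly \<sigma> (single s a) * subst_poly \<sigma> (single t b)"
proof -
  have "subst_poly \<sigma> (single s a * single t b) =
      (Const a * Const b) * (subst_monom \<sigma> s * subst_monom \<sigma> t)"
    by (simp only: mult_single subst_poly_single Const_mult subst_monom_add)
  then show ?thesis
    by (simp only: subst_poly_single mult_ac)
qed

lemma subst_poly_sum: "subst_poly \<sigma> (sum f A) = (\<Sum>x\<in>A. subst_poly \<sigma> (f x))"
  by (induction A rule: infinite_finite_induct) (auto simp: subst_poly_add)

lemma subst_poly_mult: "subst_poly \<sigma> (f * g) = subst_poly \<sigma> f * subst_poly \<sigma> g"
proof -
  have "subst_poly \<sigma> (f * g) =
      subst_poly \<sigma> ((\<Sum>s\<in>keys f. single s (lookup f s)) * (\<Sum>t\<in>keys g. single t (lookup g t)))"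
    by (simp add: sum_single_keys)
  also have "\<dots> = (\<Sum>s\<in>keys f. \<Sum>t\<in>keys g.
      subst_poly \<sigma> (single s (lookup f s)) * subst_poly \<sigma> (single t (lookup g t)))"
    unfolding sum_product subst_poly_sum subst_poly_single_mult ..
  also have "\<dots> = subst_poly \<sigma> f * subst_poly \<sigma> g"
    unfolding sum_product[symmetric] subst_poly_sum[symmetric]
    by (simp add: sum_single_keys)
  finally show ?thesis .
qed

lemma subst_poly_Const [simp]: "subst_poly \<sigma> (Const c) = Const c"
  by (simp add: subst_poly_single)

lemma subst_poly_1 [simp]: "subst_poly \<sigma> 1 = 1"
  using subst_poly_Const[of \<sigma> 1] by (simp del: subst_poly_Const)

lemma subst_poly_Var [simp]: "subst_poly \<sigma> (Var v) = \<sigma> v"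
  by (simp add: Var_def subst_poly_single)

lemma subst_poly_uminus: "subst_poly \<sigma> (- f) = - subst_poly \<sigma> f"
  using subst_poly_add[of \<sigma> f "- f"] by (simp add: eq_neg_iff_add_eq_0 add.commute)

lemma subst_poly_diff: "subst_poly \<sigma> (f - g) = subst_poly \<sigma> f - subst_poly \<sigma> g"
  using subst_poly_add[of \<sigma> f "- g"] by (simp add: subst_poly_uminus)

interpretation subst_poly: comm_ring_hom "subst_poly \<sigma>"
  by unfold_locales (auto simp: subst_poly_add subst_poly_mult)

lemma subst_monom_subst: "subst_poly \<tau> (subst_monom \<sigma> t) = subst_monom (\<lambda>v. subst_poly \<tau> (\<sigma> v)) t"
  by (simp add: subst_monom_def subst_poly.hom_prod subst_poly.hom_power)

lemma subst_poly_subst: "subst_poly \<tau> (subst_poly \<sigma> f) = subst_poly (\<lambda>v. subst_poly \<tau> (\<sigma> v)) f"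
  unfolding subst_poly_superset[OF finite_keys subset_refl, of _ f]
  by (simp add: subst_poly_sum subst_poly_mult subst_monom_subst)

lemma Var_power: "Var v ^ n = single (single v n) (1 :: 'k::comm_ring_1)"
  by (induction n) (auto simp: Var_def mult_single single_add[symmetric])

lemma prod_single: "(\<Prod>x\<in>A. single (t x) (1::'k::comm_ring_1)) = single (\<Sum>x\<in>A. t x) 1"
  for t :: "'a \<Rightarrow> 'v monom"
  by (induction A rule: infinite_finite_induct) (auto simp: mult_single)

lemma subst_monom_Var: "subst_monom Var t = single t 1"
  unfolding subst_monom_def Var_power prod_single
  by (simp add: sum_single_keys)

lemma subst_poly_id: "subst_poly Var f = f"
  unfolding subst_poly_superset[OF finite_keys subset_refl, of _ f] subst_monom_Var
  by (simp add: mult_single sum_single_keys)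

lemma subst_poly_induct:
  fixes \<sigma> :: "'v \<Rightarrow> ('w, 'k::comm_ring_1) mpoly"
  assumes "\<And>c. P (Const c)" "\<And>v. P (\<sigma> v)"
    "\<And>p q. P p \<Longrightarrow> P q \<Longrightarrow> P (p + q)" "\<And>p q. P p \<Longrightarrow> P q \<Longrightarrow> P (p * q)"
  shows "P (subst_poly \<sigma> f)"
proof -
  have P01: "P 0" "P 1" using assms(1)[of 0] assms(1)[of 1] by auto
  have pow: "P (p ^ n)" if "P p" for p n
    by (induction n) (auto simp: P01 assms(4) that)
  have prod: "P (prod h A)" if "\<And>x. P (h x)" for h and A :: "'v set"
    by (induction A rule: infinite_finite_induct) (auto simp: P01 assms(4) that)
  have sum: "P (sum h A)" if "\<And>x. P (h x)" for h and A :: "'v monom set"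
    by (induction A rule: infinite_finite_induct) (auto simp: P01 assms(3) that)
  show ?thesis
    unfolding subst_poly_def by (intro sum assms(4)) (intro assms(1), intro prod pow assms(2))
qed

lemma mpoly_induct [case_names Const Var add mult]:
  assumes "\<And>c. P (Const c)" "\<And>v. P (Var v)"
    "\<And>p q. P p \<Longrightarrow> P q \<Longrightarrow> P (p + q)" "\<And>p q. P p \<Longrightarrow> P q \<Longrightarrow> P (p * q)"
  shows "P f"
  using subst_poly_induct[of P Var f] assms by (simp add: subst_poly_id)

lemma subspace_neg: "ideal.subspace W \<Longrightarrow> x \<in> W \<Longrightarrow> - x \<in> W"
  using ideal.subspace_scale[of W x "-1"] by simp

lemma subspace_mult_right: "ideal.subspace W \<Longrightarrow> x \<in> W \<Longrightarrow> x * c \<in> W"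
  using ideal.subspace_scale[of W x c] by (simp add: mult.commute)

text \<open>Both substitutions induce the same map into the quotient by \<open>W\<close>. Applied to
  the relations \<open>x = y + z\<close> of a join and to setting the perturbation to zero.\<close>

lemma subst_poly_cong_mod:
  assumes W: "ideal.subspace W" and "\<And>v. \<sigma> v - \<tau> v \<in> W"
  shows "subst_poly \<sigma> f - subst_poly \<tau> f \<in> W"
proof (induction f rule: mpoly_induct)
  case (Const c)
  then show ?case using ideal.subspace_0[OF W] by simp
next
  case (Var v)
  then show ?case using assms by simp
next
  case (add p q)
  then show ?case
    using ideal.subspace_add[OF W add] by (simp add: subst_poly_add algebra_simps)
next
  case (mult p q)
  have "subst_poly \<sigma> (p * q) - subst_poly \<tau> (p * q) =
      subst_poly \<sigma> p * (subst_poly \<sigma> q - subst_poly \<tau> q) +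
      subst_poly \<tau> q * (subst_poly \<sigma> p - subst_poly \<tau> p)"
    by (simp add: subst_poly_mult algebra_simps)
  then show ?case
    using ideal.subspace_add[OF W ideal.subspace_scale[OF W mult(2)] ideal.subspace_scale[OF W mult(1)]]
    by metis
qed

definition polys_in :: "'v set \<Rightarrow> ('v, 'k::comm_ring_1) mpoly set" where
  "polys_in V = {p. \<forall>t\<in>keys p. keys t \<subseteq> V}"

lemma polys_in_Var: "v \<in> V \<Longrightarrow> Var v \<in> polys_in V"
  by (auto simp: polys_in_def Var_def split: if_splits)

lemma polys_in_Const: "Const c \<in> polys_in V"
  by (auto simp: polys_in_def split: if_splits)

lemma polys_in_add: "p \<in> polys_in V \<Longrightarrow> q \<in> polys_in V \<Longrightarrow> p + q \<in> polys_in V"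
  using keys_add[of p q] by (auto simp: polys_in_def)

lemma polys_in_mult: "p \<in> polys_in V \<Longrightarrow> q \<in> polys_in V \<Longrightarrow> p * q \<in> polys_in V"
  by (auto simp: polys_in_def keys_add_monom elim!: keys_mult_E) blast+

lemma polys_in_subst: "(\<And>v. \<sigma> v \<in> polys_in V) \<Longrightarrow> subst_poly \<sigma> f \<in> polys_in V"
  by (rule subst_poly_induct) (auto intro: polys_in_Const polys_in_add polys_in_mult)

section \<open>Monomial orders\<close>

text \<open>Weaker than \<open>term_order\<close>: that \<open>0\<close> is the least monomial fails
  for the order in \<open>zord_cancel\<close>, where a smaller \<open>zdeg\<close> makes a monomial
  larger.\<close>

locale monomial_order =
  fixes leq :: "'v monom \<Rightarrow> 'v monom \<Rightarrow> bool"
  assumes leq_antisym: "leq s t \<Longrightarrow> leq t s \<Longrightarrow> s = t"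
    and leq_trans: "leq s t \<Longrightarrow> leq t u \<Longrightarrow> leq s u"
    and leq_total: "leq s t \<or> leq t s"
    and leq_add: "leq s t \<Longrightarrow> leq (s + u) (t + u)"
begin

lemma leq_refl: "leq s s"
  using leq_total[of s s] by auto

lemma leq_add_mono: "leq s t \<Longrightarrow> leq u v \<Longrightarrow> leq (s + u) (t + v)"
  using leq_add[of s t u] leq_add[of u v t] leq_trans by (simp add: add.commute)

lemma leq_add_mono_eqD:
  assumes "leq s t" "leq u v" "s + u = t + v"
  shows "s = t" "u = v"
proof -
  have "leq (t + u) (s + u)" using leq_add_mono[OF leq_refl[of t] assms(2)] assms(3) by simp
  then have "t + u = s + u" using leq_add[OF assms(1), of u] leq_antisym by blast
  then show "s = t" by simp
  then show "u = v" using assms(3) by simp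
qed

lemma leq_sum_mono: "(\<And>x. x \<in> A \<Longrightarrow> leq (f x) (g x)) \<Longrightarrow> leq (sum f A) (sum g A)"
  by (induction A rule: infinite_finite_induct) (auto intro: leq_refl leq_add_mono)

text \<open>By cancellation in the monoid of monomials, a strict inequality in one place would
  survive in the sum. \<open>part_unique\<close> rests on this rigidity.\<close>

lemma leq_sum_mono_eqD:
  assumes "finite A" "\<And>x. x \<in> A \<Longrightarrow> leq (f x) (g x)" "leq (sum g A) (sum f A)" "x \<in> A"
  shows "f x = g x"
proof -
  have "leq (sum f (A - {x})) (sum g (A - {x}))" using assms(2) by (intro leq_sum_mono) auto
  moreover have "sum f A = sum g A"
    using leq_sum_mono[of A f g] assms(2,3) leq_antisym by blast
  ultimately show ?thesis
    using leq_add_mono_eqD(1)[OF assms(2)[OF assms(4)], of "sum f (A - {x})" "sum g (A - {x})"]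
    by (simp add: sum.remove[OF assms(1,4)])
qed

lemma ex_greatest: "finite A \<Longrightarrow> A \<noteq> {} \<Longrightarrow> \<exists>t\<in>A. \<forall>s\<in>A. leq s t"
proof (induction rule: finite_ne_induct)
  case (insert x F)
  then obtain t where t: "t \<in> F" "\<forall>s\<in>F. leq s t" by auto
  show ?case
  proof (cases "leq x t")
    case False
    then have "leq t x" using leq_total by blast
    then have "\<forall>s\<in>F. leq s x" using t(2) leq_trans by blast
    then show ?thesis using leq_refl by blast
  qed (use t in blast)
qed (auto intro: leq_refl)

lemma lead_monomI:
  "t \<in> keys f \<Longrightarrow> (\<And>s. s \<in> keys f \<Longrightarrow> leq s t) \<Longrightarrow> lead_monom leq f = t"
  unfolding lead_monom_def by (rule the_equality) (auto intro: leq_antisym)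

lemma
  assumes "f \<noteq> 0"
  shows lead_monom_in_keys: "lead_monom leq f \<in> keys f"
    and lead_monom_greatest: "s \<in> keys f \<Longrightarrow> leq s (lead_monom leq f)"
proof -
  obtain t where "t \<in> keys f" "\<forall>s\<in>keys f. leq s t"
    using ex_greatest[of "keys f"] assms by (auto simp: poly_mapping_eq_iff in_keys_iff fun_eq_iff)
  moreover from this have "lead_monom leq f = t" by (intro lead_monomI) auto
  ultimately show "lead_monom leq f \<in> keys f" "s \<in> keys f \<Longrightarrow> leq s (lead_monom leq f)" by auto
qed

lemma
  fixes f g :: "('v, 'k::idom) mpoly"
  assumes "f \<noteq> 0" "g \<noteq> 0"
  shows lead_monom_mult: "lead_monom leq (f * g) = lead_monom leq f + lead_monom leq g"
    and lookup_lead_monom_mult: "lookup (f * g) (lead_monom leq f + lead_monom leq g) =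
      lookup f (lead_monom leq f) * lookup g (lead_monom leq g)"
proof -
  show *: "lookup (f * g) (lead_monom leq f + lead_monom leq g) =
      lookup f (lead_monom leq f) * lookup g (lead_monom leq g)"
    using leq_add_mono_eqD lead_monom_greatest assms by (intro lookup_mult_unique) blast
  show "lead_monom leq (f * g) = lead_monom leq f + lead_monom leq g"
  proof (rule lead_monomI)
    show "lead_monom leq f + lead_monom leq g \<in> keys (f * g)"
      using * lead_monom_in_keys assms by (auto simp: in_keys_iff)
    show "leq s (lead_monom leq f + lead_monom leq g)" if "s \<in> keys (f * g)" for s
      using that lead_monom_greatest assms by (auto elim!: keys_mult_E intro!: leq_add_mono)
  qed
qed

lemma mult_ne_0: "f * g \<noteq> 0" if "f \<noteq> 0" "g \<noteq> 0" for f g :: "('v, 'k::idom) mpoly"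
proof
  assume "f * g = 0"
  then have "lookup (f * g) (lead_monom leq f + lead_monom leq g) = 0" by simp
  then show False
    using lookup_lead_monom_mult[OF that] lead_monom_in_keys that by (auto simp: in_keys_iff)
qed

lemma
  fixes f :: "'i \<Rightarrow> ('v, 'k::idom) mpoly"
  assumes "finite A" "\<And>i. i \<in> A \<Longrightarrow> f i \<noteq> 0"
  shows prod_ne_0: "prod f A \<noteq> 0"
    and lead_monom_prod: "lead_monom leq (prod f A) = (\<Sum>i\<in>A. lead_monom leq (f i))"
proof -
  have "prod f A \<noteq> 0 \<and> lead_monom leq (prod f A) = (\<Sum>i\<in>A. lead_monom leq (f i))"
    using assms
  proof (induction A rule: finite_induct)
    case empty
    have "lead_monom leq (1 :: ('v, 'k) mpoly) = 0"
      by (rule lead_monomI) (auto intro: leq_refl)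
    then show ?case by simp
  qed (auto simp: lead_monom_mult mult_ne_0)
  then show "prod f A \<noteq> 0" "lead_monom leq (prod f A) = (\<Sum>i\<in>A. lead_monom leq (f i))" by auto
qed

end

lemma term_order_monomial_order: "term_order leq \<Longrightarrow> monomial_order leq"
  unfolding term_order_def
  by unfold_locales (auto dest: antisympD transpD totalpD reflpD, metis reflpD totalpD)

definition weight_leq :: "('v::linorder monom \<Rightarrow> int) \<Rightarrow> 'v monom \<Rightarrow> 'v monom \<Rightarrow> bool" where
  "weight_leq \<omega> s t \<longleftrightarrow> \<omega> s < \<omega> t \<or> \<omega> s = \<omega> t \<and> s \<le> t"

lemma weight_leq_monomial_order:
  assumes "\<And>s t. \<omega> (s + t) = \<omega> s + \<omega> t"
  shows "monomial_order (weight_leq \<omega>)"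
  by unfold_locales (auto simp: weight_leq_def assms intro: add_right_mono)

section \<open>The Greene--Kleitman theorem\<close>

text \<open>Hall's marriage theorem by the Halmos-Vaughan induction: split at a nonempty proper
  subset with equality if there is one; otherwise every such subset has a neighbour to spare, so one
  arbitrary pair can be matched and removed.\<close>

lemma hall_sdr:
  fixes T :: "'a \<Rightarrow> 'b set"
  assumes "finite X" "\<And>x. x \<in> X \<Longrightarrow> finite (T x)"
    "\<And>A. A \<subseteq> X \<Longrightarrow> card A \<le> card (\<Union>(T ` A))"
  shows "\<exists>f. inj_on f X \<and> (\<forall>x\<in>X. f x \<in> T x)"
  using assms
proof (induction "card X" arbitrary: X T rule: less_induct)
  case less
  note fin = less.prems(1,2) and hall = less.prems(3)
  have finU: "finite (\<Union>(T ` A))" if "A \<subseteq> X" for A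
  proof -
    have "finite A" using that fin(1) by (rule finite_subset)
    then show ?thesis using that fin(2) by (intro finite_UN_I) auto
  qed
  consider "X = {}"
    | A where "A \<subset> X" "A \<noteq> {}" "card (\<Union>(T ` A)) = card A"
    | x where "x \<in> X" "\<And>A. A \<subset> X \<Longrightarrow> A \<noteq> {} \<Longrightarrow> card A < card (\<Union>(T ` A))"
    using hall by (metis all_not_in_conv le_neq_implies_less psubset_imp_subset)
  then show ?case
  proof cases
    case 1
    then show ?thesis by simp
  next
    case (2 A)
    let ?U = "\<Union>(T ` A)"
    have finA: "finite A" using 2(1) fin(1) finite_subset by blast
    have "\<exists>f. inj_on f A \<and> (\<forall>x\<in>A. f x \<in> T x)"
    proof (rule less.hyps)
      show "card A < card X" using 2(1) fin(1) by (intro psubset_card_mono) auto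
    qed (use 2(1) fin(2) hall finA in auto)
    then obtain f where f: "inj_on f A" "\<forall>x\<in>A. f x \<in> T x" by auto
    have "\<exists>g. inj_on g (X - A) \<and> (\<forall>x\<in>X - A. g x \<in> T x - ?U)"
    proof (rule less.hyps)
      show "card (X - A) < card X" using 2 fin by (intro psubset_card_mono) auto
      show "card B \<le> card (\<Union>x\<in>B. T x - ?U)" if "B \<subseteq> X - A" for B
      proof -
        have finB: "finite B" using that fin(1) finite_subset by blast
        have "card A + card B = card (A \<union> B)"
          using that finA finB by (intro card_Un_disjoint[symmetric]) auto
        also have "\<dots> \<le> card (\<Union>(T ` (A \<union> B)))" using that 2 by (intro hall) auto
        also have "\<Union>(T ` (A \<union> B)) = ?U \<union> (\<Union>x\<in>B. T x - ?U)" by auto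
        also have "card \<dots> \<le> card ?U + card (\<Union>x\<in>B. T x - ?U)" by (rule card_Un_le)
        finally show ?thesis using 2(3) by simp
      qed
    qed (use fin in auto)
    then obtain g where g: "inj_on g (X - A)" "\<forall>x\<in>X - A. g x \<in> T x - ?U" by auto
    have "inj_on (\<lambda>x. if x \<in> A then f x else g x) X"
    proof (rule inj_onI)
      fix x y
      assume xy: "x \<in> X" "y \<in> X" "(if x \<in> A then f x else g x) = (if y \<in> A then f y else g y)"
      have "f z \<in> ?U" if "z \<in> A" for z using f(2) that by auto
      moreover have "g z \<notin> ?U" if "z \<in> X - A" for z using g(2) that by auto
      ultimately show "x = y"
        using xy inj_onD[OF f(1), of x y] inj_onD[OF g(1), of x y]
        by (cases "x \<in> A"; cases "y \<in> A") (metis DiffI)+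
    qed
    then show ?thesis using f g by (intro exI[of _ "\<lambda>x. if x \<in> A then f x else g x"]) auto
  next
    case (3 x)
    have "card {x} \<le> card (\<Union>(T ` {x}))" using 3 by (intro hall) auto
    then obtain y where y: "y \<in> T x" by fastforce
    have "\<exists>g. inj_on g (X - {x}) \<and> (\<forall>z\<in>X - {x}. g z \<in> T z - {y})"
    proof (rule less.hyps)
      show "card (X - {x}) < card X" using 3 fin by (intro psubset_card_mono) auto
      show "card B \<le> card (\<Union>z\<in>B. T z - {y})" if "B \<subseteq> X - {x}" for B
      proof (cases "B = {}")
        case False
        have "card B < card (\<Union>(T ` B))" using that 3 False by blast
        also have "\<dots> \<le> card (insert y (\<Union>z\<in>B. T z - {y}))"
          using finU[of B] that by (intro card_mono) (auto intro: finite_subset)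
        also have "\<dots> \<le> Suc (card (\<Union>z\<in>B. T z - {y}))" by (rule card_insert_le_m1) auto
        finally show ?thesis by simp
      qed auto
    qed (use fin in auto)
    then obtain g where g: "inj_on g (X - {x})" "\<forall>z\<in>X - {x}. g z \<in> T z - {y}" by auto
    have "inj_on (g(x := y)) X" using g by (auto simp: inj_on_def)
    then show ?thesis using g y by (intro exI[of _ "g(x := y)"]) auto
  qed
qed

text \<open>
  The dual solution of minimal value has a perfect matching among its tight edges: by Hall's
  theorem an obstruction would be a set that allows the dual value to be lowered.
\<close>

lemma egervary:
  fixes w :: "'a \<Rightarrow> 'a \<Rightarrow> int"
  assumes fin: "finite X" and E: "\<And>x. x \<in> X \<Longrightarrow> E x x"
  obtains \<sigma> a b where "bij_betw \<sigma> X X" "\<And>x. x \<in> X \<Longrightarrow> E x (\<sigma> x)"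
    "\<And>x y. x \<in> X \<Longrightarrow> y \<in> X \<Longrightarrow> E x y \<Longrightarrow> w x y \<le> a x + b y"
    "(\<Sum>x\<in>X. w x (\<sigma> x)) = (\<Sum>x\<in>X. a x + b x)"
proof -
  define feas where "feas = (\<lambda>(a, b). \<forall>x\<in>X. \<forall>y\<in>X. E x y \<longrightarrow> w x y \<le> a x + b y)"
  \<comment> \<open>Subtracting the weight of the identity assignment, which is admissible by
    \<open>E\<close>, makes the value nonnegative on feasible pairs, so a minimum can be taken in
    the natural numbers.\<close>
  define val where "val = (\<lambda>(a, b). \<Sum>x\<in>X. a x + b x - w x x)"
  define M where "M = (\<Sum>x\<in>X. \<Sum>y\<in>X. \<bar>w x y\<bar>)"
  have "w x y \<le> M" if "x \<in> X" "y \<in> X" for x y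
  proof -
    have "w x y \<le> \<bar>w x y\<bar>" by simp
    also have "\<dots> \<le> (\<Sum>y\<in>X. \<bar>w x y\<bar>)" using that fin by (intro member_le_sum) auto
    also have "\<dots> \<le> M" unfolding M_def using that fin
      by (intro member_le_sum[of x X "\<lambda>x. \<Sum>y\<in>X. \<bar>w x y\<bar>"]) (auto intro: sum_nonneg)
    finally show ?thesis .
  qed
  then have "feas (\<lambda>_. M, \<lambda>_. 0)" by (auto simp: feas_def)
  then obtain p where p: "feas p" "\<And>q. feas q \<Longrightarrow> nat (val p) \<le> nat (val q)"
    using ex_has_least_nat[of feas _ "\<lambda>q. nat (val q)"] by blast
  obtain a b where ab: "p = (a, b)" by (cases p)
  have val_nonneg: "val q \<ge> 0" if "feas q" for q
    using that E by (auto simp: val_def feas_def split: prod.splits intro!: sum_nonneg)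
  have ge: "w x y \<le> a x + b y" if "x \<in> X" "y \<in> X" "E x y" for x y
    using p(1) that by (auto simp: feas_def ab)
  define T where "T x = {y \<in> X. E x y \<and> w x y = a x + b y}" for x
  have "\<exists>\<sigma>. inj_on \<sigma> X \<and> (\<forall>x\<in>X. \<sigma> x \<in> T x)"
  proof (rule hall_sdr[OF fin])
    show "finite (T x)" for x using fin by (auto simp: T_def)
    fix A assume A: "A \<subseteq> X"
    define U where "U = \<Union>(T ` A)"
    have U: "U \<subseteq> X" by (auto simp: U_def T_def)
    \<comment> \<open>Lower \<open>a\<close> on \<open>A\<close> and raise \<open>b\<close> on its
      tight neighbours \<open>U\<close>. Non-tight edges have slack at least 1 by integrality, so
      the pair stays feasible, and minimality gives \<open>card A \<le> card U\<close>.\<close>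
    define a' where "a' x = a x - (if x \<in> A then 1 else 0)" for x
    define b' where "b' y = b y + (if y \<in> U then 1 else 0)" for y
    have "feas (a', b')"
      unfolding feas_def
    proof (clarify)
      fix x y assume xy: "x \<in> X" "y \<in> X" "E x y"
      show "w x y \<le> a' x + b' y"
        using ge[OF xy] xy by (cases "y \<in> T x") (auto simp: a'_def b'_def U_def T_def)
    qed
    then have "val (a, b) \<le> val (a', b')"
      using p(2)[of "(a', b')"] val_nonneg[of "(a', b')"] unfolding ab by linarith
    also have "val (a', b') = val (a, b) - int (card A) + int (card U)"
      using A U fin
      by (simp add: val_def a'_def b'_def sum.distrib sum_subtractf sum.If_cases Int_absorb1)
    finally show "card A \<le> card (\<Union>(T ` A))" by (simp add: U_def)
  qed
  then obtain \<sigma> where \<sigma>: "inj_on \<sigma> X" "\<And>x. x \<in> X \<Longrightarrow> \<sigma> x \<in> T x" by auto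
  have bij: "bij_betw \<sigma> X X"
    using endo_inj_surj[OF fin _ \<sigma>(1)] \<sigma> by (auto simp: bij_betw_def T_def)
  have "(\<Sum>x\<in>X. w x (\<sigma> x)) = (\<Sum>x\<in>X. a x) + (\<Sum>x\<in>X. b (\<sigma> x))"
    unfolding sum.distrib[symmetric] using \<sigma>(2) by (intro sum.cong) (auto simp: T_def)
  also have "(\<Sum>x\<in>X. b (\<sigma> x)) = (\<Sum>x\<in>X. b x)" by (rule sum.reindex_bij_betw[OF bij])
  finally show ?thesis
    using \<sigma>(2) bij ge by (intro that[of \<sigma> a b]) (auto simp: T_def sum.distrib)
qed

text \<open>A partial injection along a strict order has no cycles, so its orbits are chains, one
  for each element without successor. The induction removes a maximal \<open>q\<close>; its
  predecessor, if any, then ends a chain, to which \<open>q\<close> is appended again.\<close>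

lemma chains_of_successor:
  assumes tr: "\<And>x y z. prec x y \<Longrightarrow> prec y z \<Longrightarrow> prec x z" and irr: "\<And>x. \<not> prec x x"
    and "finite S" "D \<subseteq> S" "inj_on nx D" "nx ` D \<subseteq> S" "\<And>x. x \<in> D \<Longrightarrow> prec x (nx x)"
  shows "\<exists>css. distinct (map last css) \<and> set (map last css) = S - D \<and> [] \<notin> set css \<and>
    distinct (concat css) \<and> set (concat css) = S \<and> (\<forall>c\<in>set css. sorted_wrt prec c)"
  using assms(3-)
proof (induction "card S" arbitrary: S D)
  case 0
  then show ?case by (intro exI[of _ "[]"]) auto
next
  case (Suc n)
  have "\<exists>q\<in>S. \<forall>x\<in>S. \<not> prec q x"
    using Finite_Set.bex_max_element[of S prec] Suc.hyps(2) Suc.prems(1) tr irr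
    by (metis asymp_onI card.empty nat.distinct(1) transp_onI)
  then obtain q where q: "q \<in> S" "\<And>x. x \<in> S \<Longrightarrow> \<not> prec q x" by blast
  have qD: "q \<notin> D" using Suc.prems(4,5) q by blast
  define D' where "D' = {p \<in> D. nx p \<noteq> q}"
  obtain css where css: "distinct (map last css)" "set (map last css) = (S - {q}) - D'"
    "[] \<notin> set css" "distinct (concat css)" "set (concat css) = S - {q}"
    "\<forall>c\<in>set css. sorted_wrt prec c"
  proof -
    have "n = card (S - {q})" using Suc.hyps(2) Suc.prems(1) q(1) by simp
    moreover have "D' \<subseteq> S - {q}" using Suc.prems(2) qD by (auto simp: D'_def)
    moreover have "inj_on nx D'" using Suc.prems(3) by (auto simp: D'_def inj_on_def)
    moreover have "nx ` D' \<subseteq> S - {q}" using Suc.prems(4) by (auto simp: D'_def)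
    moreover have "prec x (nx x)" if "x \<in> D'" for x using that Suc.prems(5) by (simp add: D'_def)
    ultimately show ?thesis
      using Suc.hyps(1)[of "S - {q}" D'] Suc.prems(1) that by (metis finite_Diff)
  qed
  show ?case
  proof (cases "\<exists>p\<in>D. nx p = q")
    case True
    then obtain p where p: "p \<in> D" "nx p = q" by auto
    have D': "D' = D - {p}" using p Suc.prems(3) by (auto simp: D'_def inj_on_def)
    have "p \<in> set (map last css)" using css(2) p Suc.prems(2) qD D' by auto
    then obtain c us vs where c: "css = us @ c # vs" "last c = p"
      by (metis (no_types, lifting) in_set_conv_decomp map_eq_append_conv map_eq_Cons_conv)
    have pq: "prec p q" using Suc.prems(5)[OF p(1)] p(2) by simp
    have "prec x q" if "x \<in> set c" for x
    proof (cases "x = p")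
      case False
      have "c = butlast c @ [p]" using c css(3) by (metis append_butlast_last_id in_set_conv_decomp)
      then have "sorted_wrt prec (butlast c @ [p])" "x \<in> set (butlast c)"
        using css(6) c(1) False that by (auto, metis in_set_conv_decomp rotate1.simps(2) set_ConsD set_rotate1)
      then show ?thesis using pq tr by (auto simp: sorted_wrt_append)
    qed (use pq in simp)
    then have "sorted_wrt prec (c @ [q])" using css(6) c(1) by (auto simp: sorted_wrt_append)
    moreover have "set (map last (us @ (c @ [q]) # vs)) = S - D"
    proof -
      have "set (map last us) \<union> set (map last vs) = set (map last css) - {p}"
        using css(1) c by auto
      then show ?thesis using css(2) D' q(1) qD p Suc.prems(2) by auto
    qed
    moreover have "q \<notin> set (map last css)" "q \<notin> set (concat css)" using css(2,5) by auto
    ultimately show ?thesis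
      using css c q(1) by (intro exI[of _ "us @ (c @ [q]) # vs"]) auto
  next
    case False
    then have "D' = D" by (auto simp: D'_def)
    then show ?thesis using css q(1) qD by (intro exI[of _ "[q] # css"]) auto
  qed
qed

text \<open>Whole chains are kept while their excess over \<open>r\<close> fits into
  \<open>s\<close>; the chain that would overshoot is cut to the length \<open>r\<close> plus the
  missing amount, and the rest is dropped. So an excess of at least \<open>s\<close> yields one of
  exactly \<open>s\<close>.\<close>

lemma trim_chains:
  assumes "s \<le> (\<Sum>c\<leftarrow>css. length c - r)" "\<forall>c\<in>set css. sorted_wrt prec c \<and> r < length c"
  shows "\<exists>css'. (\<Sum>c\<leftarrow>css'. length c - r) = s \<and> (\<forall>c\<in>set css'. sorted_wrt prec c \<and> r < length c) \<and>
    (\<forall>v. count_list (concat css') v \<le> count_list (concat css) v)"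
  using assms
proof (induction css arbitrary: s)
  case Nil
  then show ?case by (intro exI[of _ "[]"]) auto
next
  case (Cons c css)
  consider "s = 0" | "0 < s" "s \<le> length c - r" | "length c - r < s" by linarith
  then show ?case
  proof cases
    case 1
    then show ?thesis by (intro exI[of _ "[]"]) auto
  next
    case 2
    have "count_list (take n c) v \<le> count_list c v" for n v
      using count_list_append[of "take n c" "drop n c" v] by simp
    then show ?thesis
      using 2 Cons.prems
      by (intro exI[of _ "[take (r + s) c]"]) (auto intro: sorted_wrt_take trans_le_add1)
  next
    case 3
    then have "s - (length c - r) \<le> (\<Sum>c\<leftarrow>css. length c - r)" using Cons.prems(1) by simp
    then obtain css' where "(\<Sum>c\<leftarrow>css'. length c - r) = s - (length c - r)"
      "\<forall>c\<in>set css'. sorted_wrt prec c \<and> r < length c"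
      "\<forall>v. count_list (concat css') v \<le> count_list (concat css) v"
      using Cons.IH Cons.prems(2) by (meson list.set_intros(2))
    then show ?thesis using 3 Cons.prems by (intro exI[of _ "c # css'"]) auto
  qed
qed

text \<open>
  Weighted chains and antichains form an assignment problem: each of the \<open>u v\<close> copies of \<open>v\<close>
  is matched with a copy of a larger element (its successor in a chain), with itself (it lies in
  no chain) or, at the price \<open>r\<close>, with one of sufficiently many dummy elements (the chain ends).
  The dual variables \<open>a\<close>, \<open>b\<close> of a copy bound the interval of levels \<open>0, \<dots>, r\<close> that it occupies.
\<close>

lemma greene_kleitman:
  fixes prec :: "'v::finite \<Rightarrow> 'v \<Rightarrow> bool" and u :: "'v \<Rightarrow> nat"
  assumes tr: "\<And>x y z. prec x y \<Longrightarrow> prec y z \<Longrightarrow> prec x z" and irr: "\<And>x. \<not> prec x x"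
    and no: "\<And>css. \<forall>c\<in>set css. sorted_wrt prec c \<and> r < length c \<Longrightarrow>
      (\<And>v. count_list (concat css) v \<le> u v) \<Longrightarrow> (\<Sum>c\<leftarrow>css. length c - r) \<noteq> s"
  obtains lab where "\<And>v. lab v \<le> r" "\<And>v w. lab v = lab w \<Longrightarrow> lab v < r \<Longrightarrow> \<not> prec v w"
    "(\<Sum>v | lab v = r. u v) < s"
proof -
  define P where "P = (SIGMA v:UNIV. {..<u v})"
  define N where "N = card P"
  have finP: "finite P" by (auto simp: P_def)
  \<comment> \<open>The \<open>N + 1\<close> dummies are nonempty even if \<open>N = 0\<close>, so
    least dual values on them exist, and so many that a positive \<open>\<alpha> + \<beta>\<close>
    alone pushes the dual value beyond \<open>N\<close>.\<close>
  define X :: "('v \<times> nat + nat) set" where "X = Inl ` P \<union> Inr ` {..N}"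
  define E :: "'v \<times> nat + nat \<Rightarrow> 'v \<times> nat + nat \<Rightarrow> bool"
    where "E x y = (case (x, y) of (Inl p, Inl q) \<Rightarrow> p = q \<or> prec (fst p) (fst q) | _ \<Rightarrow> True)" for x y
  \<comment> \<open>A chain of length \<open>n\<close> has \<open>n - 1\<close> successor edges of
    weight 1 and one final edge of weight \<open>1 - r\<close>, so it weighs \<open>n - r\<close>,
    its excess. Edges leaving dummies are free.\<close>
  define w :: "'v \<times> nat + nat \<Rightarrow> 'v \<times> nat + nat \<Rightarrow> int"
    where "w x y = (case (x, y) of (Inl p, Inl q) \<Rightarrow> if p = q then 0 else 1
      | (Inl p, Inr d) \<Rightarrow> 1 - int r | _ \<Rightarrow> 0)" for x y
  have finX: "finite X" by (auto simp: X_def finP)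
  have EX: "E x x" for x by (auto simp: E_def split: sum.splits)
  obtain \<sigma> a b where \<sigma>: "bij_betw \<sigma> X X" "\<And>x. x \<in> X \<Longrightarrow> E x (\<sigma> x)"
    and ab: "\<And>x y. x \<in> X \<Longrightarrow> y \<in> X \<Longrightarrow> E x y \<Longrightarrow> w x y \<le> a x + b y"
    and eq: "(\<Sum>x\<in>X. w x (\<sigma> x)) = (\<Sum>x\<in>X. a x + b x)"
    using egervary[of X E w, OF finX EX] by blast
  have \<sigma>inj: "inj_on \<sigma> X" and \<sigma>X: "\<And>x. x \<in> X \<Longrightarrow> \<sigma> x \<in> X"
    using \<sigma>(1) by (auto simp: bij_betw_def)
  have sumX: "(\<Sum>x\<in>X. f x) = (\<Sum>p\<in>P. f (Inl p)) + (\<Sum>d\<le>N. f (Inr d))"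
    for f :: "'v \<times> nat + nat \<Rightarrow> int"
    unfolding X_def
    by (subst sum.union_disjoint) (auto simp: finP sum.reindex)

  define S where "S = {p \<in> P. \<sigma> (Inl p) \<noteq> Inl p}"
  define D where "D = {p \<in> S. \<exists>q. \<sigma> (Inl p) = Inl q}"
  define nx where "nx p = projl (\<sigma> (Inl p))" for p
  have finS: "finite S" by (auto simp: S_def finP)
  have SX: "Inl p \<in> X" if "p \<in> S" for p using that by (auto simp: S_def X_def)
  have nx: "\<sigma> (Inl p) = Inl (nx p)" if "p \<in> D" for p using that by (auto simp: D_def nx_def)
  have DS: "D \<subseteq> S" by (auto simp: D_def)
  have injnx: "inj_on nx D"
    using \<sigma>inj nx SX DS unfolding inj_on_def by (metis subsetD sum.inject(1))
  have nxS: "nx p \<in> S" if "p \<in> D" for p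
  proof -
    have p: "p \<in> S" using that DS by auto
    have "Inl (nx p) \<in> X" "Inl p \<in> X" "nx p \<noteq> p"
      using nx[OF that] \<sigma>X[OF SX[OF p]] SX[OF p] p by (auto simp: S_def)
    moreover from this have "\<sigma> (Inl (nx p)) \<noteq> Inl (nx p)"
      using nx[OF that] inj_onD[OF \<sigma>inj, of "Inl (nx p)" "Inl p"] by auto
    ultimately show ?thesis by (auto simp: S_def X_def)
  qed
  have precnx: "prec (fst p) (fst (nx p))" if "p \<in> D" for p
  proof -
    have p: "p \<in> S" using that DS by auto
    show ?thesis using \<sigma>(2)[OF SX[OF p]] nx[OF that] p by (auto simp: E_def S_def)
  qed
  obtain css where css: "distinct (map last css)" "set (map last css) = S - D"
    "distinct (concat css)" "set (concat css) = S"
    "\<forall>c\<in>set css. sorted_wrt (\<lambda>p q. prec (fst p) (fst q)) c"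
    using chains_of_successor[of "\<lambda>p q. prec (fst p) (fst q)" S D nx, OF _ _ finS DS injnx _ precnx]
      tr irr nxS by blast
  have "(\<Sum>x\<in>X. w x (\<sigma> x)) = (\<Sum>p\<in>P. w (Inl p) (\<sigma> (Inl p)))"
    unfolding sumX by (simp add: w_def)
  also have "\<dots> = (\<Sum>p\<in>S. w (Inl p) (\<sigma> (Inl p)))"
    using finP by (intro sum.mono_neutral_right) (auto simp: S_def w_def)
  also have "\<dots> = (\<Sum>p\<in>S. 1 - (if p \<in> S - D then int r else 0))"
    by (intro sum.cong refl) (auto simp: w_def D_def S_def split: sum.splits)
  also have "\<dots> = int (card S) - int r * int (card (S - D))"
  proof -
    have "(\<Sum>p\<in>S. if p \<in> S - D then int r else 0) = (\<Sum>p\<in>S - D. int r)"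
      using finS by (intro sum.mono_neutral_cong_right) auto
    then show ?thesis by (simp add: sum_subtractf)
  qed
  also have "card S = (\<Sum>c\<leftarrow>css. length c)"
    using css(3,4) by (metis distinct_card length_concat)
  also have "card (S - D) = length css"
    using css(1,2) by (metis distinct_card length_map)
  also have "int (\<Sum>c\<leftarrow>css. length c) - int r * int (length css) = (\<Sum>c\<leftarrow>css. int (length c) - int r)"
    by (induction css) (auto simp: algebra_simps)
  also have "\<dots> \<le> (\<Sum>c\<leftarrow>filter (\<lambda>c. r < length c) css. int (length c) - int r)"
    by (induction css) auto
  also have "\<dots> = int (\<Sum>c\<leftarrow>filter (\<lambda>c. r < length c) css. length c - r)"
    by (induction css) auto
  also have "\<dots> = int (\<Sum>c\<leftarrow>map (map fst) (filter (\<lambda>c. r < length c) css). length c - r)"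
    by (simp add: o_def)
  also have "\<dots> < int s"
  proof (rule ccontr)
    define css' where "css' = map (map fst) (filter (\<lambda>c. r < length c) css)"
    assume "\<not> int (\<Sum>c\<leftarrow>map (map fst) (filter (\<lambda>c. r < length c) css). length c - r) < int s"
    then have "s \<le> (\<Sum>c\<leftarrow>css'. length c - r)" unfolding css'_def by linarith
    moreover have "\<forall>c\<in>set css'. sorted_wrt prec c \<and> r < length c"
      using css(5) by (auto simp: css'_def sorted_wrt_map)
    ultimately obtain css'' where css'': "(\<Sum>c\<leftarrow>css''. length c - r) = s"
      "\<forall>c\<in>set css''. sorted_wrt prec c \<and> r < length c"
      "\<forall>v. count_list (concat css'') v \<le> count_list (concat css') v"
      using trim_chains[of s r css' prec] by blast
    have "count_list (concat css') v \<le> u v" for v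
    proof -
      have "count_list (concat css') v \<le> count_list (map fst (concat css)) v"
        unfolding css'_def by (induction css) (auto simp: count_list_append)
      also have "\<dots> = card ({p. fst p = v} \<inter> S)"
        unfolding count_list_eq_length_filter filter_map o_def
        using distinct_length_filter[OF css(3), of "\<lambda>p. v = fst p"] css(4)
        by (simp add: eq_commute)
      also have "\<dots> \<le> card ({v} \<times> {..<u v})"
        by (intro card_mono) (auto simp: S_def P_def)
      finally show ?thesis by simp
    qed
    then show False using no[of css''] css'' by (meson le_trans)
  qed
  finally have dual: "(\<Sum>p\<in>P. a (Inl p) + b (Inl p)) + (\<Sum>d\<le>N. a (Inr d) + b (Inr d)) < int s"
    unfolding eq sumX by simp

  have inP: "Inl p \<in> X" if "p \<in> P" for p using that by (auto simp: X_def)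
  have inN: "Inr d \<in> X" if "d \<le> N" for d using that by (auto simp: X_def)
  have y_nonneg: "0 \<le> a (Inl p) + b (Inl p)" if "p \<in> P" for p
    using ab[OF inP inP, OF that that] by (simp add: E_def w_def)
  obtain d\<^sub>0 where d0: "d\<^sub>0 \<le> N" "\<And>d. d \<le> N \<Longrightarrow> a (Inr d\<^sub>0) \<le> a (Inr d)"
    using ex_min_if_finite[of "(\<lambda>d. a (Inr d)) ` {..N}"] by (force simp: not_less)
  obtain d\<^sub>1 where d1: "d\<^sub>1 \<le> N" "\<And>d. d \<le> N \<Longrightarrow> b (Inr d\<^sub>1) \<le> b (Inr d)"
    using ex_min_if_finite[of "(\<lambda>d. b (Inr d)) ` {..N}"] by (force simp: not_less)
  define \<alpha> where "\<alpha> = a (Inr d\<^sub>0)"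
  define \<beta> where "\<beta> = b (Inr d\<^sub>1)"
  have \<alpha>\<beta>: "0 \<le> \<alpha> + \<beta>"
    using ab[OF inN inN, OF d0(1) d1(1)] by (simp add: E_def w_def \<alpha>_def \<beta>_def)
  have "(\<Sum>d\<le>N. \<alpha> + \<beta>) \<le> (\<Sum>d\<le>N. a (Inr d) + b (Inr d))"
    using d0 d1 by (intro sum_mono add_mono) (auto simp: \<alpha>_def \<beta>_def)
  then have dummies: "(int N + 1) * (\<alpha> + \<beta>) \<le> (\<Sum>d\<le>N. a (Inr d) + b (Inr d))"
    by (simp add: add.commute)
  show ?thesis
  proof (cases "\<alpha> + \<beta> = 0")
    case False
    then have "int N + 1 \<le> (int N + 1) * (\<alpha> + \<beta>)" using \<alpha>\<beta> by auto
    moreover have "0 \<le> (\<Sum>p\<in>P. a (Inl p) + b (Inl p))" by (intro sum_nonneg y_nonneg)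
    ultimately have "N < s" using dummies dual by linarith
    moreover have "N = (\<Sum>v\<in>UNIV. u v)" by (simp add: N_def P_def card_SigmaI)
    ultimately show ?thesis by (intro that[of "\<lambda>_. r"]) auto
  next
    case True
    \<comment> \<open>A good copy has \<open>a + b = 0\<close>, so its interval of levels is the
      single level \<open>b + \<alpha>\<close>. The edges from and to dummies put it between
      \<open>0\<close> and \<open>r - 1\<close>, given \<open>\<alpha> + \<beta> = 0\<close>. One
      chosen good copy fixes the label for all copies of \<open>v\<close>.\<close>
    define good where "good v c \<longleftrightarrow> c < u v \<and> a (Inl (v, c)) + b (Inl (v, c)) = 0" for v c
    define lab where "lab v = (if \<exists>c. good v c then nat (b (Inl (v, SOME c. good v c)) + \<alpha>) else r)" for v
    have lab: "\<exists>c. good v c \<and> int (lab v) = b (Inl (v, c)) + \<alpha> \<and> lab v < r" if "\<exists>c. good v c" for v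
    proof -
      define c where "c = (SOME c. good v c)"
      have c: "good v c" unfolding c_def using that by (rule someI_ex)
      then have P: "(v, c) \<in> P" by (auto simp: good_def P_def)
      have "0 \<le> \<alpha> + b (Inl (v, c))"
        using ab[OF inN inP, OF d0(1) P] by (simp add: E_def w_def \<alpha>_def)
      moreover have "1 - int r \<le> a (Inl (v, c)) + \<beta>"
        using ab[OF inP inN, OF P d1(1)] by (simp add: E_def w_def \<beta>_def)
      ultimately show ?thesis
        using c that True by (intro exI[of _ c]) (auto simp: lab_def good_def simp flip: c_def)
    qed
    show ?thesis
    proof (rule that[of lab])
      show "lab v \<le> r" for v
        using lab[of v] by (cases "\<exists>c. good v c") (auto simp: lab_def)
      show "\<not> prec v w'" if "lab v = lab w'" "lab v < r" for v w'
      proof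
        assume prec: "prec v w'"
        have "\<exists>c. good v c" "\<exists>c. good w' c" using that by (auto simp: lab_def split: if_splits)
        then obtain c c' where c: "good v c" "int (lab v) = b (Inl (v, c)) + \<alpha>"
          "good w' c'" "int (lab w') = b (Inl (w', c')) + \<alpha>" using lab by meson
        have "v \<noteq> w'" using prec irr by auto
        moreover have "(v, c) \<in> P" "(w', c') \<in> P" using c by (auto simp: P_def good_def)
        \<comment> \<open>The successor edge has weight 1; since \<open>a = - b\<close> at the good
          copy of \<open>v\<close>, the level of \<open>w'\<close> exceeds that of \<open>v\<close>
          by at least 1.\<close>
        ultimately have "1 \<le> a (Inl (v, c)) + b (Inl (w', c'))"
          using ab[OF inP inP] prec by (force simp: E_def w_def)
        then show False using c that(1) by (auto simp: good_def)
      qed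
      \<comment> \<open>A vertex labelled \<open>r\<close> has no good copy, hence each of its
        copies adds at least 1 to the dual value, which is below \<open>s\<close>.\<close>
      have "int (\<Sum>v | lab v = r. u v) \<le> (\<Sum>v | lab v = r. \<Sum>c<u v. a (Inl (v, c)) + b (Inl (v, c)))"
        unfolding of_nat_sum
      proof (rule sum_mono)
        fix v assume "v \<in> {v. lab v = r}"
        then have "\<not> good v c" for c using lab[of v] by auto
        then have "1 \<le> a (Inl (v, c)) + b (Inl (v, c))" if "c < u v" for c
          using y_nonneg[of "(v, c)"] that by (force simp: good_def P_def)
        then have "(\<Sum>c<u v. 1) \<le> (\<Sum>c<u v. a (Inl (v, c)) + b (Inl (v, c)))"
          by (intro sum_mono) auto
        then show "int (u v) \<le> (\<Sum>c<u v. a (Inl (v, c)) + b (Inl (v, c)))" by simp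
      qed
      also have "\<dots> \<le> (\<Sum>v\<in>UNIV. \<Sum>c<u v. a (Inl (v, c)) + b (Inl (v, c)))"
        by (intro sum_mono2 sum_nonneg y_nonneg) (auto simp: P_def)
      also have "\<dots> = (\<Sum>p\<in>P. a (Inl p) + b (Inl p))"
        unfolding P_def by (subst sum.Sigma) (auto simp: case_prod_unfold)
      also have "\<dots> < int s" using dual dummies True by simp
      finally show "(\<Sum>v | lab v = r. u v) < s" by linarith
    qed
  qed
qed

section \<open>Joins of kernels of substitutions\<close>

lemma lookup_Const_mult: "lookup (Const c * p) t = c * lookup p t"
  using mult_map_scale_conv_mult[of c p] by (simp add: Poly_Mapping.map.rep_eq when_def flip: mult_map_scale_conv_mult)

lemma disjoint_support_add_eqD:
  fixes s t a b :: "'v monom"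
  assumes "keys s \<subseteq> V" "keys a \<subseteq> V" "keys t \<subseteq> W" "keys b \<subseteq> W" "V \<inter> W = {}" "s + t = a + b"
  shows "s = a \<and> t = b"
proof -
  have "lookup s v = lookup a v" for v
  proof (cases "v \<in> V")
    case True
    then have "lookup t v = 0" "lookup b v = 0" using assms by (auto simp: in_keys_iff)
    then show ?thesis using arg_cong[OF assms(6), of "\<lambda>p. lookup p v"] by (simp add: lookup_add)
  next
    case False
    then have "lookup s v = 0" "lookup a v = 0" using assms by (auto simp: in_keys_iff)
    then show ?thesis by simp
  qed
  then have "s = a" by (intro poly_mapping_eqI)
  then show ?thesis using assms(6) by simp
qed

text \<open>
  Kernels of tensor products: if \<open>\<sigma> g\<^sub>j \<noteq> 0\<close>, comparing the coefficients of a monomial of \<open>\<sigma> g\<^sub>j\<close>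
  gives a linear relation between the \<open>\<tau> h\<^sub>i\<close> which allows the \<open>j\<close>-th summand to be eliminated.
\<close>

lemma tensor_kernel:
  fixes \<sigma> \<tau> :: "'v \<Rightarrow> ('w, 'k::field) mpoly" and \<eta> \<zeta> :: "'v \<Rightarrow> ('u, 'k) mpoly"
  assumes \<sigma>: "\<And>v. \<sigma> v \<in> polys_in V" and \<tau>: "\<And>v. \<tau> v \<in> polys_in U" and disj: "V \<inter> U = {}"
    and W: "ideal.subspace W"
    and \<sigma>W: "\<And>g. subst_poly \<sigma> g = 0 \<Longrightarrow> subst_poly \<eta> g \<in> W"
    and \<tau>W: "\<And>g. subst_poly \<tau> g = 0 \<Longrightarrow> subst_poly \<zeta> g \<in> W"
    and "finite I" "(\<Sum>i\<in>I. subst_poly \<sigma> (g i) * subst_poly \<tau> (h i)) = 0"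
  shows "(\<Sum>i\<in>I. subst_poly \<eta> (g i) * subst_poly \<zeta> (h i)) \<in> W"
  using assms(7-)
proof (induction "card I" arbitrary: I g)
  case 0
  then show ?case using ideal.subspace_0[OF W] by simp
next
  case (Suc n)
  show ?case
  proof (cases "\<forall>i\<in>I. subst_poly \<sigma> (g i) = 0")
    case True
    then show ?thesis
      by (intro ideal.subspace_sum[OF W] subspace_mult_right[OF W] \<sigma>W) auto
  next
    case False
    then obtain j a where j: "j \<in> I" and "lookup (subst_poly \<sigma> (g j)) a \<noteq> 0"
      by (metis lookup_zero poly_mapping_eqI)
    define c where "c i = lookup (subst_poly \<sigma> (g i)) a" for i
    have cj: "c j \<noteq> 0" using \<open>lookup _ _ \<noteq> 0\<close> by (simp add: c_def)
    have aV: "keys a \<subseteq> V"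
      using polys_in_subst[of \<sigma> V, OF \<sigma>, of "g j"] \<open>lookup _ _ \<noteq> 0\<close> by (auto simp: polys_in_def in_keys_iff)
    have in\<sigma>: "keys s \<subseteq> V" if "s \<in> keys (subst_poly \<sigma> p)" for s p
      using polys_in_subst[of \<sigma> V, OF \<sigma>, of p] that by (auto simp: polys_in_def)
    have in\<tau>: "keys s \<subseteq> U" if "s \<in> keys (subst_poly \<tau> p)" for s p
      using polys_in_subst[of \<tau> U, OF \<tau>, of p] that by (auto simp: polys_in_def)
    have "(\<Sum>i\<in>I. Const (c i) * subst_poly \<tau> (h i)) = 0"
    proof (rule poly_mapping_eqI)
      fix b
      show "lookup (\<Sum>i\<in>I. Const (c i) * subst_poly \<tau> (h i)) b = lookup 0 b"
      proof (cases "keys b \<subseteq> U")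
        case True
        have "lookup (subst_poly \<sigma> (g i) * subst_poly \<tau> (h i)) (a + b) =
            c i * lookup (subst_poly \<tau> (h i)) b" for i
          unfolding c_def
          using disjoint_support_add_eqD[OF in\<sigma> aV in\<tau> True disj]
          by (intro lookup_mult_unique) blast
        then show ?thesis
          using arg_cong[OF Suc.prems(2), of "\<lambda>p. lookup p (a + b)"]
          by (simp add: lookup_sum lookup_Const_mult)
      next
        case False
        then have "lookup (subst_poly \<tau> (h i)) b = 0" for i
          using in\<tau> by (auto simp: in_keys_iff)
        then show ?thesis by (simp add: lookup_sum lookup_Const_mult)
      qed
    qed
    moreover have "Const (c i / c j) = Const (inverse (c j)) * (Const (c i) :: ('w, 'k) mpoly)" for i
      by (simp add: mult_single divide_inverse mult.commute)
    ultimately have h0: "(\<Sum>i\<in>I. Const (c i / c j) * subst_poly \<tau> (h i)) = 0"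
      by (simp only: mult.assoc sum_distrib_left[symmetric] mult_zero_right)
    define g' where "g' i = g i - Const (c i / c j) * g j" for i
    have g'j: "g' j = 0" using cj by (simp add: g'_def)
    \<comment> \<open>Stated for arbitrary substitutions because it is applied twice: to
      \<open>\<sigma>\<close>, \<open>\<tau>\<close> to keep the vanishing hypothesis, and to
      \<open>\<eta>\<close>, \<open>\<zeta>\<close> for the conclusion.\<close>
    have rearrange: "(\<Sum>i\<in>I. subst_poly \<alpha> (g i) * subst_poly \<beta> (h i)) =
        subst_poly \<alpha> (g j) * (\<Sum>i\<in>I. Const (c i / c j) * subst_poly \<beta> (h i)) +
        (\<Sum>i\<in>I - {j}. subst_poly \<alpha> (g' i) * subst_poly \<beta> (h i))"
      for \<alpha> \<beta> :: "'v \<Rightarrow> ('x, 'k) mpoly"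
    proof -
      have "(\<Sum>i\<in>I - {j}. subst_poly \<alpha> (g' i) * subst_poly \<beta> (h i)) =
          (\<Sum>i\<in>I. subst_poly \<alpha> (g' i) * subst_poly \<beta> (h i))"
        using Suc.prems(1) g'j by (intro sum.mono_neutral_left) auto
      also have "\<dots> = (\<Sum>i\<in>I. subst_poly \<alpha> (g i) * subst_poly \<beta> (h i)) -
          subst_poly \<alpha> (g j) * (\<Sum>i\<in>I. Const (c i / c j) * subst_poly \<beta> (h i))"
      proof -
        have "subst_poly \<alpha> (g' i) = subst_poly \<alpha> (g i) - Const (c i / c j) * subst_poly \<alpha> (g j)" for i
          by (simp only: g'_def subst_poly_diff subst_poly_mult subst_poly_Const)
        then have "subst_poly \<alpha> (g' i) * subst_poly \<beta> (h i) = subst_poly \<alpha> (g i) * subst_poly \<beta> (h i) -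
            subst_poly \<alpha> (g j) * (Const (c i / c j) * subst_poly \<beta> (h i))" for i
          by (simp only: left_diff_distrib mult.assoc mult.left_commute)
        then show ?thesis by (simp only: sum_subtractf sum_distrib_left)
      qed
      finally show ?thesis by simp
    qed
    have "(\<Sum>i\<in>I - {j}. subst_poly \<eta> (g' i) * subst_poly \<zeta> (h i)) \<in> W"
      using Suc j rearrange[of \<sigma> \<tau>] h0 by (intro Suc.hyps(1)) auto
    moreover have "(\<Sum>i\<in>I. Const (c i / c j) * subst_poly \<zeta> (h i)) \<in> W"
      using \<tau>W[of "\<Sum>i\<in>I. Const (c i / c j) * h i"] h0 by (simp add: subst_poly_sum subst_poly_mult)
    ultimately show ?thesis
      unfolding rearrange by (intro ideal.subspace_add[OF W] ideal.subspace_scale[OF W])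
  qed
qed

lemma sum_list_mult_product:
  fixes f g :: "'a \<Rightarrow> 'b::comm_semiring_0"
  shows "(\<Sum>x\<leftarrow>xs. f x) * (\<Sum>y\<leftarrow>ys. g y) = (\<Sum>(x, y)\<leftarrow>List.product xs ys. f x * g y)"
  by (induction xs) (auto simp: algebra_simps sum_list_const_mult o_def)

text \<open>Brings \<open>f (y + z)\<close> into the form of a finite sum of separated products, to
  which \<open>tensor_kernel\<close> applies.\<close>

lemma subst_add_separate:
  fixes \<eta> \<zeta> :: "'v \<Rightarrow> ('u, 'k::comm_ring_1) mpoly"
  shows "\<exists>xs. subst_poly (\<lambda>v. \<eta> v + \<zeta> v) f = (\<Sum>(g, h)\<leftarrow>xs. subst_poly \<eta> g * subst_poly \<zeta> h)"
proof (induction f rule: mpoly_induct)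
  case (Const c)
  show ?case by (intro exI[of _ "[(Const c, 1)]"]) simp
next
  case (Var v)
  show ?case by (intro exI[of _ "[(Var v, 1), (1, Var v)]"]) simp
next
  case (add p q)
  then obtain xs ys where
    "subst_poly (\<lambda>v. \<eta> v + \<zeta> v) p = (\<Sum>(g, h)\<leftarrow>xs. subst_poly \<eta> g * subst_poly \<zeta> h)"
    "subst_poly (\<lambda>v. \<eta> v + \<zeta> v) q = (\<Sum>(g, h)\<leftarrow>ys. subst_poly \<eta> g * subst_poly \<zeta> h)"
    by blast
  then show ?case by (intro exI[of _ "xs @ ys"]) (simp add: subst_poly_add)
next
  case (mult p q)
  then obtain xs ys where
    "subst_poly (\<lambda>v. \<eta> v + \<zeta> v) p = (\<Sum>(g, h)\<leftarrow>xs. subst_poly \<eta> g * subst_poly \<zeta> h)"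
    "subst_poly (\<lambda>v. \<eta> v + \<zeta> v) q = (\<Sum>(g, h)\<leftarrow>ys. subst_poly \<eta> g * subst_poly \<zeta> h)"
    by blast
  then have "subst_poly (\<lambda>v. \<eta> v + \<zeta> v) (p * q) =
      (\<Sum>(x, y)\<leftarrow>List.product xs ys. (case x of (g, h) \<Rightarrow> subst_poly \<eta> g * subst_poly \<zeta> h) *
        (case y of (g, h) \<Rightarrow> subst_poly \<eta> g * subst_poly \<zeta> h))"
    by (simp only: subst_poly_mult sum_list_mult_product)
  also have "\<dots> = (\<Sum>(g, h)\<leftarrow>map (\<lambda>((g, h), (g', h')). (g * g', h * h')) (List.product xs ys).
      subst_poly \<eta> g * subst_poly \<zeta> h)"
    unfolding map_map
    by (intro arg_cong[where f = sum_list] map_cong refl) (auto simp: subst_poly_mult mult_ac)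
  finally show ?case by blast
qed

lemma subspace_set_plus:
  assumes A: "ideal.subspace A" and B: "ideal.subspace B"
  shows "ideal.subspace (A + B)"
proof (rule ideal.subspaceI)
  show "0 \<in> A + B"
    using set_plus_intro[OF ideal.subspace_0[OF A] ideal.subspace_0[OF B]] by simp
  show "x + y \<in> A + B" if xy: "x \<in> A + B" "y \<in> A + B" for x y
  proof -
    obtain a b a' b' where "x = a + b" "y = a' + b'" "a \<in> A" "a' \<in> A" "b \<in> B" "b' \<in> B"
      using xy unfolding set_plus_def by blast
    then show ?thesis
      using set_plus_intro[OF ideal.subspace_add[OF A] ideal.subspace_add[OF B], of a a' b b']
      by (simp add: ac_simps)
  qed
  show "c * x \<in> A + B" if "x \<in> A + B" for c x
    using that ideal.subspace_scale[OF A] ideal.subspace_scale[OF B]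
    by (auto elim!: set_plus_elim simp: distrib_left intro!: set_plus_intro)
qed

lemma subspace_plus_I1: "ideal.subspace B \<Longrightarrow> x \<in> A \<Longrightarrow> x \<in> A + B"
  using set_plus_intro[of x A 0 B] ideal.subspace_0 by auto

lemma subspace_plus_I2: "ideal.subspace A \<Longrightarrow> x \<in> B \<Longrightarrow> x \<in> A + B"
  using set_plus_intro[of 0 A x B] ideal.subspace_0 by auto

definition subst_kernel :: "('v \<Rightarrow> ('w, 'k::comm_ring_1) mpoly) \<Rightarrow> ('v, 'k) mpoly set" where
  "subst_kernel \<sigma> = {f. subst_poly \<sigma> f = 0}"

lemma subspace_subst_kernel: "ideal.subspace (subst_kernel \<sigma>)"
  by (auto simp: ideal.subspace_def subst_kernel_def subst_poly_add subst_poly_mult)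

lemma span_le_subst_kernel:
  "(\<And>x. x \<in> S \<Longrightarrow> subst_poly \<sigma> x = 0) \<Longrightarrow> x \<in> ideal.span S \<Longrightarrow> subst_poly \<sigma> x = 0"
  using ideal.span_minimal[of S "subst_kernel \<sigma>"] subspace_subst_kernel
  by (auto simp: subst_kernel_def)

lemma is_prime_subst_kernel:
  fixes \<sigma> :: "'v \<Rightarrow> ('w::linorder, 'k::idom) mpoly"
  shows "is_prime_ideal (subst_kernel \<sigma>)"
  unfolding is_prime_ideal_def
  using subspace_subst_kernel by (auto simp: subst_kernel_def subst_poly_mult dest: eqset_imp_iff[of _ _ 1])

text \<open>Sending \<open>x\<close>, \<open>y\<close>, \<open>z\<close> to
  \<open>\<sigma> + \<tau>\<close>, \<open>\<sigma>\<close>, \<open>\<tau>\<close> kills all three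
  generating sets, so the join lies in the kernel. Conversely \<open>f (x)\<close> is congruent to
  \<open>f (y + z)\<close> modulo the linear relations, and this is a sum of products
  \<open>g (y) h (z)\<close>; as \<open>\<sigma>\<close> and \<open>\<tau>\<close> use disjoint
  variables, \<open>tensor_kernel\<close> applies.\<close>

lemma ideal_join_subst_kernel:
  fixes \<sigma> \<tau> :: "'v \<Rightarrow> ('w, 'k::field) mpoly"
  assumes \<sigma>: "\<And>v. \<sigma> v \<in> polys_in V" and \<tau>: "\<And>v. \<tau> v \<in> polys_in U" and disj: "V \<inter> U = {}"
  shows "ideal_join (subst_kernel \<sigma>) (subst_kernel \<tau>) = subst_kernel (\<lambda>v. \<sigma> v + \<tau> v)"
proof -
  let ?X = "\<lambda>a. Var (XVar a) :: ('v xyz, 'k) mpoly"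
  let ?Y = "\<lambda>a. Var (YVar a) :: ('v xyz, 'k) mpoly"
  let ?Z = "\<lambda>a. Var (ZVar a) :: ('v xyz, 'k) mpoly"
  let ?A = "ideal.span (subst_poly ?Y ` subst_kernel \<sigma>)"
  let ?B = "ideal.span (subst_poly ?Z ` subst_kernel \<tau>)"
  let ?C = "ideal.span {?X a - ?Y a - ?Z a | a. True}"
  have sub: "ideal.subspace (?A + ?B)" "ideal.subspace (?A + ?B + ?C)"
    by (intro subspace_set_plus ideal.subspace_span)+
  show ?thesis
  proof (intro equalityI subsetI)
    fix f assume "f \<in> ideal_join (subst_kernel \<sigma>) (subst_kernel \<tau>)"
    then obtain p q w where pqw: "subst_poly ?X f = p + q + w" "p \<in> ?A" "q \<in> ?B" "w \<in> ?C"
      by (auto simp: ideal_join_def elim!: set_plus_elim)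
    define \<theta> where "\<theta> x = (case x of XVar a \<Rightarrow> \<sigma> a + \<tau> a | YVar a \<Rightarrow> \<sigma> a | ZVar a \<Rightarrow> \<tau> a)" for x
    have "subst_poly \<theta> p = 0" "subst_poly \<theta> q = 0" "subst_poly \<theta> w = 0"
      using pqw(2-) by (auto elim!: span_le_subst_kernel[rotated]
          simp: subst_poly_subst \<theta>_def subst_kernel_def subst_poly_diff)
    then have "subst_poly \<theta> (subst_poly ?X f) = 0" by (simp add: pqw(1) subst_poly_add)
    then show "f \<in> subst_kernel (\<lambda>v. \<sigma> v + \<tau> v)"
      by (simp add: subst_poly_subst \<theta>_def subst_kernel_def)
  next
    fix f assume f: "f \<in> subst_kernel (\<lambda>v. \<sigma> v + \<tau> v)"
    obtain xs where xs: "subst_poly (\<lambda>v. ?Y v + ?Z v) f = (\<Sum>(g, h)\<leftarrow>xs. subst_poly ?Y g * subst_poly ?Z h)"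
      using subst_add_separate[of ?Y ?Z f] by blast
    define \<theta> where "\<theta> x = (case x of XVar a \<Rightarrow> 0 | YVar a \<Rightarrow> \<sigma> a | ZVar a \<Rightarrow> \<tau> a)" for x
    have "subst_poly \<theta> (subst_poly (\<lambda>v. ?Y v + ?Z v) f) =
        (\<Sum>(g, h)\<leftarrow>xs. subst_poly \<theta> (subst_poly ?Y g) * subst_poly \<theta> (subst_poly ?Z h))"
      unfolding xs by (simp add: subst_poly.hom_sum_list o_def case_prod_unfold subst_poly_mult)
    then have xs': "(\<Sum>(g, h)\<leftarrow>xs. subst_poly \<sigma> g * subst_poly \<tau> h) = 0"
      using f by (simp add: subst_poly_subst subst_poly_add \<theta>_def subst_kernel_def)
    have conv: "(\<Sum>(g, h)\<leftarrow>xs. subst_poly \<alpha> g * subst_poly \<beta> h) =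
        (\<Sum>i\<in>{..<length xs}. subst_poly \<alpha> (fst (xs ! i)) * subst_poly \<beta> (snd (xs ! i)))"
      for \<alpha> \<beta> :: "'v \<Rightarrow> ('x, 'k) mpoly"
      by (simp add: sum_list_sum_nth case_prod_unfold atLeast0LessThan)
    have "subst_poly (\<lambda>v. ?Y v + ?Z v) f \<in> ?A + ?B"
      unfolding xs conv
    proof (rule tensor_kernel[OF \<sigma> \<tau> disj sub(1)])
      show "subst_poly ?Y g \<in> ?A + ?B" if "subst_poly \<sigma> g = 0" for g
        using that by (intro subspace_plus_I1 ideal.subspace_span ideal.span_base) (auto simp: subst_kernel_def)
      show "subst_poly ?Z g \<in> ?A + ?B" if "subst_poly \<tau> g = 0" for g
        using that by (intro subspace_plus_I2 ideal.subspace_span ideal.span_base) (auto simp: subst_kernel_def)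
    qed (use xs' in \<open>simp_all add: conv\<close>)
    moreover have "subst_poly ?X f - subst_poly (\<lambda>v. ?Y v + ?Z v) f \<in> ?C"
      by (intro subst_poly_cong_mod ideal.subspace_span) (auto intro!: ideal.span_base simp: algebra_simps)
    ultimately have "subst_poly (\<lambda>v. ?Y v + ?Z v) f + (subst_poly ?X f - subst_poly (\<lambda>v. ?Y v + ?Z v) f) \<in> ?A + ?B + ?C"
      by (rule set_plus_intro)
    then show "f \<in> ideal_join (subst_kernel \<sigma>) (subst_kernel \<tau>)"
      by (simp add: ideal_join_def)
  qed
qed

instance uprod :: (finite) finite
  by standard simp

section \<open>Exponents under monomial substitutions\<close>

text \<open>The inner sum is the multiple \<open>lookup t v\<close> of \<open>m v\<close>. The
  result is the exponent of the image of \<open>t\<close> when each \<open>v\<close> is replaced by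
  the monomial \<open>m v\<close>.\<close>

definition lin_exp :: "('v::finite \<Rightarrow> 'w monom) \<Rightarrow> 'v monom \<Rightarrow> 'w monom" where
  "lin_exp m t = (\<Sum>v\<in>UNIV. \<Sum>i<lookup t v. m v)"

lemma lookup_lin_exp: "lookup (lin_exp m t) w = (\<Sum>v\<in>UNIV. lookup t v * lookup (m v) w)"
  by (simp add: lin_exp_def lookup_sum)

lemma lin_exp_add: "lin_exp m (s + t) = lin_exp m s + lin_exp m t"
  by (rule poly_mapping_eqI) (simp add: lookup_lin_exp lookup_add distrib_right sum.distrib)

lemma lin_exp_0 [simp]: "lin_exp m 0 = 0"
  by (simp add: lin_exp_def)

lemma lin_exp_single [simp]: "lin_exp m (single v (Suc 0)) = m v"
  by (rule poly_mapping_eqI) (simp add: lookup_lin_exp lookup_single when_mult, simp add: when_def)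

lemma single_1_power: "single m (1 :: 'k::comm_ring_1) ^ n = single (\<Sum>i<n. m) 1" for m :: "'w monom"
  using prod_single[where t = "\<lambda>_. m" and A = "{..<n}"] by simp

lemma subst_monom_monomials:
  fixes m :: "'v::finite \<Rightarrow> 'w monom"
  shows "subst_monom (\<lambda>v. single (m v) (1 :: 'k::comm_ring_1)) t = single (lin_exp m t) 1"
  by (subst subst_monom_superset[of UNIV]) (auto simp: single_1_power prod_single lin_exp_def)

section \<open>Vertex degrees and nested intervals\<close>

text \<open>Degree of the vertex \<open>i\<close> in the multigraph with edges \<open>t\<close>, a
  loop counting twice; equivalently, the exponent of \<open>a_i\<close> in the image of
  \<open>t\<close> when each \<open>x_ij\<close> becomes \<open>a_i a_j\<close>.\<close>

definition vdeg :: "'m::{finite,linorder} uprod monom \<Rightarrow> 'm \<Rightarrow> nat" where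
  "vdeg t i = (\<Sum>e\<in>UNIV. lookup t e * (of_bool (lo e = i) + of_bool (hi e = i)))"

definition uprec :: "'m::linorder uprod \<Rightarrow> 'm uprod \<Rightarrow> bool" where
  "uprec e f \<longleftrightarrow> lo e < lo f \<and> hi e < hi f"

lemma lo_le_hi: "lo e \<le> hi e"
  by (cases e) (auto simp: min_le_iff_disj)

lemma vdeg_add: "vdeg (s + t) = (\<lambda>i. vdeg s i + vdeg t i)"
  by (rule ext) (simp add: vdeg_def lookup_add distrib_right sum.distrib)

lemma vdeg_single: "vdeg (single (Upair a b) (Suc 0)) i = of_bool (a = i) + of_bool (b = i)"
proof -
  have "vdeg (single (Upair a b) (Suc 0)) i =
      (\<Sum>e\<in>UNIV. if e = Upair a b then of_bool (lo e = i) + of_bool (hi e = i) else 0)"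
    unfolding vdeg_def by (intro sum.cong) (auto simp: lookup_single when_def)
  then show ?thesis by (auto simp: min_def max_def)
qed

lemma vdeg_single': "vdeg (single e (Suc 0)) i = of_bool (lo e = i) + of_bool (hi e = i)"
  using vdeg_single[of "lo e" "hi e"] by simp

lemma sum_vdeg_single: "(\<Sum>i\<in>UNIV. vdeg (single e (Suc 0)) i) = 2"
proof -
  have "(\<Sum>i\<in>UNIV. of_bool (a = i)) = (1 :: nat)" for a :: 'a
    by (simp add: of_bool_def)
  then show ?thesis by (simp add: vdeg_single' sum.distrib)
qed

lemma vdeg_swap:
  "vdeg (single (Upair (lo e) (hi f)) (Suc 0) + (single (Upair (lo f) (hi e)) (Suc 0) + w)) =
    vdeg (single e (Suc 0) + single f (Suc 0) + w)"
  by (rule ext) (simp only: vdeg_add vdeg_single vdeg_single'[of e] vdeg_single'[of f] ac_simps)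

lemma vdeg_0 [simp]: "vdeg 0 i = 0"
  by (simp add: vdeg_def)

lemma vdeg_eq_0_iff: "vdeg t i = 0 \<longleftrightarrow> (\<forall>e\<in>keys t. lo e \<noteq> i \<and> hi e \<noteq> i)"
  by (auto simp: vdeg_def in_keys_iff)

lemma vdeg_all_0D: "(\<And>i. vdeg t i = 0) \<Longrightarrow> t = 0"
  unfolding vdeg_eq_0_iff by (metis keys_eq_empty equals0I)

text \<open>The edge spanning all vertices of \<open>t\<close>. It depends on \<open>t\<close>
  through \<open>vdeg\<close> alone, so it can be split off simultaneously from two monomials of
  equal vertex degrees.\<close>

definition ext_edge :: "'m::{finite,linorder} uprod monom \<Rightarrow> 'm uprod" where
  "ext_edge t = Upair (Min {i. vdeg t i \<noteq> 0}) (Max {i. vdeg t i \<noteq> 0})"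

lemma monom_split_single:
  fixes t :: "'v monom"
  assumes "e \<in> keys t"
  shows "\<exists>w. t = single e (Suc 0) + w"
  using assms
  by (intro exI[of _ "t - single e (Suc 0)"] poly_mapping_eqI)
    (auto simp: lookup_add lookup_minus lookup_single when_def in_keys_iff)

text \<open>Some \<open>e\<close> starts at the least vertex of \<open>t\<close> and some
  \<open>f\<close> ends at the greatest. If neither is \<open>ext_edge t\<close>, then
  \<open>e\<close> precedes \<open>f\<close> in \<open>uprec\<close>, and one swap of end points
  will produce it.\<close>

lemma ext_edge_cases:
  assumes "t \<noteq> 0"
  obtains w where "t = single (ext_edge t) (Suc 0) + w"
  | e f w where "e \<in> keys t" "f \<in> keys t" "uprec e f" "Upair (lo e) (hi f) = ext_edge t"
    "t = single e (Suc 0) + single f (Suc 0) + w"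
proof -
  define V where "V = {i. vdeg t i \<noteq> 0}"
  have V: "finite V" by (simp add: V_def)
  have inV: "lo e \<in> V" "hi e \<in> V" if "e \<in> keys t" for e
    using that by (auto simp: V_def vdeg_eq_0_iff)
  obtain e where "e \<in> keys t" using assms by (metis keys_eq_empty ex_in_conv)
  then have "V \<noteq> {}" using inV by auto
  then have m: "Min V \<in> V" "Max V \<in> V" using V by auto
  have "\<exists>e\<in>keys t. lo e = Min V"
  proof -
    obtain e where e: "e \<in> keys t" "lo e = Min V \<or> hi e = Min V"
      using m(1) by (auto simp: V_def vdeg_eq_0_iff)
    then show ?thesis using Min_le[OF V inV(1)[OF e(1)]] lo_le_hi[of e] by force
  qed
  then obtain e where e: "e \<in> keys t" "lo e = Min V" by auto
  have "\<exists>f\<in>keys t. hi f = Max V"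
  proof -
    obtain f where f: "f \<in> keys t" "lo f = Max V \<or> hi f = Max V"
      using m(2) by (auto simp: V_def vdeg_eq_0_iff)
    then show ?thesis using Max_ge[OF V inV(2)[OF f(1)]] lo_le_hi[of f] by force
  qed
  then obtain f where f: "f \<in> keys t" "hi f = Max V" by auto
  have ext: "ext_edge t = Upair (lo e) (hi f)" unfolding ext_edge_def V_def[symmetric] e(2) f(2) ..
  show ?thesis
  proof (cases "hi e = hi f \<or> lo e = lo f")
    case True
    then have "ext_edge t = e \<or> ext_edge t = f" using ext by (metis Upair_lo_hi)
    then show ?thesis using e(1) f(1) monom_split_single that(1) by metis
  next
    case False
    then have prec: "uprec e f"
      using Min_le[OF V inV(1)[OF f(1)]] Max_ge[OF V inV(2)[OF e(1)]] e f by (auto simp: uprec_def)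
    obtain w where w: "t = single e (Suc 0) + w" using monom_split_single[OF e(1)] by auto
    have "f \<noteq> e" using prec by (auto simp: uprec_def)
    moreover have "f \<in> keys (single e (Suc 0)) \<union> keys w"
      using f(1) unfolding w keys_add_monom .
    ultimately have "f \<in> keys w" by simp
    from monom_split_single[OF this] obtain w' where "w = single f (Suc 0) + w'" ..
    then show ?thesis using that(2)[OF e(1) f(1) prec ext[symmetric]] w by (simp add: add.assoc)
  qed
qed

lemma ext_edge_cong: "vdeg s = vdeg t \<Longrightarrow> ext_edge s = ext_edge t"
  by (simp add: ext_edge_def)

text \<open>Two instances: congruence modulo the 2-minors, which is symmetric, and any diagonal term
  order. \<open>R_swap\<close> puts the nested pair on the left, as the smaller one, and the
  increasing pair with the same end points on the right.\<close>

locale swap_relation =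
  fixes R :: "'m::{finite,linorder} uprod monom \<Rightarrow> 'm uprod monom \<Rightarrow> bool"
  assumes R_refl: "R s s"
    and R_trans: "R s t \<Longrightarrow> R t u \<Longrightarrow> R s u"
    and R_add: "R s t \<Longrightarrow> R (s + u) (t + u)"
    and R_swap: "uprec e f \<Longrightarrow>
      R (single (Upair (lo e) (hi f)) 1 + single (Upair (lo f) (hi e)) 1) (single e 1 + single f 1)"
begin

lemma extract_ext_edge:
  assumes "t \<noteq> 0"
  obtains w where "R (single (ext_edge t) (Suc 0) + w) t" "vdeg (single (ext_edge t) (Suc 0) + w) = vdeg t"
  using assms
proof (cases rule: ext_edge_cases)
  case (1 w)
  then show ?thesis using R_refl that by metis
next
  case (2 e f w)
  have "R (single (ext_edge t) (Suc 0) + (single (Upair (lo f) (hi e)) (Suc 0) + w)) t"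
    using R_add[OF R_swap[OF 2(3)], of w] 2(4,5) by (simp add: add.assoc)
  moreover have "vdeg (single (ext_edge t) (Suc 0) + (single (Upair (lo f) (hi e)) (Suc 0) + w)) = vdeg t"
    using vdeg_swap[of e f w] unfolding 2(4) by (simp flip: 2(5))
  ultimately show ?thesis by (rule that)
qed

text \<open>Both monomials can be swapped so as to contain their common \<open>ext_edge\<close>;
  splitting it off lowers the degree. Symmetry is used to pass from \<open>s\<close> to its swapped
  form.\<close>

lemma same_vdeg:
  assumes sym: "\<And>s t. R s t \<Longrightarrow> R t s" and "vdeg s = vdeg t"
  shows "R s t"
  using assms(2)
proof (induction "\<Sum>i\<in>UNIV. vdeg s i" arbitrary: s t rule: less_induct)
  case less
  show ?case
  proof (cases "s = 0")
    case True
    then have "t = 0" using less.prems by (intro vdeg_all_0D) (simp flip: less.prems)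
    then show ?thesis using True R_refl by simp
  next
    case False
    then have "t \<noteq> 0" using less.prems by (metis vdeg_0 vdeg_all_0D)
    define e where "e = single (ext_edge s) (Suc 0)"
    have e': "single (ext_edge t) (Suc 0) = e" using ext_edge_cong[OF less.prems] by (simp add: e_def)
    obtain w where w: "R (e + w) s" "vdeg (e + w) = vdeg s"
      using extract_ext_edge[OF False] unfolding e_def by blast
    obtain x where x: "R (e + x) t" "vdeg (e + x) = vdeg t"
      using extract_ext_edge[OF \<open>t \<noteq> 0\<close>] unfolding e' by blast
    have "vdeg w = vdeg x"
      using w(2) x(2) less.prems by (simp add: vdeg_add fun_eq_iff) (metis add_left_cancel)
    moreover have "(\<Sum>i\<in>UNIV. vdeg w i) < (\<Sum>i\<in>UNIV. vdeg s i)"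
    proof -
      have "(\<Sum>i\<in>UNIV. vdeg s i) = (\<Sum>i\<in>UNIV. vdeg e i) + (\<Sum>i\<in>UNIV. vdeg w i)"
        unfolding w(2)[symmetric] by (simp add: vdeg_add sum.distrib)
      then show ?thesis by (simp add: e_def sum_vdeg_single)
    qed
    ultimately have "R w x" using less.hyps by blast
    then have "R (e + w) (e + x)" using R_add[of w x e] by (simp add: add.commute)
    then show ?thesis using w(1) x(1) sym R_trans by blast
  qed
qed

text \<open>An antichain \<open>s\<close> already contains its \<open>ext_edge\<close>, as a swap
  would need two comparable elements. So only \<open>t\<close> has to be swapped, in the direction
  that \<open>R\<close> allows.\<close>

lemma nested_least:
  assumes "\<And>e f. e \<in> keys s \<Longrightarrow> f \<in> keys s \<Longrightarrow> \<not> uprec e f" "vdeg s = vdeg t"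
  shows "R s t"
  using assms
proof (induction "\<Sum>i\<in>UNIV. vdeg s i" arbitrary: s t rule: less_induct)
  case less
  show ?case
  proof (cases "s = 0")
    case True
    then have "t = 0" using less.prems by (intro vdeg_all_0D) (simp flip: less.prems(2))
    then show ?thesis using True R_refl by simp
  next
    case False
    then have "t \<noteq> 0" using less.prems by (metis vdeg_0 vdeg_all_0D)
    define e where "e = single (ext_edge s) (Suc 0)"
    have e': "single (ext_edge t) (Suc 0) = e" using ext_edge_cong[OF less.prems(2)] by (simp add: e_def)
    obtain w where w: "s = e + w"
      using False less.prems(1) unfolding e_def by (cases rule: ext_edge_cases) auto
    obtain x where x: "R (e + x) t" "vdeg (e + x) = vdeg t"
      using extract_ext_edge[OF \<open>t \<noteq> 0\<close>] unfolding e' by blast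
    have "vdeg w = vdeg x"
      using x(2) less.prems(2) by (simp add: vdeg_add w fun_eq_iff) (metis add_left_cancel)
    moreover have "(\<Sum>i\<in>UNIV. vdeg w i) < (\<Sum>i\<in>UNIV. vdeg s i)"
      by (simp add: w vdeg_add sum.distrib) (simp add: e_def sum_vdeg_single)
    moreover have "\<not> uprec f g" if "f \<in> keys w" "g \<in> keys w" for f g
      using less.prems(1) that by (auto simp: w keys_add_monom)
    ultimately have "R w x" using less.hyps by blast
    then have "R (e + w) (e + x)" using R_add[of w x e] by (simp add: add.commute)
    then show ?thesis using w x(1) R_trans by blast
  qed
qed

end

section \<open>The ideal of 2-minors and its secant ideals as kernels\<close>

text \<open>
  The target ring has variables \<open>a\<^sub>k\<^sub>,\<^sub>i\<close> (row \<open>i\<close> of the \<open>k\<close>-th summand \<open>a\<^sub>k a\<^sub>k\<^sup>T\<close> of a matrix of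
  low rank) and \<open>z\<^sub>e\<close> (a generic symmetric perturbation), encoded in one linearly ordered type.
\<close>

abbreviation avar :: "nat \<Rightarrow> 'm \<Rightarrow> 'm uprod \<times> nat" where "avar k i \<equiv> (Upair i i, Suc k)"
abbreviation zvar :: "'m uprod \<Rightarrow> 'm uprod \<times> nat" where "zvar e \<equiv> (e, 0)"

definition ver_mon :: "nat \<Rightarrow> 'm::linorder uprod \<Rightarrow> ('m uprod \<times> nat) monom" where
  "ver_mon k e = single (avar k (lo e)) 1 + single (avar k (hi e)) 1"

text \<open>The \<open>k\<close>-th copy of the Veronese parametrisation; different \<open>k\<close>
  use disjoint variables, as the join of kernels requires.\<close>

definition ver :: "nat \<Rightarrow> 'm::linorder uprod \<Rightarrow> ('m uprod \<times> nat, 'k::comm_ring_1) mpoly" where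
  "ver k e = single (ver_mon k e) 1"

definition sec :: "nat \<Rightarrow> 'm::linorder uprod \<Rightarrow> ('m uprod \<times> nat, 'k::comm_ring_1) mpoly" where
  "sec r e = (\<Sum>k<r. ver k e)"

lemma ver_Upair: "ver k (Upair i j) = Var (avar k i) * Var (avar k j)"
  by (cases "i \<le> j") (auto simp: ver_def ver_mon_def Var_def mult_single add.commute min_def max_def)

lemma sec_Upair: "sec r (Upair i j) = (\<Sum>k<r. Var (avar k i) * Var (avar k j))"
  by (simp add: sec_def ver_Upair)

lemma lookup_lin_ver:
  "lookup (lin_exp (ver_mon k) t) (avar k' i) = (if k = k' then vdeg t i else 0)"
  by (auto simp: lookup_lin_exp ver_mon_def lookup_add lookup_single when_def vdeg_def intro!: sum.cong)

lemma ver_in_polys: "ver k e \<in> polys_in (range (avar k))"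
  by (cases e) (auto simp: ver_Upair intro!: polys_in_mult polys_in_Var)

lemma polys_in_0: "0 \<in> polys_in V"
  by (simp add: polys_in_def)

lemma polys_in_sum: "(\<And>x. x \<in> A \<Longrightarrow> f x \<in> polys_in V) \<Longrightarrow> sum f A \<in> polys_in V"
  by (induction A rule: infinite_finite_induct) (auto intro!: polys_in_add polys_in_0)

lemma polys_in_mono: "V \<subseteq> W \<Longrightarrow> polys_in V \<subseteq> polys_in W"
  by (auto simp: polys_in_def)

lemma sec_in_polys: "sec r e \<in> polys_in (\<Union>k<r. range (avar k))"
  unfolding sec_def
proof (rule polys_in_sum)
  fix k assume "k \<in> {..<r}"
  then have "range (avar k) \<subseteq> (\<Union>k<r. range (avar k))" by blast
  then show "ver k e \<in> polys_in (\<Union>k<r. range (avar k))" by (rule subsetD[OF polys_in_mono ver_in_polys])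
qed

lemma det_2: "det (mat 2 2 f) = f (0, 0) * f (1, 1) - f (0, 1) * (f (1, 0) :: 'a::comm_ring_1)"
  by (subst laplace_expansion_row[of _ 2 0])
    (auto simp: numeral_2_eq_2 cofactor_def mat_delete_def det_single lessThan_Suc)

lemma minor_2: "minor A 2 \<rho> \<gamma> = A (\<rho> 0) (\<gamma> 0) * A (\<rho> 1) (\<gamma> 1) - A (\<rho> 0) (\<gamma> 1) * A (\<rho> 1) (\<gamma> 0)"
  by (simp add: minor_def det_2)

text \<open>With the left end points as rows and the right ones as columns, the diagonal of the
  minor is the increasing pair and the antidiagonal the nested pair. Thus 2-minors are exactly what
  realises \<open>R_swap\<close>.\<close>

lemma minor_2_swap:
  assumes "uprec e f"
  defines "\<rho> \<equiv> (\<lambda>n::nat. if n = 0 then lo e else lo f)"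
    and "\<gamma> \<equiv> (\<lambda>n::nat. if n = 0 then hi e else hi f)"
  shows "strict_mono_on {..<2} \<rho>" "strict_mono_on {..<2} \<gamma>"
    and "minor generic_sym 2 \<rho> \<gamma> = (single (single e 1 + single f 1) 1 -
      single (single (Upair (lo e) (hi f)) 1 + single (Upair (lo f) (hi e)) 1) 1 :: ('m::linorder uprod, 'k::comm_ring_1) mpoly)"
  using assms(1)
  by (auto simp: minor_2 generic_sym_def Var_def mult_single \<rho>_def \<gamma>_def strict_mono_on_def uprec_def less_2_cases_iff)

lemma swap_relation_ideal:
  "swap_relation (\<lambda>s t. single s 1 - single t 1 \<in> (sym_minor_ideal :: ('m::{finite,linorder} uprod, 'k::comm_ring_1) mpoly set))"
proof
  let ?I = "sym_minor_ideal :: ('m uprod, 'k) mpoly set"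
  have sub: "ideal.subspace ?I" by (simp add: sym_minor_ideal_def)
  fix s t u :: "'m uprod monom" and e f :: "'m uprod"
  show "single s 1 - single s 1 \<in> ?I" using ideal.subspace_0[OF sub] by simp
  show "single s 1 - single u 1 \<in> ?I" if "single s 1 - single t 1 \<in> ?I" "single t 1 - single u 1 \<in> ?I"
    using ideal.subspace_add[OF sub that] by simp
  show "single (s + u) 1 - single (t + u) 1 \<in> ?I" if "single s 1 - single t 1 \<in> ?I"
    using subspace_mult_right[OF sub that, of "single u 1"] by (simp add: left_diff_distrib mult_single)
  show "single (single (Upair (lo e) (hi f)) 1 + single (Upair (lo f) (hi e)) 1) 1 -
      single (single e 1 + single f 1) 1 \<in> ?I" if ef: "uprec e f"
  proof -
    have "single (single e 1 + single f 1) 1 -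
        single (single (Upair (lo e) (hi f)) 1 + single (Upair (lo f) (hi e)) 1) 1 \<in> ?I"
      unfolding minor_2_swap(3)[OF ef, symmetric] sym_minor_ideal_def minors_def
      using minor_2_swap(1,2)[OF ef] by (intro ideal.span_base) blast
    then show ?thesis using subspace_neg[OF sub] by force
  qed
qed

text \<open>Valid for every \<open>k\<close>, so that each copy in a join can have its own
  variables. A kernel element is reduced term by term to chosen representatives with the same image.
  These have equal vertex degrees, so \<open>same_vdeg\<close> applies, and the coefficients
  collected at one representative add up to a coefficient of the image, which is zero.\<close>

lemma sym_minor_ideal_eq_kernel:
  "(sym_minor_ideal :: ('m::{finite,linorder} uprod, 'k::comm_ring_1) mpoly set) = subst_kernel (ver k)"
proof (intro equalityI subsetI)
  fix f :: "('m uprod, 'k) mpoly"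
  assume "f \<in> sym_minor_ideal"
  then show "f \<in> subst_kernel (ver k)"
    unfolding sym_minor_ideal_def subst_kernel_def
    by (auto elim!: span_le_subst_kernel[rotated]
        simp: minors_def minor_2 generic_sym_def subst_poly_diff subst_poly_mult ver_Upair mult_ac)
next
  fix f :: "('m uprod, 'k) mpoly"
  assume f: "f \<in> subst_kernel (ver k)"
  let ?I = "sym_minor_ideal :: ('m uprod, 'k) mpoly set"
  interpret swap_relation "\<lambda>s t. single s 1 - single t 1 \<in> ?I" by (rule swap_relation_ideal)
  have sub: "ideal.subspace ?I" by (simp add: sym_minor_ideal_def)
  let ?L = "lin_exp (ver_mon k) :: 'm uprod monom \<Rightarrow> _"
  define rep where "rep \<kappa> = (SOME t. ?L t = \<kappa>)" for \<kappa>
  have rep: "?L (rep (?L t)) = ?L t" for t unfolding rep_def by (rule someI) simp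
  have "vdeg (rep (?L t)) = vdeg t" for t
    using arg_cong[OF rep, of "\<lambda>p. lookup p (avar k i)" t for i] by (auto simp: lookup_lin_ver)
  moreover have "single t 1 - single s 1 \<in> ?I" if "single s 1 - single t 1 \<in> ?I" for s t
    using subspace_neg[OF sub that] by simp
  ultimately have "single t 1 - single (rep (?L t)) 1 \<in> ?I" for t
    using same_vdeg by simp
  then have "Const c * (single t 1 - single (rep (?L t)) 1) \<in> ?I" for c t
    by (rule ideal.subspace_scale[OF sub])
  then have "single t c - single (rep (?L t)) c \<in> ?I" for c t
    by (simp add: right_diff_distrib mult_single)
  then have "(\<Sum>t\<in>keys f. single t (lookup f t) - single (rep (?L t)) (lookup f t)) \<in> ?I"
    by (intro ideal.subspace_sum[OF sub])
  moreover have "(\<Sum>t\<in>keys f. single (rep (?L t)) (lookup f t)) = 0"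
  proof -
    have coeff: "(\<Sum>t\<in>{t \<in> keys f. ?L t = \<kappa>}. lookup f t) = 0" for \<kappa>
    proof -
      have "0 = lookup (subst_poly (ver k) f) \<kappa>" using f by (simp add: subst_kernel_def)
      also have "\<dots> = (\<Sum>t\<in>keys f. lookup f t when ?L t = \<kappa>)"
        unfolding subst_poly_superset[OF finite_keys subset_refl] ver_def[abs_def]
        by (simp add: subst_monom_monomials mult_single lookup_sum lookup_single)
      also have "\<dots> = (\<Sum>t\<in>{t \<in> keys f. ?L t = \<kappa>}. lookup f t)"
        by (simp add: when_def sum.inter_filter)
      finally show ?thesis by simp
    qed
    have "(\<Sum>t\<in>keys f. single (rep (?L t)) (lookup f t)) =
        (\<Sum>\<kappa>\<in>?L ` keys f. \<Sum>t\<in>{t \<in> keys f. ?L t = \<kappa>}. single (rep (?L t)) (lookup f t))"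
      by (rule sum.image_gen) simp
    also have "\<dots> = (\<Sum>\<kappa>\<in>?L ` keys f. single (rep \<kappa>) (\<Sum>t\<in>{t \<in> keys f. ?L t = \<kappa>}. lookup f t))"
      by (intro sum.cong refl poly_mapping_eqI) (simp add: lookup_sum lookup_single when_def)
    finally show ?thesis by (simp add: coeff)
  qed
  ultimately show "f \<in> ?I" by (simp add: sum_subtractf sum_single_keys)
qed

lemma secant_sym_minor_ideal:
  assumes "r \<ge> 1"
  shows "secant_ideal (sym_minor_ideal :: ('m::{finite,linorder} uprod, 'k::field) mpoly set) r = subst_kernel (sec r)"
proof -
  have "(ideal_join (sym_minor_ideal :: ('m uprod, 'k) mpoly set) ^^ n) sym_minor_ideal = subst_kernel (sec (Suc n))" for n
  proof (induction n)
    case 0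
    show ?case by (simp add: sym_minor_ideal_eq_kernel[of 0] sec_def)
  next
    case (Suc n)
    \<comment> \<open>\<open>sec (Suc n)\<close> involves the indices \<open>0\<close> to
      \<open>n\<close>; the new copy of the ideal is presented with the fresh index
      \<open>Suc n\<close>, which makes the variables disjoint.\<close>
    have "ideal_join (subst_kernel (ver (Suc n))) (subst_kernel (sec (Suc n))) =
        subst_kernel (\<lambda>e :: 'm uprod. ver (Suc n) e + sec (Suc n) e :: (_, 'k) mpoly)"
      by (rule ideal_join_subst_kernel[OF ver_in_polys sec_in_polys]) auto
    also have "\<dots> = subst_kernel (sec (Suc (Suc n)))"
    proof -
      have "(\<lambda>e. ver (Suc n) e + sec (Suc n) e) = (sec (Suc (Suc n)) :: 'm uprod \<Rightarrow> (_, 'k) mpoly)"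
        by (rule ext) (simp add: sec_def add_ac)
      then show ?thesis by simp
    qed
    finally show ?case
      using Suc by (simp flip: sym_minor_ideal_eq_kernel[of "Suc n"])
  qed
  from this[of "r - 1"] show ?thesis using assms by (simp add: secant_ideal_def)
qed

section \<open>Symbolic powers of prime ideals\<close>

lemma subspace_ideal_power: "ideal.subspace (ideal_power I n)"
  by (cases n) (auto simp: ideal_mult_def ideal.subspace_UNIV)

lemma ideal_mult_subset:
  assumes "ideal.subspace W" "\<And>a b. a \<in> I \<Longrightarrow> b \<in> J \<Longrightarrow> a * b \<in> W"
  shows "ideal_mult I J \<subseteq> W"
  unfolding ideal_mult_def using assms by (intro ideal.span_minimal) auto

lemma ideal_mult_I: "a \<in> I \<Longrightarrow> b \<in> J \<Longrightarrow> a * b \<in> ideal_mult I J"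
  unfolding ideal_mult_def by (intro ideal.span_base) auto

lemma ideal_power_mult:
  "a \<in> ideal_power I m \<Longrightarrow> b \<in> ideal_power I n \<Longrightarrow> a * b \<in> ideal_power I (m + n)"
proof (induction m arbitrary: a)
  case 0
  then show ?case using ideal.subspace_scale[OF subspace_ideal_power] by auto
next
  case (Suc m)
  define W where "W = {a. a * b \<in> ideal_power I (Suc m + n)}"
  have "ideal.subspace W"
    using subspace_ideal_power[of I "Suc m + n"]
    by (auto simp: W_def ideal.subspace_def distrib_right mult.assoc simp del: ideal_power.simps)
  moreover have "x * y \<in> W" if "x \<in> I" "y \<in> ideal_power I m" for x y
    using ideal_mult_I[OF that(1) Suc.IH[OF that(2) Suc.prems(2)]] by (simp add: W_def mult.assoc)
  ultimately have "ideal_power I (Suc m) \<subseteq> W" by (simp add: ideal_mult_subset)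
  then show ?case using Suc.prems(1) by (auto simp: W_def simp del: ideal_power.simps)
qed

lemma prod_in_ideal_power:
  "finite A \<Longrightarrow> (\<And>i. i \<in> A \<Longrightarrow> f i \<in> I) \<Longrightarrow> prod f A \<in> ideal_power I (card A)"
  by (induction A rule: finite_induct) (auto intro: ideal_mult_I)

lemma det_in_ideal_power:
  assumes "\<And>i j. i < n \<Longrightarrow> j < n \<Longrightarrow> f (i, j) \<in> I"
  shows "det (mat n n f) \<in> ideal_power I n"
proof -
  have "(\<Prod>i = 0..<n. mat n n f $$ (i, p i)) \<in> ideal_power I (card {0..<n})" if "p permutes {0..<n}" for p
    using permutes_in_image[OF that] assms by (intro prod_in_ideal_power) auto
  then show ?thesis
    unfolding det_def'[OF mat_carrier]
    by (intro ideal.subspace_sum[OF subspace_ideal_power] ideal.subspace_scale[OF subspace_ideal_power]) auto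
qed

lemma minimal_primes_prime: "is_prime_ideal P \<Longrightarrow> minimal_primes P = {P}"
  by (auto simp: minimal_primes_def)

lemma symbolic_power_prime:
  assumes "is_prime_ideal P"
  shows "symbolic_power P s = {f. \<exists>a\<in>ideal_power P s. \<exists>u w. u \<notin> P \<and> w \<notin> P \<and> w * (u * f - a) = 0}"
  by (auto simp: symbolic_power_def minimal_primes_prime[OF assms] Let_def)

lemma one_notin_prime: "is_prime_ideal P \<Longrightarrow> 1 \<notin> P"
  using ideal.subspace_scale[of P 1] by (fastforce simp: is_prime_ideal_def)

lemma mult_notin_prime: "is_prime_ideal P \<Longrightarrow> a \<notin> P \<Longrightarrow> b \<notin> P \<Longrightarrow> a * b \<notin> P"
  by (auto simp: is_prime_ideal_def)

lemma symbolic_powerI: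
  assumes "is_prime_ideal P" "u \<notin> P" "u * f \<in> ideal_power P s"
  shows "f \<in> symbolic_power P s"
proof -
  have "1 * (u * f - u * f) = 0" by simp
  then show ?thesis
    unfolding symbolic_power_prime[OF assms(1)] using assms one_notin_prime[OF assms(1)] by blast
qed

lemma symbolic_power_mult:
  assumes P: "is_prime_ideal P" and "f \<in> symbolic_power P m" "g \<in> symbolic_power P n"
  shows "f * g \<in> symbolic_power P (m + n)"
proof -
  obtain a u w where a: "a \<in> ideal_power P m" "u \<notin> P" "w \<notin> P" "w * (u * f - a) = 0"
    using assms by (auto simp: symbolic_power_prime)
  obtain b v x where b: "b \<in> ideal_power P n" "v \<notin> P" "x \<notin> P" "x * (v * g - b) = 0"
    using assms by (auto simp: symbolic_power_prime)
  have "(w * x) * ((u * v) * (f * g) - a * b) =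
      x * (v * g) * (w * (u * f - a)) + w * a * (x * (v * g - b))"
    by (simp add: algebra_simps)
  then have "(w * x) * ((u * v) * (f * g) - a * b) = 0" using a(4) b(4) by simp
  then show ?thesis
    unfolding symbolic_power_prime[OF P]
    using ideal_power_mult[OF a(1) b(1)] mult_notin_prime[OF P] a b by blast
qed

lemma subspace_symbolic_power:
  assumes P: "is_prime_ideal P"
  shows "ideal.subspace (symbolic_power P s)"
proof (rule ideal.subspaceI)
  show "0 \<in> symbolic_power P s"
    using symbolic_powerI[OF P one_notin_prime[OF P], of 0 s]
      ideal.subspace_0[OF subspace_ideal_power[of P s]]
    by simp
  show "c * f \<in> symbolic_power P s" if "f \<in> symbolic_power P s" for c f
    using symbolic_power_mult[OF P symbolic_powerI[OF P one_notin_prime[OF P], of c 0] that] by simp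
  fix f g assume "f \<in> symbolic_power P s" "g \<in> symbolic_power P s"
  then obtain a u w b v x where a: "a \<in> ideal_power P s" "u \<notin> P" "w \<notin> P" "w * (u * f - a) = 0"
    and b: "b \<in> ideal_power P s" "v \<notin> P" "x \<notin> P" "x * (v * g - b) = 0"
    by (auto simp: symbolic_power_prime[OF P])
  have "(w * x) * ((u * v) * (f + g) - (v * a + u * b)) =
      x * v * (w * (u * f - a)) + w * u * (x * (v * g - b))"
    by (simp add: algebra_simps)
  then have "(w * x) * ((u * v) * (f + g) - (v * a + u * b)) = 0" using a(4) b(4) by simp
  moreover have "v * a + u * b \<in> ideal_power P s"
    using a b by (intro ideal.subspace_add[OF subspace_ideal_power] ideal.subspace_scale[OF subspace_ideal_power])
  ultimately show "f + g \<in> symbolic_power P s"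
    unfolding symbolic_power_prime[OF P] using mult_notin_prime[OF P] a b by blast
qed

lemma prime_le_symbolic_power_1: "is_prime_ideal P \<Longrightarrow> f \<in> P \<Longrightarrow> f \<in> symbolic_power P 1"
  using symbolic_powerI[of P 1 f 1] one_notin_prime[of P] ideal_mult_I[of f P 1 UNIV] by simp

section \<open>Order of vanishing along the perturbation\<close>

definition zdeg :: "('m::finite uprod \<times> nat) monom \<Rightarrow> nat" where
  "zdeg t = (\<Sum>e\<in>UNIV. lookup t (zvar e))"

text \<open>The \<open>s\<close>-th power of the ideal generated by the variables
  \<open>zvar e\<close>, described through exponents.\<close>

definition zord :: "nat \<Rightarrow> ('m::finite uprod \<times> nat, 'k::comm_ring_1) mpoly set" where
  "zord s = {p. \<forall>t\<in>keys p. s \<le> zdeg t}"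

definition perturbed :: "nat \<Rightarrow> 'm::linorder uprod \<Rightarrow> ('m uprod \<times> nat, 'k::comm_ring_1) mpoly" where
  "perturbed r e = sec r e + Var (zvar e)"

lemma zdeg_add: "zdeg (s + t) = zdeg s + zdeg t"
  by (simp add: zdeg_def lookup_add sum.distrib)

lemma zord_mult: "p \<in> zord a \<Longrightarrow> q \<in> zord b \<Longrightarrow> p * q \<in> zord (a + b)"
  unfolding zord_def by (clarsimp elim!: keys_mult_E simp: zdeg_add) (simp add: add_mono)

lemma subspace_zord: "ideal.subspace (zord s)"
proof (rule ideal.subspaceI)
  show "x + y \<in> zord s" if "x \<in> zord s" "y \<in> zord s" for x y :: "('a uprod \<times> nat, 'b) mpoly"
    using that keys_add[of x y] by (auto simp: zord_def)
  show "c * x \<in> zord s" if "x \<in> zord s" for c x :: "('a uprod \<times> nat, 'b) mpoly"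
    using zord_mult[of c 0 x s] that by (simp add: zord_def)
qed (simp add: zord_def)

text \<open>Leading monomials for an order that prefers small degree in the \<open>z\<close> are multiplicative.\<close>

lemma zord_cancel:
  fixes p q :: "('m::{finite,linorder} uprod \<times> nat, 'k::idom) mpoly"
  assumes "p \<notin> zord 1" "p * q \<in> zord s"
  shows "q \<in> zord s"
proof (rule ccontr)
  assume "q \<notin> zord s"
  then obtain t where t: "t \<in> keys q" "zdeg t < s" by (auto simp: zord_def)
  obtain u where u: "u \<in> keys p" "zdeg u = 0" using assms(1) by (auto simp: zord_def)
  define leq where "leq = weight_leq (\<lambda>t :: ('m uprod \<times> nat) monom. - int (zdeg t))"
  interpret monomial_order leq
    unfolding leq_def by (rule weight_leq_monomial_order) (simp add: zdeg_add)
  have leqD: "zdeg b \<le> zdeg a" if "leq a b" for a b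
    using that by (auto simp: leq_def weight_leq_def)
  have nz: "p \<noteq> 0" "q \<noteq> 0" using t u by auto
  then have "p * q \<noteq> 0" by simp
  then have "lead_monom leq p + lead_monom leq q \<in> keys (p * q)"
    using lead_monom_in_keys[of "p * q"] lead_monom_mult[OF nz] by simp
  moreover have "zdeg (lead_monom leq p) = 0" "zdeg (lead_monom leq q) < s"
    using leqD[OF lead_monom_greatest[OF nz(1) u(1)]] leqD[OF lead_monom_greatest[OF nz(2) t(1)]] t u
    by auto
  ultimately show False using assms(2) by (force simp: zord_def zdeg_add)
qed

lemma perturbed_diff_zord: "subst_poly (perturbed r) f - subst_poly (sec r) f \<in> zord 1"
proof (rule subst_poly_cong_mod[OF subspace_zord])
  fix e :: "'a uprod"
  have "1 \<le> zdeg (single (zvar e) 1)"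
    unfolding zdeg_def by (rule order.trans[OF _ member_le_sum[of e]]) auto
  then show "perturbed r e - sec r e \<in> zord 1"
    by (auto simp: perturbed_def zord_def Var_def split: if_splits)
qed

lemma perturbed_kernel_zord: "f \<in> subst_kernel (sec r) \<Longrightarrow> subst_poly (perturbed r) f \<in> zord 1"
  using perturbed_diff_zord[of r f] by (simp add: subst_kernel_def)

text \<open>Modulo \<open>zord 1\<close> the perturbed value agrees with
  \<open>subst_poly (sec r) f\<close>, which is free of the \<open>zvar e\<close> and so vanishes if
  it lies in \<open>zord 1\<close>. Hence denominators outside the kernel stay outside
  \<open>zord 1\<close>.\<close>

lemma perturbed_zord_kernel:
  assumes "subst_poly (perturbed r) f \<in> zord 1"
  shows "f \<in> subst_kernel (sec r)"
proof -
  have "subst_poly (sec r) f =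
      subst_poly (perturbed r) f + (- (subst_poly (perturbed r) f - subst_poly (sec r) f))" by simp
  also have "\<dots> \<in> zord 1"
    using assms perturbed_diff_zord by (intro ideal.subspace_add[OF subspace_zord] subspace_neg[OF subspace_zord])
  finally have ord: "subst_poly (sec r) f \<in> zord 1" .
  have "subst_poly (sec r) f \<in> polys_in (\<Union>k<r. range (avar k))"
    by (rule polys_in_subst[OF sec_in_polys])
  then have "zdeg t = 0" if "t \<in> keys (subst_poly (sec r) f)" for t
    using that by (force simp: polys_in_def zdeg_def in_keys_iff)
  then have "keys (subst_poly (sec r) f) = {}" using ord by (force simp: zord_def)
  then show ?thesis by (simp add: subst_kernel_def)
qed

text \<open>The kernel is mapped into \<open>zord 1\<close>, hence its powers into
  \<open>zord n\<close>. A denominator is mapped outside \<open>zord 1\<close> and is removed by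
  \<open>zord_cancel\<close>.\<close>

lemma perturbed_symbolic_power_zord:
  fixes f :: "('m::{finite,linorder} uprod, 'k::idom) mpoly"
  assumes "f \<in> symbolic_power (subst_kernel (sec r)) s"
  shows "subst_poly (perturbed r) f \<in> zord s"
proof -
  let ?J = "subst_kernel (sec r) :: ('m uprod, 'k) mpoly set"
  let ?h = "subst_poly (perturbed r) :: ('m uprod, 'k) mpoly \<Rightarrow> _"
  have pow: "a \<in> ideal_power ?J n \<Longrightarrow> ?h a \<in> zord n" for a n
  proof (induction n arbitrary: a)
    case 0
    then show ?case by (simp add: zord_def)
  next
    case (Suc n)
    have "ideal.subspace {a. ?h a \<in> zord (Suc n)}"
      using subspace_zord[of "Suc n"] by (auto simp: ideal.subspace_def subst_poly_add subst_poly_mult)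
    then have "ideal_mult ?J (ideal_power ?J n) \<subseteq> {a. ?h a \<in> zord (Suc n)}"
      using zord_mult[OF perturbed_kernel_zord Suc.IH] by (intro ideal_mult_subset) (auto simp: subst_poly_mult)
    then show ?case using Suc.prems by auto
  qed
  obtain a u w where a: "a \<in> ideal_power ?J s" "u \<notin> ?J" "w \<notin> ?J" "w * (u * f - a) = 0"
    using assms by (auto simp: symbolic_power_prime[OF is_prime_subst_kernel])
  have nz: "?h u \<notin> zord 1" "?h w \<notin> zord 1" using a perturbed_zord_kernel by blast+
  then have "?h w \<noteq> 0" by (auto simp: zord_def)
  moreover have "?h w * (?h u * ?h f - ?h a) = 0"
    using arg_cong[OF a(4), of ?h] by (simp add: subst_poly_mult subst_poly_diff)
  ultimately have "?h u * ?h f = ?h a" by simp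
  then show ?thesis using pow[OF a(1)] nz(1) zord_cancel by metis
qed

section \<open>Minors in symbolic powers\<close>

text \<open>
  Block elimination for a matrix with top left block \<open>B\<close>, multiplied by powers of \<open>det B\<close> so that
  no inverse is needed.
\<close>

lemma det_schur_complement:
  fixes f :: "nat \<Rightarrow> nat \<Rightarrow> 'a::idom"
  defines "B r \<equiv> mat r r (\<lambda>(i, j). f i j)"
  shows "det (B r) ^ n * det (B (r + n)) = det (B r) *
    det (mat n n (\<lambda>(i, j). det (B r) * f (r + i) (r + j) -
      (\<Sum>k<r. \<Sum>l<r. f (r + i) k * adj_mat (B r) $$ (k, l) * f l (r + j))))"
proof -
  define d where "d = det (B r)"
  define C where "C = mat r n (\<lambda>(i, j). f i (r + j))"
  define D where "D = mat n r (\<lambda>(i, j). f (r + i) j)"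
  define E where "E = mat n n (\<lambda>(i, j). f (r + i) (r + j))"
  define AC where "AC = adj_mat (B r) * C"
  have B: "B r \<in> carrier_mat r r" by (simp add: B_def)
  note adj = adj_mat[OF B]
  have car: "C \<in> carrier_mat r n" "D \<in> carrier_mat n r" "E \<in> carrier_mat n n" "AC \<in> carrier_mat r n"
    using adj(1) by (auto simp: C_def D_def E_def AC_def)
  have block: "B (r + n) = four_block_mat (B r) C D E"
    by (rule eq_matI) (auto simp: B_def C_def D_def E_def)
  \<comment> \<open>Right multiplication by \<open>?N\<close> clears the upper right block without
    division, since \<open>B r * AC\<close> is \<open>d\<close> times \<open>C\<close>. The
    determinant of \<open>?N\<close> is the factor \<open>d ^ n\<close> of the claim.\<close>
  let ?N = "four_block_mat (1\<^sub>m r) (- AC) (0\<^sub>m n r) (d \<cdot>\<^sub>m 1\<^sub>m n)"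
  have BAC: "B r * AC = d \<cdot>\<^sub>m C"
  proof -
    have "B r * AC = (B r * adj_mat (B r)) * C"
      unfolding AC_def using B adj(1) car(1) by (simp add: assoc_mult_mat)
    then show ?thesis using car(1) by (simp add: adj(2) d_def mult_smult_assoc_mat[of _ r r _ n])
  qed
  have "four_block_mat (B r) C D E * ?N =
      four_block_mat (B r * 1\<^sub>m r + C * 0\<^sub>m n r) (B r * (- AC) + C * (d \<cdot>\<^sub>m 1\<^sub>m n))
        (D * 1\<^sub>m r + E * 0\<^sub>m n r) (D * (- AC) + E * (d \<cdot>\<^sub>m 1\<^sub>m n))"
    using B car by (intro mult_four_block_mat) auto
  also have "B r * 1\<^sub>m r + C * 0\<^sub>m n r = B r" using B car by auto
  also have "B r * (- AC) + C * (d \<cdot>\<^sub>m 1\<^sub>m n) = 0\<^sub>m r n"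
  proof -
    have "B r * (- AC) = - (d \<cdot>\<^sub>m C)" using B car BAC by simp
    moreover have "C * (d \<cdot>\<^sub>m 1\<^sub>m n) = d \<cdot>\<^sub>m C"
      using car by (simp add: mult_smult_distrib[OF _ one_carrier_mat])
    ultimately show ?thesis using car by (intro eq_matI) auto
  qed
  also have "D * 1\<^sub>m r + E * 0\<^sub>m n r = D" using car by auto
  also have "D * (- AC) + E * (d \<cdot>\<^sub>m 1\<^sub>m n) = mat n n (\<lambda>(i, j). d * f (r + i) (r + j) -
      (\<Sum>k<r. \<Sum>l<r. f (r + i) k * adj_mat (B r) $$ (k, l) * f l (r + j)))" (is "_ = ?S")
  proof (rule eq_matI)
    fix i j assume "i < dim_row ?S" "j < dim_col ?S"
    then have ij: "i < n" "j < n" by auto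
    have "(D * AC) $$ (i, j) = (\<Sum>k<r. f (r + i) k * AC $$ (k, j))"
      using ij car by (simp add: scalar_prod_def D_def atLeast0LessThan)
    also have "\<dots> = (\<Sum>k<r. \<Sum>l<r. f (r + i) k * adj_mat (B r) $$ (k, l) * f l (r + j))"
      using ij adj(1) car(1)
      by (simp add: AC_def scalar_prod_def C_def atLeast0LessThan sum_distrib_left mult.assoc)
    finally have DAC: "(D * AC) $$ (i, j) =
        (\<Sum>k<r. \<Sum>l<r. f (r + i) k * adj_mat (B r) $$ (k, l) * f l (r + j))" .
    have "D * (- AC) = - (D * AC)" "E * (d \<cdot>\<^sub>m 1\<^sub>m n) = d \<cdot>\<^sub>m E"
      using car by (auto simp: mult_smult_distrib[OF _ one_carrier_mat])
    then show "(D * (- AC) + E * (d \<cdot>\<^sub>m 1\<^sub>m n)) $$ (i, j) = ?S $$ (i, j)"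
      using ij car DAC by (simp add: E_def)
  qed (use car in auto)
  finally have prod: "four_block_mat (B r) C D E * ?N = four_block_mat (B r) (0\<^sub>m r n) D ?S" .
  have "det ?N = d ^ n"
    using car by (subst det_four_block_mat_lower_left_zero) (auto simp: det_smult)
  moreover have "det (four_block_mat (B r) (0\<^sub>m r n) D ?S) = d * det ?S"
    unfolding d_def using B car by (subst det_four_block_mat_upper_right_zero) auto
  moreover have "det (four_block_mat (B r) C D E * ?N) = det (four_block_mat (B r) C D E) * det ?N"
    using B car by (intro det_mult[of _ "r + n"]) auto
  ultimately show ?thesis
    unfolding prod block d_def[symmetric] by (simp add: mult.commute)
qed

lemma minor_subst:
  "subst_poly \<sigma> (minor generic_sym t \<rho> \<gamma>) = minor (\<lambda>i j. \<sigma> (Upair i j)) t \<rho> \<gamma>"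
proof -
  have "map_mat (subst_poly \<sigma>) (mat t t (\<lambda>(a, b). generic_sym (\<rho> a) (\<gamma> b))) =
      mat t t (\<lambda>(a, b). \<sigma> (Upair (\<rho> a) (\<gamma> b)))"
    by (rule eq_matI) (auto simp: generic_sym_def)
  then show ?thesis unfolding minor_def by (metis subst_poly.hom_det)
qed

text \<open>The factorisation \<open>A A^T\<close> has inner dimension \<open>r\<close>; padding
  with zeros to size \<open>t\<close> makes both factors square, so multiplicativity of
  \<open>det\<close> suffices. For \<open>t = r + 1\<close> the padding is a zero column, for
  \<open>t = r\<close> there is none.\<close>

lemma minor_sec_factor:
  assumes "r \<le> t"
  shows "minor (\<lambda>i j. sec r (Upair i j) :: ('m::linorder uprod \<times> nat, 'k::comm_ring_1) mpoly) t \<rho> \<gamma> =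
    det (mat t t (\<lambda>(a, k). if k < r then Var (avar k (\<rho> a)) else 0)) *
    det (mat t t (\<lambda>(k, b). if k < r then Var (avar k (\<gamma> b)) else 0))"
proof -
  have "mat t t (\<lambda>(a, b). sec r (Upair (\<rho> a) (\<gamma> b)) :: ('m uprod \<times> nat, 'k) mpoly) =
      mat t t (\<lambda>(a, k). if k < r then Var (avar k (\<rho> a)) else 0) *
      mat t t (\<lambda>(k, b). if k < r then Var (avar k (\<gamma> b)) else 0)"
  proof (rule eq_matI, goal_cases)
    case (1 a b)
    have "(\<Sum>k = 0..<t. (if k < r then Var (avar k (\<rho> a)) else 0) * (if k < r then Var (avar k (\<gamma> b)) else 0)) =
        (\<Sum>k<r. Var (avar k (\<rho> a)) * Var (avar k (\<gamma> b)) :: ('m uprod \<times> nat, 'k) mpoly)"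
      using assms by (intro sum.mono_neutral_cong_right) auto
    then show ?case using 1 by (simp add: scalar_prod_def sec_Upair)
  qed auto
  then show ?thesis unfolding minor_def by (simp add: det_mult[of _ t])
qed

lemma minor_Suc_in_kernel:
  "minor generic_sym (Suc r) \<rho> \<gamma> \<in> (subst_kernel (sec r) :: ('m::linorder uprod, 'k::comm_ring_1) mpoly set)"
proof -
  have "det (mat (Suc r) (Suc r) (\<lambda>(a, k). if k < r then Var (avar k (\<rho> a)) else 0)) =
      (0 :: ('m uprod \<times> nat, 'k) mpoly)"
    by (subst laplace_expansion_column[of _ "Suc r" r]) auto
  then show ?thesis
    by (simp add: subst_kernel_def minor_subst minor_sec_factor)
qed

lemma det_generic_ne_0:
  assumes "inj_on \<rho> {..<r}"
  shows "det (mat r r (\<lambda>(a, k). if k < r then Var (avar k (\<rho> a)) else 0)) \<noteq> (0 :: ('m uprod \<times> nat, 'k::comm_ring_1) mpoly)"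
    (is "det ?A \<noteq> 0")
proof
  \<comment> \<open>\<open>snd x - 1\<close> undoes the \<open>Suc\<close> of \<open>avar\<close>,
    so \<open>avar k i\<close> goes to 1 exactly if \<open>i = \<rho> k\<close>; by injectivity the
    matrix specialises to the identity.\<close>
  define \<theta> where "\<theta> x = (of_bool (fst x = Upair (\<rho> (snd x - 1)) (\<rho> (snd x - 1))) :: ('m uprod \<times> nat, 'k) mpoly)" for x
  assume "det ?A = 0"
  then have "det (map_mat (subst_poly \<theta>) ?A) = 0" by (simp add: subst_poly.hom_det)
  also have "map_mat (subst_poly \<theta>) ?A = 1\<^sub>m r"
    using assms by (intro eq_matI) (auto simp: \<theta>_def inj_on_def)
  finally show False by simp
qed

lemma minor_notin_kernel:
  assumes "inj_on \<rho> {..<r}" "inj_on \<gamma> {..<r}"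
  shows "minor generic_sym r \<rho> \<gamma> \<notin> (subst_kernel (sec r) :: ('m::linorder uprod, 'k::idom) mpoly set)"
proof -
  have "mat r r (\<lambda>(k, b). if k < r then Var (avar k (\<gamma> b)) else 0) =
      transpose_mat (mat r r (\<lambda>(a, k). if k < r then Var (avar k (\<gamma> a)) else (0 :: ('m uprod \<times> nat, 'k) mpoly)))"
    by (rule eq_matI) auto
  then show ?thesis
    using det_generic_ne_0[OF assms(1)] det_generic_ne_0[OF assms(2)]
    by (simp add: subst_kernel_def minor_subst minor_sec_factor det_transpose[of _ r])
qed

text \<open>With \<open>d\<close> the top left \<open>r\<close>-minor, which is outside the prime,
  \<open>d ^ n\<close> times the minor is \<open>d\<close> times the determinant of the Schur
  complement \<open>S\<close>. An entry of \<open>S\<close> times \<open>d\<close> equals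
  \<open>d\<close> times a bordered \<open>(r + 1)\<close>-minor, so it lies in the prime, and then
  so does the entry.\<close>

lemma minor_in_symbolic_power:
  fixes \<rho> \<gamma> :: "nat \<Rightarrow> 'm::{finite,linorder}"
  assumes inj: "inj_on \<rho> {..<r}" "inj_on \<gamma> {..<r}"
  shows "minor generic_sym (r + n) \<rho> \<gamma> \<in> symbolic_power (subst_kernel (sec r) :: ('m uprod, 'k::idom) mpoly set) n"
proof -
  let ?J = "subst_kernel (sec r) :: ('m uprod, 'k) mpoly set"
  have P: "is_prime_ideal ?J" by (rule is_prime_subst_kernel)
  define f where "f a b = (generic_sym (\<rho> a) (\<gamma> b) :: ('m uprod, 'k) mpoly)" for a b
  define d :: "('m uprod, 'k) mpoly" where "d = minor generic_sym r \<rho> \<gamma>"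
  have d: "d = det (mat r r (\<lambda>(i, j). f i j))" by (simp add: d_def minor_def f_def)
  have dJ: "d \<notin> ?J" unfolding d_def by (rule minor_notin_kernel[OF inj])
  define S where "S i j = d * f (r + i) (r + j) -
    (\<Sum>k<r. \<Sum>l<r. f (r + i) k * adj_mat (mat r r (\<lambda>(i, j). f i j)) $$ (k, l) * f l (r + j))" for i j
  have SJ: "S i j \<in> ?J" for i j
  proof -
    \<comment> \<open>Borders the top left block by row \<open>r + i\<close> and column
      \<open>r + j\<close>; the Schur complement of this matrix is the single entry
      \<open>S i j\<close>.\<close>
    define f' where "f' a b = f (if a < r then a else r + i) (if b < r then b else r + j)" for a b
    have mat: "mat r r (\<lambda>(i, j). f' i j) = mat r r (\<lambda>(i, j). f i j)"
      by (rule eq_matI) (auto simp: f'_def)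
    have "det (mat r r (\<lambda>(i, j). f' i j)) ^ 1 * det (mat (r + 1) (r + 1) (\<lambda>(i, j). f' i j)) =
        det (mat r r (\<lambda>(i, j). f' i j)) * det (mat 1 1 (\<lambda>(a, b). S i j))"
      unfolding det_schur_complement[of r f' 1] unfolding mat
      by (intro arg_cong2[where f = "(*)"] arg_cong[where f = det] eq_matI refl)
        (auto simp: S_def f'_def d)
    also have "det (mat 1 1 (\<lambda>(a, b). S i j)) = S i j" by (simp add: det_single)
    also have "mat (r + 1) (r + 1) (\<lambda>(i, j). f' i j) =
        mat (Suc r) (Suc r) (\<lambda>(a, b). generic_sym (\<rho> (if a < r then a else r + i)) (\<gamma> (if b < r then b else r + j)))"
      by (rule eq_matI) (auto simp: f'_def f_def)
    finally have "d * S i j = d * minor generic_sym (Suc r)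
        (\<lambda>a. \<rho> (if a < r then a else r + i)) (\<lambda>b. \<gamma> (if b < r then b else r + j))"
      by (auto simp: mat d minor_def)
    also have "\<dots> \<in> ?J"
      by (intro ideal.subspace_scale[OF subspace_subst_kernel] minor_Suc_in_kernel)
    finally show ?thesis using P dJ by (auto simp: is_prime_ideal_def)
  qed
  have minor: "minor generic_sym (r + n) \<rho> \<gamma> = det (mat (r + n) (r + n) (\<lambda>(i, j). f i j))"
    by (simp add: minor_def f_def)
  have "d ^ n * minor generic_sym (r + n) \<rho> \<gamma> = d * det (mat n n (\<lambda>(i, j). S i j))"
    using det_schur_complement[of r f n] unfolding d[symmetric] minor S_def .
  also have "\<dots> \<in> ideal_power ?J n"
    using SJ by (intro ideal.subspace_scale[OF subspace_ideal_power] det_in_ideal_power) auto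
  finally show ?thesis
  proof (rule symbolic_powerI[OF P, rotated])
    show "d ^ n \<notin> ?J"
      using dJ one_notin_prime[OF P] mult_notin_prime[OF P] by (induction n) auto
  qed
qed

section \<open>Diagonal term orders\<close>

text \<open>A permutation that moves the last index is improved by a transposition which makes it
  fix that index; the gain is \<open>(x n - x q) * (y n - y (p n))\<close>.\<close>

lemma rearrangement_strict:
  fixes x y :: "nat \<Rightarrow> int"
  assumes "strict_mono_on {..<n} x" "strict_mono_on {..<n} y" "p permutes {..<n}" "p \<noteq> id"
  shows "(\<Sum>i<n. x i * y (p i)) < (\<Sum>i<n. x i * y i)"
  using assms
proof (induction n arbitrary: p)
  case 0
  then show ?case by simp
next
  case (Suc n)
  have mono: "strict_mono_on {..<n} x" "strict_mono_on {..<n} y"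
    using Suc.prems(1,2) by (auto simp: strict_mono_on_def)
  have IH: "(\<Sum>i<n. x i * y (p i)) < (\<Sum>i<n. x i * y i)"
    if "p permutes {..<Suc n}" "p n = n" "p \<noteq> id" for p
    using Suc.IH[OF mono permutes_superset[OF that(1)] that(3)] that(2) by (auto simp: less_Suc_eq)
  show ?case
  proof (cases "p n = n")
    case True
    then show ?thesis using IH[OF Suc.prems(3) True Suc.prems(4)] by simp
  next
    case False
    define q where "q = inv_into UNIV p n"
    have pq: "p q = n" unfolding q_def by (rule permutes_inverses(1)[OF Suc.prems(3)])
    have qn: "q < n" and m: "p n < n"
      using permutes_in_image[OF permutes_inv[OF Suc.prems(3)], of n]
        permutes_in_image[OF Suc.prems(3), of n] pq False
      by (auto simp: q_def less_Suc_eq)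
    define p' where "p' = p \<circ> transpose q n"
    have p': "p' permutes {..<Suc n}" "p' n = n"
      unfolding p'_def using qn
      by (intro permutes_compose[OF permutes_swap_id Suc.prems(3)]) (simp_all add: pq)
    have "(x n - x q) * (y n - y (p n)) > 0"
      using Suc.prems(1,2) qn m by (intro mult_pos_pos) (auto simp: strict_mono_on_def)
    moreover have split: "(\<Sum>i<Suc n. g i) = (\<Sum>i\<in>{..<n} - {q}. g i) + g q + g n" for g :: "nat \<Rightarrow> int"
      using sum.remove[of "{..<n}" q g] qn by simp
    have "(\<Sum>i\<in>{..<n} - {q}. x i * y (p' i)) = (\<Sum>i\<in>{..<n} - {q}. x i * y (p i))"
      by (intro sum.cong) (auto simp: p'_def transpose_def)
    ultimately have "(\<Sum>i<Suc n. x i * y (p i)) < (\<Sum>i<Suc n. x i * y (p' i))"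
      unfolding split using pq by (simp add: p'_def algebra_simps)
    also have "\<dots> \<le> (\<Sum>i<Suc n. x i * y i)"
      using IH[OF p'] p'(2) by (cases "p' = id") auto
    finally show ?thesis .
  qed
qed

section \<open>Leibniz expansion and diagonal term of a generic symmetric minor\<close>

definition chain_monom :: "nat \<Rightarrow> (nat \<Rightarrow> 'm) \<Rightarrow> (nat \<Rightarrow> 'm) \<Rightarrow> 'm uprod monom" where
  "chain_monom t \<rho> \<gamma> = (\<Sum>a<t. single (Upair (\<rho> a) (\<gamma> a)) 1)"

lemma minor_generic_sym_expand:
  "(minor generic_sym t \<rho> \<gamma> :: ('m uprod, 'k::comm_ring_1) mpoly) = (\<Sum>p | p permutes {..<t}. single (chain_monom t \<rho> (\<gamma> \<circ> p)) (of_int (sign p)))"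
proof -
  have "(minor generic_sym t \<rho> \<gamma> :: ('m uprod, 'k) mpoly) =
      (\<Sum>p | p permutes {..<t}. of_int (sign p) * (\<Prod>i<t. mat t t (\<lambda>(a, b). generic_sym (\<rho> a) (\<gamma> b)) $$ (i, p i)))"
    unfolding minor_def by (subst det_def'[of _ t]) (auto simp: atLeast0LessThan)
  also have "\<dots> = (\<Sum>p | p permutes {..<t}. single (chain_monom t \<rho> (\<gamma> \<circ> p)) (of_int (sign p)))"
  proof (intro sum.cong refl)
    fix p assume "p \<in> {p. p permutes {..<t}}"
    then have "p i < t" if "i < t" for i using permutes_in_image[of p "{..<t}" i] that by auto
    then have "(\<Prod>i<t. mat t t (\<lambda>(a, b). generic_sym (\<rho> a) (\<gamma> b) :: ('m uprod, 'k) mpoly) $$ (i, p i)) =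
        (\<Prod>i<t. single (single (Upair (\<rho> i) (\<gamma> (p i))) 1) 1)"
      by (intro prod.cong) (auto simp: generic_sym_def Var_def)
    also have "\<dots> = single (chain_monom t \<rho> (\<gamma> \<circ> p)) 1"
      by (simp add: prod_single chain_monom_def)
    finally have prod: "(\<Prod>i<t. mat t t (\<lambda>(a, b). generic_sym (\<rho> a) (\<gamma> b) :: ('m uprod, 'k) mpoly) $$ (i, p i)) =
        single (chain_monom t \<rho> (\<gamma> \<circ> p)) 1" .
    show "of_int (sign p) * (\<Prod>i<t. mat t t (\<lambda>(a, b). generic_sym (\<rho> a) (\<gamma> b) :: ('m uprod, 'k) mpoly) $$ (i, p i)) =
        single (chain_monom t \<rho> (\<gamma> \<circ> p)) (of_int (sign p))"
      unfolding prod single_of_int[symmetric] mult_single by simp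
  qed
  finally show ?thesis .
qed

lemma keys_minor_generic_sym:
  assumes "s \<in> keys (minor generic_sym t \<rho> \<gamma> :: ('m uprod, 'k::comm_ring_1) mpoly)"
  obtains p where "p permutes {..<t}" "s = chain_monom t \<rho> (\<gamma> \<circ> p)"
proof -
  have "s \<in> (\<Union>p\<in>{p. p permutes {..<t}}. keys (single (chain_monom t \<rho> (\<gamma> \<circ> p)) (of_int (sign p) :: 'k)))"
    using assms unfolding minor_generic_sym_expand by (rule subsetD[OF keys_sum])
  then show ?thesis using that by (auto split: if_splits)
qed

text \<open>\<open>i\<close> itself is counted, so ranks are positive and every exponent is bounded
  by the weight; this makes the lower sets of \<open>rank_order\<close> finite.\<close>

definition rank :: "'m::{finite,linorder} \<Rightarrow> nat" where
  "rank i = card {j. j \<le> i}"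

lemma rank_pos: "0 < rank i"
  by (auto simp: rank_def card_gt_0_iff)

lemma rank_strict_mono: "i < j \<Longrightarrow> rank i < rank j"
proof -
  assume "i < j"
  then have "j \<notin> {k. k \<le> i}" "{k. k \<le> i} \<subseteq> {k. k \<le> j}" by auto
  then show ?thesis unfolding rank_def by (intro psubset_card_mono) auto
qed

text \<open>
  With weight \<open>rank i * rank j\<close> for \<open>x\<^sub>i\<^sub>j\<close>, the diagonal monomial of a minor is by the
  rearrangement inequality the unique one of maximal weight.
\<close>

definition rank_weight :: "'m::{finite,linorder} uprod monom \<Rightarrow> int" where
  "rank_weight t = (\<Sum>e\<in>UNIV. int (lookup t e) * int (rank (lo e) * rank (hi e)))"

lemma rank_weight_add: "rank_weight (s + t) = rank_weight s + rank_weight t"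
  by (simp add: rank_weight_def lookup_add distrib_right sum.distrib)

lemma rank_weight_0 [simp]: "rank_weight 0 = 0"
  by (simp add: rank_weight_def)

lemma rank_weight_sum: "rank_weight (sum f A) = (\<Sum>x\<in>A. rank_weight (f x))"
  by (induction A rule: infinite_finite_induct) (auto simp: rank_weight_add)

lemma rank_weight_single: "rank_weight (single (Upair i j) (Suc 0)) = int (rank i) * int (rank j)"
proof -
  have "rank_weight (single (Upair i j) (Suc 0)) =
      (\<Sum>e\<in>UNIV. if e = Upair i j then int (rank (lo e) * rank (hi e)) else 0)"
    unfolding rank_weight_def by (intro sum.cong) (auto simp: lookup_single when_def)
  then show ?thesis by (cases "i \<le> j") (auto simp: min_def max_def)
qed

lemma rank_weight_chain_monom: "rank_weight (chain_monom t \<rho> \<gamma>) = (\<Sum>a<t. int (rank (\<rho> a)) * int (rank (\<gamma> a)))"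
  by (simp add: chain_monom_def rank_weight_sum rank_weight_single)

text \<open>By symmetry of the matrix, different permutations may yield the same monomial. The
  strict rearrangement inequality shows that the identity alone yields the diagonal one, so its
  coefficient is 1 in every characteristic.\<close>

lemma
  fixes \<rho> \<gamma> :: "nat \<Rightarrow> 'm::{finite,linorder}"
  assumes "strict_mono_on {..<t} \<rho>" "strict_mono_on {..<t} \<gamma>"
  shows lookup_minor_diagonal:
      "lookup (minor generic_sym t \<rho> \<gamma> :: ('m uprod, 'k::comm_ring_1) mpoly) (chain_monom t \<rho> \<gamma>) = 1"
    and rank_weight_keys_minor:
      "s \<in> keys (minor generic_sym t \<rho> \<gamma> :: ('m uprod, 'k) mpoly) \<Longrightarrow>
        s = chain_monom t \<rho> \<gamma> \<or> rank_weight s < rank_weight (chain_monom t \<rho> \<gamma>)"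
proof -
  have less: "rank_weight (chain_monom t \<rho> (\<gamma> \<circ> p)) < rank_weight (chain_monom t \<rho> \<gamma>)"
    if "p permutes {..<t}" "p \<noteq> id" for p
  proof -
    have "strict_mono_on {..<t} (\<lambda>i. int (rank (\<rho> i)))" "strict_mono_on {..<t} (\<lambda>i. int (rank (\<gamma> i)))"
      using assms by (auto simp: strict_mono_on_def rank_strict_mono)
    then show ?thesis
      unfolding rank_weight_chain_monom o_def using that by (rule rearrangement_strict)
  qed
  have "lookup (minor generic_sym t \<rho> \<gamma> :: ('m uprod, 'k) mpoly) (chain_monom t \<rho> \<gamma>) =
      (\<Sum>p | p permutes {..<t}. if p = id then 1 else 0)"
    unfolding minor_generic_sym_expand lookup_sum lookup_single
  proof (intro sum.cong refl)
    fix p assume "p \<in> {p. p permutes {..<t}}"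
    then show "((of_int (sign p) :: 'k) when chain_monom t \<rho> (\<gamma> \<circ> p) = chain_monom t \<rho> \<gamma>) = (if p = id then 1 else 0)"
      using less[of p] by (auto simp: when_def sign_id)
  qed
  then show "lookup (minor generic_sym t \<rho> \<gamma> :: ('m uprod, 'k) mpoly) (chain_monom t \<rho> \<gamma>) = 1"
    by (simp add: finite_permutations permutes_id)
  assume "s \<in> keys (minor generic_sym t \<rho> \<gamma> :: ('m uprod, 'k) mpoly)"
  then obtain p where "p permutes {..<t}" "s = chain_monom t \<rho> (\<gamma> \<circ> p)"
    by (rule keys_minor_generic_sym)
  then show "s = chain_monom t \<rho> \<gamma> \<or> rank_weight s < rank_weight (chain_monom t \<rho> \<gamma>)"
    using less[of p] by (cases "p = id") auto
qed

lemma minor_generic_sym_ne_0: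
  fixes \<rho> \<gamma> :: "nat \<Rightarrow> 'm::{finite,linorder}"
  assumes "strict_mono_on {..<t} \<rho>" "strict_mono_on {..<t} \<gamma>"
  shows "minor generic_sym t \<rho> \<gamma> \<noteq> (0 :: ('m uprod, 'k::comm_ring_1) mpoly)"
  using lookup_minor_diagonal[OF assms, where 'k = 'k] by auto

lemma sum_lookup_chain_monom: "(\<Sum>e\<in>UNIV. lookup (chain_monom t \<rho> \<gamma>) e) = t"
  for \<rho> :: "nat \<Rightarrow> 'm::finite"
  unfolding chain_monom_def lookup_sum
  by (subst sum.swap) (simp add: lookup_single when_def)

lemma total_degree_minor:
  fixes \<rho> \<gamma> :: "nat \<Rightarrow> 'm::{finite,linorder}"
  assumes "strict_mono_on {..<t} \<rho>" "strict_mono_on {..<t} \<gamma>"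
  shows "total_degree (minor generic_sym t \<rho> \<gamma> :: ('m uprod, 'k::comm_ring_1) mpoly) = t"
proof -
  let ?M = "minor generic_sym t \<rho> \<gamma> :: ('m uprod, 'k) mpoly"
  have "(\<Sum>v\<in>keys s. lookup s v) = t" if s: "s \<in> keys ?M" for s
  proof -
    obtain p where "s = chain_monom t \<rho> (\<gamma> \<circ> p)"
      using keys_minor_generic_sym[OF s] by blast
    then have "(\<Sum>v\<in>UNIV. lookup s v) = t" by (simp add: sum_lookup_chain_monom)
    moreover have "(\<Sum>v\<in>keys s. lookup s v) = (\<Sum>v\<in>UNIV. lookup s v)"
      by (intro sum.mono_neutral_left) (auto simp: in_keys_iff)
    ultimately show ?thesis by simp
  qed
  moreover have "chain_monom t \<rho> \<gamma> \<in> keys ?M" by (simp add: in_keys_iff lookup_minor_diagonal[OF assms])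
  ultimately have "(\<lambda>s. \<Sum>v\<in>keys s. lookup s v) ` keys ?M = {t}" by force
  then show ?thesis by (simp add: total_degree_def)
qed

text \<open>One concrete diagonal order with finite lower sets, on which the division in
  \<open>symbolic_power_eq_span\<close> runs.\<close>

definition rank_order :: "'m::{finite,linorder} uprod monom \<Rightarrow> 'm uprod monom \<Rightarrow> bool" where
  "rank_order = weight_leq rank_weight"

lemma rank_order_monomial_order: "monomial_order (rank_order :: 'm::{finite,linorder} uprod monom \<Rightarrow> _)"
  unfolding rank_order_def by (rule weight_leq_monomial_order) (rule rank_weight_add)

lemma lookup_le_rank_weight: "int (lookup t e) \<le> rank_weight t"
proof -
  have "int (lookup t e) * 1 \<le> int (lookup t e) * int (rank (lo e) * rank (hi e))"
    using rank_pos[of "lo e"] rank_pos[of "hi e"] by (intro mult_left_mono) (auto simp: Suc_le_eq simp flip: of_nat_mult)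
  also have "\<dots> \<le> rank_weight t"
    unfolding rank_weight_def by (intro member_le_sum[of e]) auto
  finally show ?thesis by simp
qed

lemma finite_rank_order:
  fixes t :: "'m::{finite,linorder} uprod monom"
  shows "finite {s. rank_order s t}"
proof -
  define N where "N = nat (rank_weight t)"
  have "{s. rank_order s t} \<subseteq> lookup -` (UNIV \<rightarrow>\<^sub>E {..N})"
  proof
    fix s assume "s \<in> {s. rank_order s t}"
    then have "rank_weight s \<le> rank_weight t" by (auto simp: rank_order_def weight_leq_def)
    then have "lookup s e \<le> N" for e
      using lookup_le_rank_weight[of s e] by (simp add: N_def)
    then show "s \<in> lookup -` (UNIV \<rightarrow>\<^sub>E {..N})" by (simp add: PiE_UNIV_domain)
  qed
  moreover have "finite (lookup -` (UNIV \<rightarrow>\<^sub>E {..N}) :: 'm uprod monom set)"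
    by (intro finite_vimageI finite_PiE injI poly_mapping_eqI) simp_all
  ultimately show ?thesis by (rule finite_subset)
qed

lemma diagonal_rank_order:
  "diagonal_term_order TYPE('k::field) (rank_order :: 'm::{finite,linorder} uprod monom \<Rightarrow> _)"
proof -
  interpret monomial_order "rank_order :: 'm uprod monom \<Rightarrow> _" by (rule rank_order_monomial_order)
  have "rank_order 0 t" for t :: "'m uprod monom"
  proof -
    have "0 \<le> rank_weight t" by (auto simp: rank_weight_def intro!: sum_nonneg)
    moreover have "t = 0" if "rank_weight t = 0"
      using lookup_le_rank_weight[of t] that by (intro poly_mapping_eqI) auto
    ultimately show ?thesis by (force simp: rank_order_def weight_leq_def)
  qed
  then have "term_order (rank_order :: 'm uprod monom \<Rightarrow> _)"
    unfolding term_order_def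
    using leq_refl leq_trans leq_antisym leq_total leq_add
    by (auto simp: reflp_def transp_def antisymp_def totalp_on_def)
  moreover have "lead_monom rank_order (minor generic_sym t \<rho> \<gamma> :: ('m uprod, 'k) mpoly) = chain_monom t \<rho> \<gamma>"
    if "strict_mono_on {..<t} \<rho>" "strict_mono_on {..<t} \<gamma>" for t \<rho> \<gamma>
  proof (rule lead_monomI)
    show "chain_monom t \<rho> \<gamma> \<in> keys (minor generic_sym t \<rho> \<gamma> :: ('m uprod, 'k) mpoly)"
      by (simp add: in_keys_iff lookup_minor_diagonal[OF that])
    show "rank_order s (chain_monom t \<rho> \<gamma>)" if "s \<in> keys (minor generic_sym t \<rho> \<gamma> :: ('m uprod, 'k) mpoly)" for s
      using rank_weight_keys_minor[OF \<open>strict_mono_on {..<t} \<rho>\<close> \<open>strict_mono_on {..<t} \<gamma>\<close> that] leq_refl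
      by (auto simp: rank_order_def weight_leq_def)
  qed
  ultimately show ?thesis by (auto simp: diagonal_term_order_def chain_monom_def)
qed

section \<open>Leading monomials in the symbolic powers\<close>

text \<open>A diagonal order selects the increasing pair among the two terms of a 2-minor, which is
  \<open>R_swap\<close>. Thus \<open>nested_least\<close> holds for every diagonal order.\<close>

lemma diagonal_swap_relation:
  assumes "diagonal_term_order TYPE('k::field) (leq :: 'm::{finite,linorder} uprod monom \<Rightarrow> _)"
  shows "swap_relation leq"
proof -
  interpret monomial_order leq
    using assms by (auto simp: diagonal_term_order_def intro: term_order_monomial_order)
  show ?thesis
  proof
    fix e f :: "'m uprod" assume ef: "uprec e f"
    define A where "A = single e 1 + single f (1 :: nat)"
    define B where "B = single (Upair (lo e) (hi f)) 1 + single (Upair (lo f) (hi e)) (1 :: nat)"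
    let ?M = "single A 1 - single B 1 :: ('m uprod, 'k) mpoly"
    have lead: "lead_monom leq ?M = A"
    proof -
      have "lead_monom leq ?M =
          (\<Sum>a<2::nat. single (Upair (if a = 0 then lo e else lo f) (if a = 0 then hi e else hi f)) 1)"
        unfolding A_def B_def minor_2_swap(3)[OF ef, symmetric]
        using assms minor_2_swap(1,2)[OF ef] by (simp add: diagonal_term_order_def)
      then show ?thesis by (simp add: A_def numeral_2_eq_2)
    qed
    show "leq B A"
    proof (cases "A = B")
      case False
      then have B: "B \<in> keys ?M" by (auto simp: in_keys_iff lookup_minus lookup_single)
      then have "?M \<noteq> 0" by auto
      then show ?thesis using lead_monom_greatest[OF _ B] lead by simp
    qed (simp add: leq_refl)
  qed (auto intro: leq_refl leq_trans leq_add)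
qed

section \<open>Distributing the factors of a monomial over the summands of
  \<open>perturbed\<close>\<close>

definition part_mon :: "nat \<Rightarrow> nat \<Rightarrow> 'm::linorder uprod \<Rightarrow> ('m uprod \<times> nat) monom" where
  "part_mon r k e = (if k < r then ver_mon k e else single (zvar e) 1)"

lemma perturbed_part_mon: "perturbed r e = (\<Sum>k\<le>r. single (part_mon r k e) 1)"
  by (simp add: perturbed_def sec_def ver_def part_mon_def Var_def lessThan_Suc_atMost[symmetric])

lemma part_mon_less: "k < r \<Longrightarrow> part_mon r k = ver_mon k"
  and part_mon_not_less: "\<not> k < r \<Longrightarrow> part_mon r k = (\<lambda>e. single (zvar e) 1)"
  by (simp_all add: part_mon_def fun_eq_iff)

lemma lookup_part_avar:
  "k' < r \<Longrightarrow> lookup (lin_exp (part_mon r k) t) (avar k' i) = (if k = k' then vdeg t i else 0)"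
proof (cases "k < r")
  case False
  then show "k' < r \<Longrightarrow> ?thesis" by (auto simp: part_mon_not_less lookup_lin_exp lookup_single)
qed (simp add: part_mon_less lookup_lin_ver)

lemma lookup_part_zvar:
  assumes "k \<le> r"
  shows "lookup (lin_exp (part_mon r k) t) (zvar e) = (if k = r then lookup t e else 0)"
proof (cases "k < r")
  case False
  have "(\<Sum>v\<in>UNIV. lookup t v * lookup (single (zvar v) 1) (zvar e)) = (\<Sum>v\<in>UNIV. if v = e then lookup t v else 0)"
    by (intro sum.cong) (auto simp: lookup_single)
  then show ?thesis using assms False by (simp add: part_mon_not_less lookup_lin_exp)
qed (simp add: part_mon_less lookup_lin_exp ver_mon_def lookup_add lookup_single)

lemma part_mon_inj:
  fixes e :: "'m::{finite,linorder} uprod"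
  assumes "k \<le> r" "j \<le> r" "part_mon r k e = part_mon r j e"
  shows "k = j"
proof (rule ccontr)
  assume "k \<noteq> j"
  have "lookup (part_mon r l e) (avar l' (lo e)) \<noteq> 0 \<longleftrightarrow> l = l'" if "l' < r" for l l'
    using lookup_part_avar[OF that, of l "single e (Suc 0)" "lo e"] by (simp add: vdeg_single')
  then have "\<not> k < r" "\<not> j < r" using assms(3) \<open>k \<noteq> j\<close> by metis+
  then show False using assms(1,2) \<open>k \<noteq> j\<close> by simp
qed

lemma monom_induct [case_names 0 add]:
  fixes t :: "'v::finite monom"
  assumes "P 0" "\<And>t e. P t \<Longrightarrow> P (t + single e 1)"
  shows "P t"
proof (induction "\<Sum>e\<in>UNIV. lookup t e" arbitrary: t)
  case 0
  then have "t = 0" by (intro poly_mapping_eqI) simp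
  then show ?case using assms(1) by simp
next
  case (Suc n)
  have "\<exists>e. lookup t e \<noteq> 0"
  proof (rule ccontr)
    assume "\<not> ?thesis"
    then show False using Suc.hyps(2) by simp
  qed
  then obtain e where e: "e \<in> keys t" by (auto simp: in_keys_iff)
  from monom_split_single[OF e] obtain w where w: "t = single e (Suc 0) + w" ..
  have "n = (\<Sum>e\<in>UNIV. lookup w e)"
    using Suc.hyps(2) by (simp add: w lookup_add sum.distrib lookup_single when_def)
  then show ?case using assms(2)[OF Suc.hyps(1)[of w], of e] by (simp add: w add.commute)
qed

text \<open>When the product is expanded, each factor of \<open>t\<close> picks one of the
  \<open>r + 1\<close> summands; \<open>d k\<close> collects the factors that picked the
  \<open>k\<close>-th, with \<open>k = r\<close> for the perturbation.\<close>

lemma keys_subst_perturbed: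
  fixes t :: "'m::{finite,linorder} uprod monom"
  assumes "\<kappa> \<in> keys (subst_monom (perturbed r) t :: (_, 'k::comm_ring_1) mpoly)"
  shows "\<exists>d. (\<Sum>k\<le>r. d k) = t \<and> (\<Sum>k\<le>r. lin_exp (part_mon r k) (d k)) = \<kappa>"
  using assms
proof (induction t arbitrary: \<kappa> rule: monom_induct)
  case 0
  then show ?case by (intro exI[of _ "\<lambda>_. 0"]) simp
next
  case (add t e)
  obtain s u where su: "s \<in> keys (subst_monom (perturbed r) t :: (_, 'k) mpoly)"
    "u \<in> keys (perturbed r e :: (_, 'k) mpoly)" "\<kappa> = s + u"
    using add.prems by (auto simp: subst_monom_add elim!: keys_mult_E)
  obtain d where d: "(\<Sum>k\<le>r. d k) = t" "(\<Sum>k\<le>r. lin_exp (part_mon r k) (d k)) = s"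
    using add.IH[OF su(1)] by auto
  obtain j where j: "j \<le> r" "u = part_mon r j e"
    using su(2) keys_sum[of "\<lambda>k. single (part_mon r k e) (1 :: 'k)" "{..r}"]
    by (auto simp: perturbed_part_mon)
  show ?case
    using j d by (intro exI[of _ "\<lambda>k. d k + (if k = j then single e (Suc 0) else 0)"])
      (simp add: sum.distrib lin_exp_add su(3) if_distrib[of "lin_exp _"] cong: if_cong)
qed

definition restr :: "'v set \<Rightarrow> 'v::finite monom \<Rightarrow> 'v monom" where
  "restr S t = (\<Sum>e\<in>S. single e (lookup t e))"

lemma lookup_restr: "lookup (restr S t) e = (if e \<in> S then lookup t e else 0)"
  by (simp add: restr_def lookup_sum lookup_single when_def)

text \<open>Labels as produced by \<open>greene_kleitman\<close>: a class below \<open>r\<close> is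
  an antichain and goes to a column of \<open>A\<close>, the class \<open>r\<close> goes to the
  perturbation.\<close>

locale labelled_monom = monomial_order leq + swap_relation leq
  for leq :: "'m::{finite,linorder} uprod monom \<Rightarrow> 'm uprod monom \<Rightarrow> bool" +
  fixes r :: nat and lab :: "'m uprod \<Rightarrow> nat"
  assumes lab_le: "lab e \<le> r"
    and lab_nested: "lab e = lab f \<Longrightarrow> lab e < r \<Longrightarrow> \<not> uprec e f"
begin

definition part :: "nat \<Rightarrow> 'm uprod monom \<Rightarrow> 'm uprod monom" where
  "part k t = restr {e. lab e = k} t"

definition image_monom :: "'m uprod monom \<Rightarrow> ('m uprod \<times> nat) monom" where
  "image_monom t = (\<Sum>k\<le>r. lin_exp (part_mon r k) (part k t))"

lemma lookup_part: "lookup (part k t) e = (if lab e = k then lookup t e else 0)"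
  by (simp add: part_def lookup_restr)

lemma sum_part: "(\<Sum>k\<le>r. part k t) = t"
  using lab_le by (intro poly_mapping_eqI) (simp add: lookup_sum lookup_part)

lemma image_monom_add: "image_monom (s + t) = image_monom s + image_monom t"
proof -
  have "part k (s + t) = part k s + part k t" for k
    by (rule poly_mapping_eqI) (simp add: lookup_part lookup_add)
  then show ?thesis by (simp add: image_monom_def lin_exp_add sum.distrib)
qed

lemma image_monom_single: "image_monom (single e (Suc 0)) = part_mon r (lab e) e"
proof -
  have "part k (single e (Suc 0)) = (if k = lab e then single e (Suc 0) else 0)" for k
    by (rule poly_mapping_eqI) (auto simp: lookup_part lookup_single when_def)
  then show ?thesis
    using lab_le by (simp add: image_monom_def if_distrib[of "lin_exp _"] cong: if_cong)
qed

text \<open>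
  The parts with label \<open>< r\<close> are the least monomials of their vertex degrees, so every other
  decomposition with the same image is one of a larger monomial.
\<close>

lemma part_unique:
  assumes "leq (\<Sum>k\<le>r. d k) t" "(\<Sum>k\<le>r. lin_exp (part_mon r k) (d k)) = image_monom t" "k \<le> r"
  shows "d k = part k t"
proof -
  have le: "leq (part k t) (d k)" if "k \<in> {..r}" for k
  proof (cases "k < r")
    case True
    \<comment> \<open>The image shows a part \<open>k < r\<close> through its vertex degrees only,
      hence the appeal to \<open>nested_least\<close>; the part \<open>r\<close> is visible
      completely, each \<open>zvar e\<close> being a separate variable.\<close>
    have "vdeg (part k t) i = vdeg (d k) i" for i
    proof -
      have "(\<Sum>j\<le>r. lookup (lin_exp (part_mon r j) (d j)) (avar k i)) =
          (\<Sum>j\<le>r. lookup (lin_exp (part_mon r j) (part j t)) (avar k i))"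
        using arg_cong[OF assms(2), of "\<lambda>p. lookup p (avar k i)"]
        by (simp add: image_monom_def lookup_sum)
      then show ?thesis using True by (simp add: lookup_part_avar[OF True])
    qed
    moreover have "\<not> uprec e f" if "e \<in> keys (part k t)" "f \<in> keys (part k t)" for e f
      using that True lab_nested by (auto simp: in_keys_iff lookup_part split: if_splits)
    ultimately show ?thesis by (intro nested_least) auto
  next
    case False
    then have "k = r" using that by simp
    have "lookup (part r t) e = lookup (d r) e" for e
    proof -
      have "(\<Sum>j\<le>r. lookup (lin_exp (part_mon r j) (d j)) (zvar e)) =
          (\<Sum>j\<le>r. lookup (lin_exp (part_mon r j) (part j t)) (zvar e))"
        using arg_cong[OF assms(2), of "\<lambda>p. lookup p (zvar e)"]
        by (simp add: image_monom_def lookup_sum)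
      then show ?thesis by (simp add: lookup_part_zvar)
    qed
    then show ?thesis unfolding \<open>k = r\<close> by (metis leq_refl poly_mapping_eqI)
  qed
  then show ?thesis
    using leq_sum_mono_eqD[of "{..r}" "\<lambda>k. part k t" d k] assms(1,3) sum_part[of t] by simp
qed

text \<open>By \<open>part_unique\<close> a further factor \<open>e\<close> can go only to the
  summand \<open>lab e\<close>, as do all other copies of \<open>e\<close>. So the coefficient is a
  product of ones.\<close>

lemma lookup_subst_image_monom: "lookup (subst_monom (perturbed r) t) (image_monom t) = (1 :: 'k::comm_ring_1)"
proof (induction t rule: monom_induct)
  case 0
  have "image_monom 0 = 0" using image_monom_add[of 0 0] by simp
  then show ?case by simp
next
  case (add t e)
  have "s = image_monom t \<and> u = part_mon r (lab e) e"
    if s: "s \<in> keys (subst_monom (perturbed r) t :: (_, 'k) mpoly)" and u: "u \<in> keys (perturbed r e :: (_, 'k) mpoly)"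
      and su: "s + u = image_monom t + part_mon r (lab e) e" for s u
  proof -
    obtain d where d: "(\<Sum>k\<le>r. d k) = t" "(\<Sum>k\<le>r. lin_exp (part_mon r k) (d k)) = s"
      using keys_subst_perturbed[OF s] by auto
    obtain j where j: "j \<le> r" "u = part_mon r j e"
      using u keys_sum[of "\<lambda>k. single (part_mon r k e) (1 :: 'k)" "{..r}"]
      by (auto simp: perturbed_part_mon)
    define d' where "d' k = d k + (if k = j then single e (Suc 0) else 0)" for k
    have "(\<Sum>k\<le>r. d' k) = t + single e (Suc 0)"
      "(\<Sum>k\<le>r. lin_exp (part_mon r k) (d' k)) = image_monom (t + single e (Suc 0))"
      using j d su unfolding image_monom_add image_monom_single
      by (simp_all add: d'_def sum.distrib lin_exp_add if_distrib[of "lin_exp _"] cong: if_cong)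
    then have "d' j = part j (t + single e (Suc 0))" using leq_refl j(1) by (intro part_unique) auto
    then have "lookup (part j (t + single e (Suc 0))) e \<noteq> 0"
      unfolding d'_def by (metis (full_types) add_is_0 lookup_add lookup_single_eq nat.distinct(1))
    then have "lab e = j" by (auto simp: lookup_part split: if_splits)
    then show ?thesis using j su by simp
  qed
  moreover have "lookup (perturbed r e) (part_mon r (lab e) e) = (1 :: 'k)"
  proof -
    have "lookup (perturbed r e) (part_mon r (lab e) e) = (\<Sum>k\<le>r. if k = lab e then 1 else (0 :: 'k))"
      unfolding perturbed_part_mon lookup_sum lookup_single
    proof (intro sum.cong refl)
      fix k assume "k \<in> {..r}"
      then show "((1 :: 'k) when part_mon r k e = part_mon r (lab e) e) = (if k = lab e then 1 else 0)"
        using part_mon_inj[OF _ lab_le, of k e e] by (auto simp: when_def)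
    qed
    then show ?thesis using lab_le by simp
  qed
  ultimately show ?case
    using add.IH lookup_mult_unique[of "subst_monom (perturbed r) t :: (_, 'k) mpoly" "perturbed r e"
        "image_monom t" "part_mon r (lab e) e"]
    by (simp add: subst_monom_add image_monom_add image_monom_single)
qed

text \<open>\<open>part_unique\<close> covers every monomial at most \<open>u\<close>, hence all
  terms of \<open>f\<close>; a term other than \<open>u\<close> therefore cannot reach
  \<open>image_monom u\<close>.\<close>

lemma lookup_perturbed_lead_monom:
  fixes f :: "('m uprod, 'k::comm_ring_1) mpoly"
  assumes "f \<noteq> 0"
  defines "u \<equiv> lead_monom leq f"
  shows "lookup (subst_poly (perturbed r) f) (image_monom u) = lookup f u"
proof -
  have "lookup (subst_monom (perturbed r) t :: (_, 'k) mpoly) (image_monom u) = 0" if t: "t \<in> keys f" "t \<noteq> u" for t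
  proof (rule ccontr)
    assume "\<not> ?thesis"
    then obtain d where d: "(\<Sum>k\<le>r. d k) = t" "(\<Sum>k\<le>r. lin_exp (part_mon r k) (d k)) = image_monom u"
      using keys_subst_perturbed[of "image_monom u" r t, where 'k = 'k] by (auto simp: in_keys_iff)
    have "leq t u" unfolding u_def using lead_monom_greatest[OF assms(1) t(1)] .
    then have "d k = part k u" if "k \<le> r" for k using part_unique d that by blast
    then have "t = u" using d(1) sum_part[of u] by simp
    then show False using t(2) by simp
  qed
  then have "lookup (subst_poly (perturbed r) f) (image_monom u) =
      (\<Sum>t\<in>keys f. if t = u then lookup f u else 0)"
    unfolding subst_poly_superset[OF finite_keys subset_refl] lookup_sum lookup_Const_mult
    by (intro sum.cong) (auto simp: lookup_subst_image_monom)
  then show ?thesis by (auto simp: in_keys_iff)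
qed

lemma zdeg_image_monom: "zdeg (image_monom t) = (\<Sum>e | lab e = r. lookup t e)"
  by (simp add: zdeg_def image_monom_def lookup_sum lookup_part_zvar lookup_part sum.If_cases)

end

lemma lead_monom_symbolic_power:
  fixes f :: "('m::{finite,linorder} uprod, 'k::field) mpoly"
  assumes diag: "diagonal_term_order TYPE('k) leq" and "f \<noteq> 0"
    and f: "f \<in> symbolic_power (subst_kernel (sec r)) s"
  shows "\<exists>css. (\<forall>c\<in>set css. sorted_wrt uprec c \<and> r < length c) \<and>
    (\<Sum>c\<leftarrow>css. length c - r) = s \<and> (\<forall>e. count_list (concat css) e \<le> lookup (lead_monom leq f) e)"
proof (rule ccontr)
  assume no: "\<not> ?thesis"
  have trans: "uprec x z" if "uprec x y" "uprec y z" for x y z :: "'m uprod"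
    using that by (auto simp: uprec_def)
  have irrefl: "\<not> uprec x x" for x :: "'m uprod" by (simp add: uprec_def)
  have no': "(\<Sum>c\<leftarrow>css. length c - r) \<noteq> s"
    if "\<forall>c\<in>set css. sorted_wrt uprec c \<and> r < length c"
      "\<And>e. count_list (concat css) e \<le> lookup (lead_monom leq f) e" for css
    using no that by blast
  obtain lab where lab: "\<And>e. lab e \<le> r" "\<And>e f. lab e = lab f \<Longrightarrow> lab e < r \<Longrightarrow> \<not> uprec e f"
    "(\<Sum>e | lab e = r. lookup (lead_monom leq f) e) < s"
  proof (rule greene_kleitman[of uprec r "lookup (lead_monom leq f)" s], goal_cases)
    case 1
    from 1(2,3) show ?case by (rule trans)
  next
    case 2
    show ?case by (rule irrefl)
  next
    case 3
    from 3(2,3) show ?case by (rule no')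
  next
    case 4
    from 4(2-4) show ?case by (rule 4(1))
  qed
  interpret monomial_order leq
    using diag by (auto simp: diagonal_term_order_def intro: term_order_monomial_order)
  interpret swap_relation leq by (rule diagonal_swap_relation[OF diag])
  interpret labelled_monom leq r lab by unfold_locales (use lab in auto)
  have "image_monom (lead_monom leq f) \<in> keys (subst_poly (perturbed r) f)"
    using lookup_perturbed_lead_monom[OF assms(2)] lead_monom_in_keys[OF assms(2)] by (simp add: in_keys_iff)
  then have "s \<le> zdeg (image_monom (lead_monom leq f))"
    using perturbed_symbolic_power_zord[OF f] by (simp add: zord_def)
  then show False using lab(3) by (simp add: zdeg_image_monom)
qed

section \<open>Products of minors\<close>

definition minor_products :: "nat \<Rightarrow> nat \<Rightarrow> ('m::{finite,linorder} uprod, 'k::field) mpoly set" where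
  "minor_products r s = {\<Prod>i<l. f i | (l::nat) f.
    l \<ge> 1 \<and> (\<forall>i<l. f i \<in> minors_ge (r + 1) (generic_sym :: 'm \<Rightarrow> 'm \<Rightarrow> ('m uprod, 'k) mpoly)) \<and>
    (\<Sum>i<l. int (total_degree (f i)) - int r) = int s}"

lemma minors_in_symbolic_power:
  assumes "g \<in> minors generic_sym (r + n)"
  shows "g \<in> symbolic_power (subst_kernel (sec r) :: ('m::{finite,linorder} uprod, 'k::field) mpoly set) n"
proof -
  obtain \<rho> \<gamma> where g: "g = minor generic_sym (r + n) \<rho> \<gamma>"
    "strict_mono_on {..<r + n} \<rho>" "strict_mono_on {..<r + n} \<gamma>"
    using assms by (auto simp: minors_def)
  have "inj_on \<rho> {..<r}" "inj_on \<gamma> {..<r}"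
    by (rule inj_on_subset[OF strict_mono_on_imp_inj_on[OF g(2)]], simp)
      (rule inj_on_subset[OF strict_mono_on_imp_inj_on[OF g(3)]], simp)
  then show ?thesis unfolding g(1) by (rule minor_in_symbolic_power)
qed

lemma minors_ge_Suc:
  fixes g :: "('m::{finite,linorder} uprod, 'k::field) mpoly"
  assumes "g \<in> minors_ge (r + 1) generic_sym"
  shows "r < total_degree g" "g \<in> minors generic_sym (total_degree g)"
    and "g \<in> symbolic_power (subst_kernel (sec r)) (total_degree g - r)"
proof -
  obtain t \<rho> \<gamma> where t: "t \<ge> r + 1" "g = minor generic_sym t \<rho> \<gamma>"
    "strict_mono_on {..<t} \<rho>" "strict_mono_on {..<t} \<gamma>"
    using assms by (auto simp: minors_ge_def minors_def)
  have deg: "total_degree g = t" using total_degree_minor[OF t(3,4)] t(2) by simp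
  show "r < total_degree g" using t(1) deg by simp
  show "g \<in> minors generic_sym (total_degree g)" using t deg by (auto simp: minors_def)
  then show "g \<in> symbolic_power (subst_kernel (sec r)) (total_degree g - r)"
    using minors_in_symbolic_power[of g r "t - r"] t(1) deg by simp
qed

lemma symbolic_power_prod:
  assumes P: "is_prime_ideal P" and "finite A" "\<And>i. i \<in> A \<Longrightarrow> f i \<in> symbolic_power P (n i)"
  shows "prod f A \<in> symbolic_power P (sum n A)"
  using assms(2,3)
proof (induction A rule: finite_induct)
  case empty
  show ?case using symbolic_powerI[OF P one_notin_prime[OF P], of 1 0] by simp
qed (auto intro: symbolic_power_mult[OF P])

text \<open>The alternatives mirror the two kinds of summands in differential perfection. Each
  factor has excess at least 1 over \<open>r\<close>, so splitting off the first of several factors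
  gives \<open>1 \<le> i < s\<close>.\<close>

lemma minor_products_cases:
  fixes g :: "('m::{finite,linorder} uprod, 'k::field) mpoly"
  assumes "g \<in> minor_products r s"
  obtains "g \<in> minors generic_sym (r + s)"
  | a b i where "1 \<le> i" "i < s" "g = a * b" "a \<in> symbolic_power (subst_kernel (sec r)) i"
    "b \<in> symbolic_power (subst_kernel (sec r)) (s - i)"
proof -
  obtain l :: nat and f where l: "l \<ge> 1"
    and f': "\<forall>i<l. f i \<in> minors_ge (r + 1) (generic_sym :: 'm \<Rightarrow> 'm \<Rightarrow> ('m uprod, 'k) mpoly)"
    and sum: "(\<Sum>i<l. int (total_degree (f i)) - int r) = int s" and g: "g = (\<Prod>i<l. f i)"
    using assms unfolding minor_products_def by blast
  have f: "f i \<in> minors_ge (r + 1) generic_sym" if "i < l" for i using f' that by blast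
  define n where "n i = total_degree (f i) - r" for i
  have n: "int (n i) = int (total_degree (f i)) - int r" "n i \<ge> 1" if "i < l" for i
    using minors_ge_Suc(1)[OF f[OF that]] by (auto simp: n_def)
  have "int (\<Sum>i<l. n i) = (\<Sum>i<l. int (total_degree (f i)) - int r)"
    unfolding of_nat_sum using n by (intro sum.cong) auto
  then have s: "(\<Sum>i<l. n i) = s" unfolding sum by (simp only: of_nat_eq_iff)
  obtain m where m: "l = Suc m" using l by (cases l) auto
  have rest: "s = n 0 + (\<Sum>i<m. n (Suc i))" "g = f 0 * (\<Prod>i<m. f (Suc i))"
    unfolding s[symmetric] g m
    by (simp_all only: sum.lessThan_Suc_shift prod.lessThan_Suc_shift)
  show ?thesis
  proof (cases "m = 0")
    case True
    then have "total_degree (f 0) = r + s" using minors_ge_Suc(1)[OF f[of 0]] rest(1) m by (simp add: n_def)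
    then show ?thesis using that(1) minors_ge_Suc(2)[OF f[of 0]] rest(2) m True by simp
  next
    case False
    have "n (Suc 0) \<le> (\<Sum>i<m. n (Suc i))" using False by (intro member_le_sum) auto
    then have "1 \<le> (\<Sum>i<m. n (Suc i))" using n(2)[of "Suc 0"] False m by simp
    moreover have "(\<Prod>i<m. f (Suc i)) \<in> symbolic_power (subst_kernel (sec r)) (\<Sum>i<m. n (Suc i))"
      unfolding n_def using minors_ge_Suc(3)[OF f] m
      by (intro symbolic_power_prod[OF is_prime_subst_kernel]) auto
    moreover have "f 0 \<in> symbolic_power (subst_kernel (sec r)) (n 0)"
      unfolding n_def using minors_ge_Suc(3)[OF f] m by auto
    moreover have "1 \<le> n 0" using n(2)[of 0] m by simp
    ultimately show ?thesis using that(2)[of "n 0" "f 0" "\<Prod>i<m. f (Suc i)"] rest by simp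
  qed
qed

lemma minor_products_subset:
  "minor_products r s \<subseteq> symbolic_power (subst_kernel (sec r) :: ('m::{finite,linorder} uprod, 'k::field) mpoly set) s"
proof
  fix g :: "('m uprod, 'k) mpoly" assume "g \<in> minor_products r s"
  then show "g \<in> symbolic_power (subst_kernel (sec r)) s"
  proof (cases rule: minor_products_cases)
    case 1
    then show ?thesis by (rule minors_in_symbolic_power)
  next
    case (2 a b i)
    then show ?thesis using symbolic_power_mult[OF is_prime_subst_kernel 2(4,5)] by simp
  qed
qed

section \<open>Finiteness of the set of products of minors\<close>

lemma finite_minors: "finite (minors A t)" for A :: "'m::{finite,linorder} \<Rightarrow> 'm \<Rightarrow> 'a::comm_ring_1"
proof -
  have "minors A t \<subseteq> (\<lambda>(xs, ys). minor A t ((!) xs) ((!) ys)) ` ({xs. length xs = t} \<times> {ys. length ys = t})"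
  proof
    fix g assume "g \<in> minors A t"
    then obtain \<rho> \<gamma> where "g = minor A t \<rho> \<gamma>" by (auto simp: minors_def)
    moreover have "minor A t \<rho> \<gamma> = minor A t ((!) (map \<rho> [0..<t])) ((!) (map \<gamma> [0..<t]))"
      unfolding minor_def by (intro arg_cong[where f = det] eq_matI) auto
    ultimately show "g \<in> (\<lambda>(xs, ys). minor A t ((!) xs) ((!) ys)) ` ({xs. length xs = t} \<times> {ys. length ys = t})"
      by (intro image_eqI[of _ _ "(map \<rho> [0..<t], map \<gamma> [0..<t])"]) auto
  qed
  moreover have "finite {xs :: 'm list. length xs = t}"
    using finite_lists_length_eq[of "UNIV :: 'm set" t] by simp
  ultimately show ?thesis by (meson finite_SigmaI finite_imageI finite_subset)
qed

lemma minors_empty: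
  assumes "card (UNIV :: 'm set) < t"
  shows "minors (A :: 'm::{finite,linorder} \<Rightarrow> 'm \<Rightarrow> 'a::comm_ring_1) t = {}"
proof -
  have False if "strict_mono_on {..<t} \<rho>" for \<rho> :: "nat \<Rightarrow> 'm"
    using card_inj_on_le[OF strict_mono_on_imp_inj_on[OF that], of UNIV] assms by simp
  then show ?thesis by (auto simp: minors_def)
qed

lemma finite_minors_ge: "finite (minors_ge r (A :: 'm::{finite,linorder} \<Rightarrow> 'm \<Rightarrow> 'a::comm_ring_1))"
proof -
  have "minors_ge r A \<subseteq> (\<Union>t\<le>card (UNIV :: 'm set). minors A t)"
    using minors_empty[of _ A] by (fastforce simp: minors_ge_def not_less[symmetric])
  then show ?thesis by (rule finite_subset) (auto intro: finite_minors)
qed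

lemma finite_minor_products: "finite (minor_products r s :: ('m::{finite,linorder} uprod, 'k::field) mpoly set)"
proof -
  let ?M = "minors_ge (r + 1) (generic_sym :: 'm \<Rightarrow> 'm \<Rightarrow> ('m uprod, 'k) mpoly)"
  have "minor_products r s \<subseteq> prod_list ` {xs. set xs \<subseteq> ?M \<and> length xs \<le> s}"
  proof
    fix g :: "('m uprod, 'k) mpoly" assume "g \<in> minor_products r s"
    then obtain l :: nat and f where f': "\<forall>i<l. f i \<in> ?M"
      and sum: "(\<Sum>i<l. int (total_degree (f i)) - int r) = int s" and g: "g = (\<Prod>i<l. f i)"
      unfolding minor_products_def by blast
    have f: "f i \<in> ?M" if "i < l" for i using f' that by blast
    \<comment> \<open>Every factor has degree above \<open>r\<close> and contributes at least 1, so
      there are at most \<open>s\<close> factors.\<close>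
    have "(\<Sum>i<l. 1) \<le> (\<Sum>i<l. int (total_degree (f i)) - int r)"
      using minors_ge_Suc(1)[OF f] by (intro sum_mono) force
    then have "l \<le> s" using sum by simp
    moreover have "g = prod_list (map f [0..<l])"
      by (simp add: g prod.distinct_set_conv_list[symmetric] atLeast0LessThan)
    ultimately show "g \<in> prod_list ` {xs. set xs \<subseteq> ?M \<and> length xs \<le> s}"
      using f by (intro image_eqI[of _ _ "map f [0..<l]"]) auto
  qed
  then show ?thesis
    by (rule finite_subset) (intro finite_imageI finite_lists_length_le finite_minors_ge)
qed

lemma count_list_sum_nth: "count_list c e = (\<Sum>a<length c. if c ! a = e then Suc 0 else 0)"
  by (simp add: count_list_eq_length_filter length_filter_conv_card sum.If_cases eq_commute Collect_conj_eq lessThan_def)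

lemma count_list_concat: "count_list (concat css) e = (\<Sum>i<length css. count_list (css ! i) e)"
proof -
  have "count_list (concat css) e = (\<Sum>c\<leftarrow>css. count_list c e)"
    by (induction css) auto
  then show ?thesis by (simp add: sum_list_sum_nth atLeast0LessThan)
qed

text \<open>Along a chain of \<open>uprec\<close> the left end points increase strictly and so do
  the right ones; they serve as rows and columns of a minor, whose diagonal monomial is the product
  of the chain.\<close>

lemma ex_minor_product_lead:
  fixes leq :: "'m::{finite,linorder} uprod monom \<Rightarrow> 'm uprod monom \<Rightarrow> bool"
  assumes diag: "diagonal_term_order TYPE('k::field) leq"
    and s: "s \<ge> 1"
    and css: "\<forall>c\<in>set css. sorted_wrt uprec c \<and> r < length c" "(\<Sum>c\<leftarrow>css. length c - r) = s"
  obtains g :: "('m uprod, 'k::field) mpoly" where "g \<in> minor_products r s" "g \<noteq> 0"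
    "\<And>e. lookup (lead_monom leq g) e = count_list (concat css) e"
proof -
  interpret monomial_order leq
    using diag by (auto simp: diagonal_term_order_def intro: term_order_monomial_order)
  define l where "l = length css"
  define \<rho> where "\<rho> i a = lo (css ! i ! a)" for i a
  define \<gamma> where "\<gamma> i a = hi (css ! i ! a)" for i a
  define t where "t i = length (css ! i)" for i
  define f :: "nat \<Rightarrow> ('m uprod, 'k) mpoly" where "f i = minor generic_sym (t i) (\<rho> i) (\<gamma> i)" for i
  have chain: "sorted_wrt uprec (css ! i)" "r < t i" if "i < l" for i
    using css(1) that by (auto simp: l_def t_def)
  have mono: "strict_mono_on {..<t i} (\<rho> i)" "strict_mono_on {..<t i} (\<gamma> i)" if "i < l" for i
    using sorted_wrt_nth_less[OF chain(1)[OF that]]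
    by (auto simp: strict_mono_on_def uprec_def t_def \<rho>_def \<gamma>_def)
  have ne: "f i \<noteq> 0" if "i < l" for i unfolding f_def by (rule minor_generic_sym_ne_0[OF mono[OF that]])
  have deg: "total_degree (f i) = t i" if "i < l" for i unfolding f_def by (rule total_degree_minor[OF mono[OF that]])
  have lead: "lookup (lead_monom leq (f i)) e = count_list (css ! i) e" if "i < l" for i e
  proof -
    have "lead_monom leq (f i) = (\<Sum>a<t i. single (Upair (\<rho> i a) (\<gamma> i a)) 1)"
      using diag mono[OF that] by (simp add: diagonal_term_order_def f_def)
    then show ?thesis
      by (simp add: \<rho>_def \<gamma>_def lookup_sum lookup_single when_def count_list_sum_nth t_def)
  qed
  show ?thesis
  proof (rule that[of "\<Prod>i<l. f i"])
    show "(\<Prod>i<l. f i) \<noteq> 0" using ne by (intro prod_ne_0) auto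
    show "lookup (lead_monom leq (\<Prod>i<l. f i)) e = count_list (concat css) e" for e
      using ne by (subst lead_monom_prod) (auto simp: lookup_sum lead count_list_concat l_def)
    have "f i \<in> minors_ge (r + 1) generic_sym" if "i < l" for i
      using chain(2)[OF that] mono[OF that] by (auto simp: minors_ge_def minors_def f_def intro!: bexI[of _ "t i"])
    moreover have "(\<Sum>i<l. int (total_degree (f i)) - int r) = int s"
    proof -
      have "(\<Sum>i<l. int (total_degree (f i)) - int r) = (\<Sum>i<l. int (t i - r))"
        using deg chain(2) by (intro sum.cong) (auto simp: of_nat_diff less_imp_le)
      also have "\<dots> = int s"
        using css(2) by (simp add: sum_list_sum_nth atLeast0LessThan l_def t_def flip: of_nat_sum)
      finally show ?thesis .
    qed
    moreover have "l \<ge> 1" using css(2) s by (cases css) (auto simp: l_def)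
    ultimately show "(\<Prod>i<l. f i) \<in> minor_products r s"
      unfolding minor_products_def by blast
  qed
qed

lemma lead_monom_symbolic_power_divisible:
  fixes f :: "('m::{finite,linorder} uprod, 'k::field) mpoly"
  assumes diag: "diagonal_term_order TYPE('k) leq" and "s \<ge> 1" "f \<noteq> 0"
    and "f \<in> symbolic_power (subst_kernel (sec r)) s"
  obtains g :: "('m uprod, 'k) mpoly" and w where "g \<in> minor_products r s" "g \<noteq> 0" "lead_monom leq f = w + lead_monom leq g"
proof -
  obtain css where css: "\<forall>c\<in>set css. sorted_wrt uprec c \<and> r < length c"
    "(\<Sum>c\<leftarrow>css. length c - r) = s" "\<And>e. count_list (concat css) e \<le> lookup (lead_monom leq f) e"
    using lead_monom_symbolic_power[OF diag assms(3,4)] by blast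
  obtain g :: "('m uprod, 'k) mpoly" where g: "g \<in> minor_products r s" "g \<noteq> 0"
    "\<And>e. lookup (lead_monom leq g) e = count_list (concat css) e"
    using ex_minor_product_lead[OF diag assms(2) css(1,2)] by metis
  have "lead_monom leq f = (lead_monom leq f - lead_monom leq g) + lead_monom leq g"
    using css(3) by (intro poly_mapping_eqI) (simp add: lookup_add lookup_minus g(3))
  then show ?thesis by (rule that[OF g(1,2)])
qed

text \<open>Division with respect to \<open>rank_order\<close>: subtracting a multiple of a
  generator with the same leading term lowers the leading monomial, so the number of monomials below
  it drops.\<close>

lemma symbolic_power_eq_span:
  assumes "s \<ge> 1"
  shows "symbolic_power (subst_kernel (sec r) :: ('m::{finite,linorder} uprod, 'k::field) mpoly set) s =
    ideal.span (minor_products r s)"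
proof (intro equalityI subsetI)
  let ?J = "subst_kernel (sec r) :: ('m uprod, 'k) mpoly set"
  have sub: "ideal.subspace (symbolic_power ?J s)" by (rule subspace_symbolic_power[OF is_prime_subst_kernel])
  show "f \<in> symbolic_power ?J s" if "f \<in> ideal.span (minor_products r s)" for f
    using that ideal.span_minimal[OF minor_products_subset sub] by blast
  interpret monomial_order "rank_order :: 'm uprod monom \<Rightarrow> _" by (rule rank_order_monomial_order)
  let ?lm = "lead_monom rank_order :: ('m uprod, 'k) mpoly \<Rightarrow> _"
  fix f :: "('m uprod, 'k) mpoly" assume "f \<in> symbolic_power ?J s"
  then show "f \<in> ideal.span (minor_products r s)"
  proof (induction "card {t. rank_order t (?lm f)}" arbitrary: f rule: less_induct)
    case less
    show ?case
    proof (cases "f = 0")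
      case False
      obtain g w where g: "g \<in> minor_products r s" "g \<noteq> 0" "?lm f = w + ?lm g"
        using lead_monom_symbolic_power_divisible[OF diagonal_rank_order assms False less.prems] .
      define c where "c = lookup f (?lm f) / lookup g (?lm g)"
      define h where "h = single w c * g"
      define f' where "f' = f - h"
      have hspan: "h \<in> ideal.span (minor_products r s)"
        unfolding h_def by (intro ideal.span_scale ideal.span_base g(1))
      have hJ: "h \<in> symbolic_power ?J s"
        unfolding h_def using g(1) minor_products_subset by (intro ideal.subspace_scale[OF sub]) auto
      have "lookup f (?lm f) \<noteq> 0" "lookup g (?lm g) \<noteq> 0"
        using lead_monom_in_keys[OF False] lead_monom_in_keys[OF g(2)] by (auto simp: in_keys_iff)
      then have c: "c \<noteq> 0" "c * lookup g (?lm g) = lookup f (?lm f)" by (auto simp: c_def)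
      have w: "single w c \<noteq> 0" "?lm (single w c) = w"
        using c(1) by (metis lookup_single_eq lookup_zero) (intro lead_monomI, auto simp: c(1) leq_refl)
      have lmh: "?lm h = ?lm f" unfolding h_def using lead_monom_mult[OF w(1) g(2)] w(2) g(3) by simp
      have "h \<noteq> 0" unfolding h_def using w(1) g(2) by simp
      have "lookup h (?lm f) = lookup f (?lm f)"
        unfolding h_def using lookup_lead_monom_mult[OF w(1) g(2)] w(2) g(3) c(2) by simp
      then have lmf': "lookup f' (?lm f) = 0" by (simp add: f'_def lookup_minus)
      have f': "f' \<in> symbolic_power ?J s"
        unfolding f'_def using less.prems hJ by (rule ideal.subspace_diff[OF sub])
      have "f' \<in> ideal.span (minor_products r s)"
      proof (cases "f' = 0")
        case False
        have "rank_order t (?lm f)" if "t \<in> keys f'" for t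
        proof -
          have "t \<in> keys f \<or> t \<in> keys h" using that by (auto simp: f'_def in_keys_iff lookup_minus)
          then show ?thesis
            using lead_monom_greatest[OF \<open>f \<noteq> 0\<close>, of t] lead_monom_greatest[OF \<open>h \<noteq> 0\<close>, of t] lmh by auto
        qed
        moreover have "?lm f' \<in> keys f'" by (rule lead_monom_in_keys[OF False])
        ultimately have "rank_order (?lm f') (?lm f)" "?lm f' \<noteq> ?lm f"
          using lmf' by (auto simp: in_keys_iff)
        then have "{t. rank_order t (?lm f')} \<subset> {t. rank_order t (?lm f)}"
          using leq_trans leq_antisym leq_refl by blast
        then have "card {t. rank_order t (?lm f')} < card {t. rank_order t (?lm f)}"
          by (intro psubset_card_mono finite_rank_order)
        then show ?thesis using less.hyps f' by blast
      qed (simp add: ideal.span_zero)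
      then have "f' + h \<in> ideal.span (minor_products r s)" using hspan by (rule ideal.span_add)
      then show ?thesis by (simp add: f'_def)
    qed (simp add: ideal.span_zero)
  qed
qed

lemma groebner_minor_products:
  assumes diag: "diagonal_term_order TYPE('k::field) (leq :: 'm::{finite,linorder} uprod monom \<Rightarrow> _)" and s: "s \<ge> 1"
  shows "is_groebner_basis leq (minor_products r s :: ('m uprod, 'k) mpoly set) (symbolic_power (subst_kernel (sec r)) s)"
proof -
  let ?J = "symbolic_power (subst_kernel (sec r) :: ('m uprod, 'k) mpoly set) s"
  have "initial_ideal leq (minor_products r s) \<subseteq> initial_ideal leq ?J"
    unfolding initial_ideal_def using minor_products_subset by (intro ideal.span_mono) blast
  moreover have "initial_ideal leq ?J \<subseteq> initial_ideal leq (minor_products r s)"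
    unfolding initial_ideal_def[of leq ?J]
  proof (rule ideal.span_minimal)
    show "ideal.subspace (initial_ideal leq (minor_products r s :: ('m uprod, 'k) mpoly set))"
      by (simp add: initial_ideal_def)
    show "(\<lambda>f. single (lead_monom leq f) 1) ` (?J - {0}) \<subseteq>
        initial_ideal leq (minor_products r s :: ('m uprod, 'k) mpoly set)"
    proof (rule image_subsetI)
      fix f :: "('m uprod, 'k) mpoly" assume "f \<in> ?J - {0}"
      then have "f \<in> ?J" "f \<noteq> 0" by auto
      then obtain g :: "('m uprod, 'k) mpoly" and w where g: "g \<in> minor_products r s" "g \<noteq> 0" "lead_monom leq f = w + lead_monom leq g"
        using lead_monom_symbolic_power_divisible[OF diag s] by metis
      have "single w 1 * single (lead_monom leq g) 1 \<in>
          initial_ideal leq (minor_products r s :: ('m uprod, 'k) mpoly set)"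
        unfolding initial_ideal_def using g(1,2)
        by (intro ideal.span_scale ideal.span_base imageI) auto
      then show "single (lead_monom leq f) 1 \<in>
          initial_ideal leq (minor_products r s :: ('m uprod, 'k) mpoly set)"
        by (simp add: mult_single g(3))
    qed
  qed
  ultimately show ?thesis
    unfolding is_groebner_basis_def
    by (intro conjI finite_minor_products minor_products_subset equalityI)
qed

section \<open>Sums of ideals and differential perfection\<close>

lemma subspace_sum_sets:
  "(\<And>i. i \<in> A \<Longrightarrow> ideal.subspace (S i)) \<Longrightarrow> ideal.subspace (\<Sum>i\<in>A. S i)"
  by (induction A rule: infinite_finite_induct) (auto intro: subspace_set_plus simp: set_zero)

lemma mem_sum_sets:
  assumes "finite A" "\<And>i. i \<in> A \<Longrightarrow> ideal.subspace (S i)" "i \<in> A" "x \<in> S i"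
  shows "x \<in> (\<Sum>i\<in>A. S i)"
  unfolding sum.remove[OF assms(1,3)]
  by (intro subspace_plus_I1 subspace_sum_sets assms) auto

lemma set_plus_subset:
  "ideal.subspace W \<Longrightarrow> A \<subseteq> W \<Longrightarrow> B \<subseteq> W \<Longrightarrow> A + B \<subseteq> W"
  using ideal.subspace_add[of W] by (blast elim: set_plus_elim)

lemma sum_sets_subset:
  assumes "ideal.subspace W" "\<And>i. i \<in> A \<Longrightarrow> S i \<subseteq> W"
  shows "(\<Sum>i\<in>A. S i) \<subseteq> W"
  using assms(2)
proof (induction A rule: infinite_finite_induct)
  case (insert x F)
  then show ?case by (simp add: set_plus_subset[OF assms(1)])
qed (use ideal.subspace_0[OF assms(1)] in \<open>auto simp: set_zero\<close>)

text \<open>One inclusion is checked on generators: a product is either a single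
  \<open>(r + s)\<close>-minor, which lies in the secant ideal of index \<open>r + s - 1\<close>, or
  it splits into elements of two complementary symbolic powers.\<close>

lemma differentially_perfect_sym_minor_ideal:
  "differentially_perfect (sym_minor_ideal :: ('m::{finite,linorder} uprod, 'k::field) mpoly set)"
  unfolding differentially_perfect_def r_differentially_perfect_def
proof (intro allI impI)
  fix r s :: nat assume r: "r \<ge> 1" and s: "s \<ge> 1"
  let ?J = "\<lambda>r. subst_kernel (sec r) :: ('m uprod, 'k) mpoly set"
  let ?M = "\<lambda>i. ideal_mult (symbolic_power (?J r) i) (symbolic_power (?J r) (s - i))"
  let ?R = "?J (r + s - 1) + (\<Sum>i = 1..s - 1. ?M i)"
  have subM: "ideal.subspace (?M i)" for i by (simp add: ideal_mult_def)
  have subR: "ideal.subspace ?R"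
    by (intro subspace_set_plus subspace_subst_kernel subspace_sum_sets subM)
  have subJ: "ideal.subspace (symbolic_power (?J r) s)"
    by (rule subspace_symbolic_power[OF is_prime_subst_kernel])
  have "symbolic_power (?J r) s \<subseteq> ?R"
    unfolding symbolic_power_eq_span[OF s]
  proof (rule ideal.span_minimal[OF _ subR], rule subsetI)
    fix g :: "('m uprod, 'k) mpoly" assume "g \<in> minor_products r s"
    then show "g \<in> ?R"
    proof (cases rule: minor_products_cases)
      case 1
      then have "g \<in> ?J (r + s - 1)"
        using minor_Suc_in_kernel[of "r + s - 1"] s by (auto simp: minors_def)
      then show ?thesis by (intro subspace_plus_I1 subspace_sum_sets subM)
    next
      case (2 a b i)
      then have "g \<in> ?M i" by (auto intro: ideal_mult_I)
      then show ?thesis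
        using 2(1,2) by (intro subspace_plus_I2 subspace_subst_kernel mem_sum_sets[of _ ?M i] subM) auto
    qed
  qed
  moreover have "?R \<subseteq> symbolic_power (?J r) s"
  proof -
    \<comment> \<open>The secant ideal lies in its first symbolic power, which is spanned by the
      products of total excess 1 over \<open>r + s - 1\<close>. These are single
      \<open>(r + s)\<close>-minors, since a splitting would need
      \<open>1 \<le> i < 1\<close>.\<close>
    have "?J (r + s - 1) \<subseteq> symbolic_power (?J (r + s - 1)) 1"
      using prime_le_symbolic_power_1[OF is_prime_subst_kernel] by blast
    also have "\<dots> = ideal.span (minor_products (r + s - 1) 1)" by (rule symbolic_power_eq_span) simp
    also have "\<dots> \<subseteq> symbolic_power (?J r) s"
    proof (rule ideal.span_minimal[OF _ subJ], rule subsetI)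
      fix g :: "('m uprod, 'k) mpoly" assume "g \<in> minor_products (r + s - 1) 1"
      then have "g \<in> minors generic_sym (r + s)"
        using s by (cases rule: minor_products_cases) auto
      then show "g \<in> symbolic_power (?J r) s" by (rule minors_in_symbolic_power)
    qed
    finally have "?J (r + s - 1) \<subseteq> symbolic_power (?J r) s" .
    moreover have "?M i \<subseteq> symbolic_power (?J r) s" if "i \<in> {1..s - 1}" for i
      using symbolic_power_mult[OF is_prime_subst_kernel, of _ "sec r" i _ "s - i"] that
      by (intro ideal_mult_subset[OF subJ]) force
    ultimately show ?thesis
      by (intro set_plus_subset[OF subJ] sum_sets_subset[OF subJ])
  qed
  ultimately show "symbolic_power (secant_ideal sym_minor_ideal r) s =
      secant_ideal (sym_minor_ideal :: ('m uprod, 'k) mpoly set) (r + s - 1) +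
      (\<Sum>i = 1..s - 1. ideal_mult (symbolic_power (secant_ideal sym_minor_ideal r) i)
        (symbolic_power (secant_ideal sym_minor_ideal r) (s - i)))"
    using r s by (simp add: secant_sym_minor_ideal)
qed

theorem theorem5p8:
  shows "differentially_perfect
           (sym_minor_ideal :: ('m::{finite,linorder} uprod, 'k::alg_closed_field) mpoly set) \<and>
    (\<forall>r\<ge>1. \<forall>s\<ge>1. \<forall>leq. diagonal_term_order TYPE('k) leq \<longrightarrow>
       is_groebner_basis leq
         {\<Prod>i<l. f i | (l::nat) f.
            l \<ge> 1 \<and>
            (\<forall>i<l. f i \<in> minors_ge (r + 1)
                     (generic_sym :: 'm \<Rightarrow> 'm \<Rightarrow> ('m uprod, 'k) mpoly)) \<and>
            (\<Sum>i<l. int (total_degree (f i)) - int r) = int s}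
         (symbolic_power (secant_ideal sym_minor_ideal r) s))"
proof (intro conjI allI impI)
  show "differentially_perfect (sym_minor_ideal :: ('m uprod, 'k) mpoly set)"
    by (rule differentially_perfect_sym_minor_ideal)
  fix r s :: nat and leq :: "'m uprod monom \<Rightarrow> 'm uprod monom \<Rightarrow> bool"
  assume r: "1 \<le> r" and s: "1 \<le> s" and diag: "diagonal_term_order TYPE('k) leq"
  show "is_groebner_basis leq
         {\<Prod>i<l. f i | (l::nat) f.
            l \<ge> 1 \<and>
            (\<forall>i<l. f i \<in> minors_ge (r + 1)
                     (generic_sym :: 'm \<Rightarrow> 'm \<Rightarrow> ('m uprod, 'k) mpoly)) \<and>
            (\<Sum>i<l. int (total_degree (f i)) - int r) = int s}
         (symbolic_power (secant_ideal sym_minor_ideal r) s)"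
    unfolding secant_sym_minor_ideal[OF r] minor_products_def[symmetric]
    by (rule groebner_minor_products[OF diag s])
qed

end
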